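(* Let $r\ge 2$ be an integer, let $j\in\{1,\dots,r\}$ and let $n_j\in\mathbb{N}_0$. Then, as an identity of meromorphic functions of the variables $s_i$ ($i\neq j$), \begin{align*} &\zeta_r(s_1,\dots,s_{j-1},-n_j,s_{j+1},\dots,s_r)\\ &=-(1-\delta_{j1})\frac{1}{n_j+1}\zeta_{r-1}(s_1,\dots,s_{j-2},s_{j-1}-n_j-1,s_{j+1},\dots,s_r)\\ &\quad+(1-\delta_{jr})\frac{1}{n_j+1}\zeta_{r-1}(s_1,\dots,s_{j-1},-n_j+s_{j+1}-1,s_{j+2},\dots,s_r)\\ &\quad+(1-\delta_{j1})\sum_{k=0}^{n_j}\binom{n_j}{k}\zeta_{r-1}(s_1,\dots,s_{j-2},s_{j-1}-n_j+k,s_{j+1},\dots,s_r)\zeta(-k)\\ &\quad-(1-\delta_{jr})\sum_{k=0}^{n_j}\binom{n_j}{k}\zeta_{r-1}(s_1,\dots,s_{j-1},-n_j+s_{j+1}+k,s_{j+2},\dots,s_r)\zeta(-k)\\ &\quad+\delta_{j1}(1-\delta_{jr})\,\zeta_j(s_1,\dots,s_{j-1},-n_j)\,\zeta_{r-j}(s_{j+1},\dots,s_r)\\ &\quad+(\delta_{jr}-1)\,\zeta_{r-1}(s_1,\dots,s_{j-1},-n_j+s_{j+1},s_{j+2},\dots,s_r), \end{align*} where $\delta$ is the Kronecker delta and terms whose coefficient vanishes (which are exactly those that would involve the nonexistent variables $s_0$ or $s_{r+1}$) are omitted.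
   Context: For a positive integer $r$, $\zeta_r(s_1,\dots,s_r)=\sum_{0<m_1<\cdots<m_r} m_1^{-s_1}\cdots m_r^{-s_r}$ is the Euler–Zagier multiple zeta function, meromorphically continued to $\mathbb{C}^r$; $\zeta=\zeta_1$ is the Riemann zeta function. For $j=1$, the term $\zeta_j(s_1,\dots,s_{j-1},-n_j)$ means $\zeta(-n_1)$. *)

theory Defs
  imports "HOL-Analysis.Analysis"
begin

text \<open>
  The dimension \<open>r\<close> varies inside the statement, so the complex affine space with coordinates
  indexed by \<open>I\<close> is the topological space on the extensional functions \<open>I \<rightarrow>\<^sub>E UNIV\<close>.
  The \<open>r\<close>-dimensional space is \<open>cspace {1..r}\<close>.
\<close>

definition cspace :: "nat set \<Rightarrow> (nat \<Rightarrow> complex) topology"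
  where "cspace I = product_topology (\<lambda>_. euclidean) I"

lemma topspace_cspace [simp]: "topspace (cspace I) = I \<rightarrow>\<^sub>E UNIV"
  by (simp add: cspace_def)

text \<open>Holomorphic functions of several variables: continuous, and holomorphic in each variable.\<close>

definition holo_on :: "nat set \<Rightarrow> (nat \<Rightarrow> complex) set \<Rightarrow> ((nat \<Rightarrow> complex) \<Rightarrow> complex) \<Rightarrow> bool"
  where "holo_on I U f \<longleftrightarrow>
    openin (cspace I) U \<and>
    continuous_map (subtopology (cspace I) U) euclidean f \<and>
    (\<forall>s\<in>U. \<forall>i\<in>I. (\<lambda>z. f (s(i := z))) field_differentiable at (s i))"

definition agree_densely ::
    "nat set \<Rightarrow> (nat \<Rightarrow> complex) set \<Rightarrow> ((nat \<Rightarrow> complex) \<Rightarrow> complex) \<Rightarrow> ((nat \<Rightarrow> complex) \<Rightarrow> complex) \<Rightarrow> bool"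
  where "agree_densely I U f g \<longleftrightarrow>
    (\<exists>W. openin (cspace I) W \<and> W \<subseteq> U \<and> U \<subseteq> cspace I closure_of W \<and> (\<forall>s\<in>W. f s = g s))"

text \<open>
  A meromorphic function is represented by a total function that is locally a quotient \<open>g / h\<close>
  of holomorphic functions, \<open>h\<close> vanishing identically on no nonempty open set; the values of the
  representative where \<open>h\<close> vanishes are unconstrained. Accordingly, two representatives are equal
  as meromorphic functions iff they agree on a dense open set.
\<close>

definition mero :: "nat set \<Rightarrow> ((nat \<Rightarrow> complex) \<Rightarrow> complex) \<Rightarrow> bool"
  where "mero I f \<longleftrightarrow>
    (\<forall>p\<in>topspace (cspace I). \<exists>U g h. p \<in> U \<and> holo_on I U g \<and> holo_on I U h \<and>
       U \<subseteq> cspace I closure_of {s \<in> U. h s \<noteq> 0} \<and>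
       (\<forall>s\<in>U. h s \<noteq> 0 \<longrightarrow> f s = g s / h s))"

definition mero_eq :: "nat set \<Rightarrow> ((nat \<Rightarrow> complex) \<Rightarrow> complex) \<Rightarrow> ((nat \<Rightarrow> complex) \<Rightarrow> complex) \<Rightarrow> bool"
  where "mero_eq I f g \<longleftrightarrow> mero I f \<and> mero I g \<and> agree_densely I (topspace (cspace I)) f g"

text \<open>
  The canonical representative: holomorphic near every point to which it extends
  holomorphically, and \<open>0\<close> at the other points (compare \<open>nicely_meromorphic_on\<close> in one variable).
  This makes the restriction to a hyperplane not contained in the polar set the right one.
\<close>

definition nicely_mero :: "nat set \<Rightarrow> ((nat \<Rightarrow> complex) \<Rightarrow> complex) \<Rightarrow> bool"
  where "nicely_mero I f \<longleftrightarrow> mero I f \<and>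
    (\<forall>p\<in>topspace (cspace I).
       (\<exists>U. p \<in> U \<and> holo_on I U f) \<or>
       (f p = 0 \<and> \<not> (\<exists>U g. p \<in> U \<and> holo_on I U g \<and> agree_densely I U f g)))"

definition mzeta_series :: "nat \<Rightarrow> (nat \<Rightarrow> complex) \<Rightarrow> complex"
  where "mzeta_series r s =
    (\<Sum>\<^sub>\<infinity>m\<in>{m \<in> {1..r} \<rightarrow>\<^sub>E {1..}. strict_mono_on {1..r} m}.
       \<Prod>i=1..r. complex_of_nat (m i) powr (- s i))"

text \<open>The domain of absolute convergence of the Euler--Zagier series.\<close>

definition mzeta_dom :: "nat \<Rightarrow> (nat \<Rightarrow> complex) set"
  where "mzeta_dom r =
    {s \<in> {1..r} \<rightarrow>\<^sub>E UNIV. \<forall>k\<in>{1..r}. Re (\<Sum>i=k..r. s i) > real (r + 1 - k)}"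

text \<open>
  By the identity theorem, the meromorphic continuation \<open>F\<close> below is unique on
  \<open>{1..r} \<rightarrow>\<^sub>E UNIV\<close>. The argument of \<open>mzeta\<close> is the list \<open>[s\<^sub>1, \<dots>, s\<^sub>r]\<close>, whose length is the depth.
\<close>

definition mzeta_cont :: "nat \<Rightarrow> (nat \<Rightarrow> complex) \<Rightarrow> complex"
  where "mzeta_cont r =
    (SOME F. nicely_mero {1..r} F \<and> (\<forall>s\<in>mzeta_dom r. F s = mzeta_series r s))"

definition mzeta :: "complex list \<Rightarrow> complex"
  where "mzeta xs = mzeta_cont (length xs) (\<lambda>i\<in>{1..length xs}. xs ! (i - 1))"

abbreviation zeta :: "complex \<Rightarrow> complex"
  where "zeta z \<equiv> mzeta [z]"

text \<open>The list \<open>[s\<^sub>a, \<dots>, s\<^sub>b]\<close>, empty if \<open>b < a\<close>.\<close>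

abbreviation seg :: "(nat \<Rightarrow> complex) \<Rightarrow> nat \<Rightarrow> nat \<Rightarrow> complex list"
  where "seg s a b \<equiv> map s [a..<Suc b]"

definition kdelta :: "nat \<Rightarrow> nat \<Rightarrow> complex"
  where "kdelta a b = (if a = b then 1 else 0)"

end

(*
  Write w = 1 - s_r and let e_K(s_r, m) be the error of the K-term Euler--Maclaurin telescoping of
  m^(-s_r), which is O(m^(-Re s_r - K)). Summing over the last index expresses (s_r - 1) zeta_r
  as a combination of the zeta_(r-1)(s_1, ..., s_(r-1) + s_r - 1 + i), i < K, plus a remainder
  converging on the domain of zeta_r with s_r replaced by s_r + K. Inductively zeta_r is a quotient
  of entire functions, the denominator being (s_r - 1) times a product of reciprocal Gamma factors
  in the s_k + ... + s_r with k < r. At s_r = -n and K > n the remainder vanishes, which is the case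
  j = r. For j < r the hyperplane s_j = -n meets the domain of absolute convergence, the sum over
  m_j is given by Faulhaber's formula, and the identity theorem extends the result. Holomorphy in each
  variable separately together with continuity suffices, because all substitutions that occur
  change one coordinate at a time.
*)
theory Submission
  imports Defs "HOL-Complex_Analysis.Complex_Analysis" "HOL-Real_Asymp.Real_Asymp"
begin


section \<open>Several complex variables\<close>

text \<open>The value of \<open>mzeta_cont\<close>, a Hilbert choice, at a point of the hyperplane
  s_j = -n is accessible only through a quotient of entire functions whose denominator is nonzero
  there. Hence the numerator and denominator are constructed explicitly, and canonical
  representatives are compared with such quotients. For j = r the hyperplane misses the domain of
  convergence, where Re s_r > 1, so nothing can be read off the series and the numerator itself has
  to be evaluated. The possible poles fill infinitely many parallel hyperplanes. The reciprocal
  Gamma function vanishes on a whole family at once, and its functional equation absorbs the shifts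
  by i, so one denominator serves every K. No single K reaches all points; the numerator picks K
  pointwise, and independence of K glues the pieces. With B_1 = 1/2 the Bernoulli numbers fit sums
  that include their upper end, and zeta(-k) = -B_(k+1)/(k+1) holds for k = 0 as well, which gives
  the uniform sums over k. The sum over m_j excludes its upper end m_(j+1); this costs the last term
  of the identity.\<close>

definition polydisc :: "nat set \<Rightarrow> (nat \<Rightarrow> complex) \<Rightarrow> real \<Rightarrow> (nat \<Rightarrow> complex) set"
  where "polydisc I p e = (\<Pi>\<^sub>E i\<in>I. ball (p i) e)"

lemma mem_polydisc:
  "s \<in> polydisc I p e \<longleftrightarrow> s \<in> extensional I \<and> (\<forall>i\<in>I. dist (p i) (s i) < e)"
  by (auto simp: polydisc_def PiE_def)

lemma openin_cspace_PiE:
  assumes "finite I" "\<And>i. i \<in> I \<Longrightarrow> open (D i)"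
  shows "openin (cspace I) (Pi\<^sub>E I D)"
  using assms by (auto simp: cspace_def openin_PiE_gen)

text \<open>For a finite index set the radii in the single coordinates have a positive minimum, so
  polydiscs form a neighbourhood base.\<close>

lemma openin_cspace_iff:
  assumes "finite I"
  shows "openin (cspace I) U \<longleftrightarrow> U \<subseteq> extensional I \<and> (\<forall>p\<in>U. \<exists>e>0. polydisc I p e \<subseteq> U)"
proof safe
  fix x assume "openin (cspace I) U" "x \<in> U"
  then show "x \<in> extensional I"
    using openin_subset by (fastforce simp: PiE_def)
next
  fix p assume "openin (cspace I) U" "p \<in> U"
  then obtain D where D: "\<And>i. i \<in> I \<Longrightarrow> open (D i)" "p \<in> Pi\<^sub>E I D" "Pi\<^sub>E I D \<subseteq> U"
    unfolding cspace_def openin_product_topology_alt by auto metis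
  then have "\<forall>i\<in>I. \<exists>e>0. ball (p i) e \<subseteq> D i"
    by (metis PiE_E openE)
  then obtain e where e: "\<And>i. i \<in> I \<Longrightarrow> e i > 0 \<and> ball (p i) (e i) \<subseteq> D i"
    by metis
  \<comment> \<open>The inserted 1 keeps the minimum defined when I is empty.\<close>
  define d where "d = Min (insert 1 (e ` I))"
  have d: "d > 0" "\<And>i. i \<in> I \<Longrightarrow> d \<le> e i"
    using assms e by (auto simp: d_def)
  have "polydisc I p d \<subseteq> Pi\<^sub>E I D"
    unfolding polydisc_def
    by (rule PiE_mono) (use d(2) e in \<open>force intro: order_trans[OF subset_ball]\<close>)
  with D d show "\<exists>e>0. polydisc I p e \<subseteq> U" by blast
next
  assume U: "U \<subseteq> extensional I" "\<forall>p\<in>U. \<exists>e>0. polydisc I p e \<subseteq> U"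
  show "openin (cspace I) U"
  proof (subst openin_subopen, intro ballI)
    fix p assume p: "p \<in> U"
    then obtain e where e: "e > 0" "polydisc I p e \<subseteq> U" using U by blast
    have "openin (cspace I) (polydisc I p e)"
      unfolding polydisc_def by (rule openin_cspace_PiE) (use assms in auto)
    moreover have "p \<in> polydisc I p e"
      using p U e by (auto simp: mem_polydisc)
    ultimately show "\<exists>T. openin (cspace I) T \<and> p \<in> T \<and> T \<subseteq> U" using e by blast
  qed
qed

lemma openin_polydisc: "finite I \<Longrightarrow> openin (cspace I) (polydisc I p e)"
  unfolding polydisc_def by (rule openin_cspace_PiE) auto

lemma polydisc_centre: "p \<in> extensional I \<Longrightarrow> e > 0 \<Longrightarrow> p \<in> polydisc I p e"
  by (auto simp: mem_polydisc)

lemma holo_onD: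
  assumes "holo_on I U f"
  shows "openin (cspace I) U" "continuous_map (subtopology (cspace I) U) euclidean f"
    "\<And>s i. s \<in> U \<Longrightarrow> i \<in> I \<Longrightarrow> (\<lambda>z. f (s(i := z))) field_differentiable at (s i)"
  using assms by (auto simp: holo_on_def)

lemma holo_on_subset:
  assumes "holo_on I U f" "openin (cspace I) V" "V \<subseteq> U"
  shows "holo_on I V f"
  using assms unfolding holo_on_def
  by (meson continuous_map_from_subtopology_mono subsetD)

lemma holo_on_const: "openin (cspace I) U \<Longrightarrow> holo_on I U (\<lambda>_. c)"
  by (auto simp: holo_on_def)

lemma holo_on_coord:
  assumes "openin (cspace I) U" "i \<in> I"
  shows "holo_on I U (\<lambda>s. s i)"
proof -
  have "continuous_map (cspace I) euclidean (\<lambda>s. s i)"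
    unfolding cspace_def by (rule continuous_map_product_projection[OF assms(2)])
  moreover have "(\<lambda>z. (s(k := z)) i) field_differentiable at (s k)" for s k
    by (cases "k = i") (auto simp: field_differentiable_ident)
  ultimately show ?thesis
    using assms by (auto simp: holo_on_def intro: continuous_map_from_subtopology)
qed

lemma holo_on_add:
  assumes "holo_on I U f" "holo_on I U g"
  shows "holo_on I U (\<lambda>s. f s + g s)"
  using assms unfolding holo_on_def
  by (auto intro!: continuous_map_add field_differentiable_add)

lemma continuous_map_mult_complex:
  fixes f g :: "'a \<Rightarrow> complex"
  assumes "continuous_map X euclidean f" "continuous_map X euclidean g"
  shows "continuous_map X euclidean (\<lambda>x. f x * g x)"
  using assms by (auto simp: continuous_map_atin limitin_canonical_iff intro: tendsto_mult)

lemma holo_on_mult: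
  assumes "holo_on I U f" "holo_on I U g"
  shows "holo_on I U (\<lambda>s. f s * g s)"
  using assms unfolding holo_on_def
  by (auto intro!: continuous_map_mult_complex field_differentiable_mult)

lemma holo_on_diff:
  assumes "holo_on I U f" "holo_on I U g"
  shows "holo_on I U (\<lambda>s. f s - g s)"
proof -
  have "holo_on I U (\<lambda>s. f s + (-1) * g s)"
    using assms holo_on_const[of I U "-1"]
    by (intro holo_on_add holo_on_mult) (auto dest: holo_onD)
  then show ?thesis by simp
qed

lemma holo_on_sum:
  assumes "openin (cspace I) U" "\<And>k. k \<in> K \<Longrightarrow> holo_on I U (f k)"
  shows "holo_on I U (\<lambda>s. \<Sum>k\<in>K. f k s)"
  using assms(2)
  by (induction K rule: infinite_finite_induct) (auto intro: holo_on_add holo_on_const assms)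

lemma holo_on_prod:
  assumes "openin (cspace I) U" "\<And>k. k \<in> K \<Longrightarrow> holo_on I U (f k)"
  shows "holo_on I U (\<lambda>s. \<Prod>k\<in>K. f k s)"
  using assms(2)
  by (induction K rule: infinite_finite_induct) (auto intro: holo_on_mult holo_on_const assms)

lemma holo_on_compose_1:
  assumes f: "holo_on I U f" and \<phi>: "\<phi> holomorphic_on A" "open A" and fU: "\<And>s. s \<in> U \<Longrightarrow> f s \<in> A"
  shows "holo_on I U (\<lambda>s. \<phi> (f s))"
proof -
  have "continuous_map (top_of_set A) euclidean \<phi>"
    using \<phi> holomorphic_on_imp_continuous_on by auto
  moreover have "continuous_map (subtopology (cspace I) U) (top_of_set A) f"
    using holo_onD[OF f] fU by (auto simp: continuous_map_in_subtopology)
  ultimately have "continuous_map (subtopology (cspace I) U) euclidean (\<phi> \<circ> f)"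
    by (rule continuous_map_compose[rotated])
  moreover have "(\<lambda>z. \<phi> (f (s(i := z)))) field_differentiable at (s i)" if "s \<in> U" "i \<in> I" for s i
  proof -
    have "\<phi> field_differentiable at (f (s(i := s i)))"
      using \<phi> fU[OF that(1)] holomorphic_on_imp_differentiable_at by auto
    then show ?thesis
      using field_differentiable_compose[OF holo_onD(3)[OF f that]] by (simp add: o_def)
  qed
  ultimately show ?thesis
    using holo_onD[OF f] by (auto simp: holo_on_def o_def)
qed

lemma openin_vanishing_complement:
  assumes "holo_on I U h"
  shows "openin (cspace I) {s\<in>U. h s \<noteq> 0}"
proof -
  have top: "topspace (subtopology (cspace I) U) = U"
    using holo_onD(1)[OF assms] by (metis openin_subset topspace_subtopology_subset)
  have "openin (subtopology (cspace I) U) {x \<in> topspace (subtopology (cspace I) U). h x \<in> - {0}}"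
    using holo_onD(2)[OF assms] by (rule openin_continuous_map_preimage) auto
  then have "openin (subtopology (cspace I) U) {x \<in> U. h x \<noteq> 0}"
    unfolding top by simp
  then show ?thesis
    using openin_open_subtopology[OF holo_onD(1)[OF assms]] by metis
qed

lemma holo_on_divide:
  assumes "holo_on I U g" "holo_on I U h" "\<And>s. s \<in> U \<Longrightarrow> h s \<noteq> 0"
  shows "holo_on I U (\<lambda>s. g s / h s)"
proof -
  have "holo_on I U (\<lambda>s. inverse (h s))"
    by (rule holo_on_compose_1[OF assms(2), of inverse "-{0}"])
       (use assms in \<open>auto intro!: holomorphic_intros\<close>)
  from holo_on_mult[OF assms(1) this] show ?thesis by (simp add: field_simps)
qed

lemma holo_on_cong:
  assumes "\<And>s. s \<in> U \<Longrightarrow> f s = g s" "finite I" "holo_on I U f"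
  shows "holo_on I U g"
proof -
  have "topspace (subtopology (cspace I) U) = U"
    using holo_onD(1)[OF assms(3)] by (metis openin_subset topspace_subtopology_subset)
  then have "continuous_map (subtopology (cspace I) U) euclidean g"
    using assms(1) holo_onD(2)[OF assms(3)] by (metis (no_types, lifting) continuous_map_eq)
  moreover have "(\<lambda>z. g (s(i := z))) field_differentiable at (s i)" if si: "s \<in> U" "i \<in> I" for s i
  proof -
    obtain e where e: "e > 0" "polydisc I s e \<subseteq> U"
      using holo_onD(1)[OF assms(3)] si openin_cspace_iff[OF assms(2)] by metis
    have "s \<in> extensional I"
      using holo_onD(1)[OF assms(3)] si openin_cspace_iff[OF assms(2)] by auto
    then have "f (s(i := z)) = g (s(i := z))" if "z \<in> ball (s i) e" for z
      using that \<open>i \<in> I\<close> e by (intro assms(1) subsetD[OF e(2)]) (auto simp: mem_polydisc extensional_def)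
    then show ?thesis
      using holo_onD(3)[OF assms(3) si] e(1)
      by (auto intro: field_differentiable_transform_within[of e _ UNIV "\<lambda>z. f (s(i := z))"] simp: dist_commute)
  qed
  ultimately show ?thesis using holo_onD[OF assms(3)] by (auto simp: holo_on_def)
qed

text \<open>Holomorphy is local. This glues the pieces of the continuation that live on the domains
  \<open>em_dom r K\<close>.\<close>

lemma holo_on_localI:
  assumes "finite I" "U \<subseteq> extensional I"
    and "\<And>p. p \<in> U \<Longrightarrow> \<exists>V. p \<in> V \<and> V \<subseteq> U \<and> holo_on I V f"
  shows "holo_on I U f"
proof -
  obtain V where V: "\<And>p. p \<in> U \<Longrightarrow> p \<in> V p \<and> V p \<subseteq> U \<and> holo_on I (V p) f"
    using assms(3) by metis
  have o: "openin (cspace I) U"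
  proof (subst openin_subopen, intro ballI exI conjI)
    fix p assume "p \<in> U"
    then show "openin (cspace I) (V p)" "p \<in> V p" "V p \<subseteq> U"
      using V[of p] holo_onD(1)[of I "V p" f] by auto
  qed
  have top: "topspace (subtopology (cspace I) U) = U"
    using o by (metis openin_subset topspace_subtopology_subset)
  have "continuous_map (subtopology (cspace I) U) euclidean f"
  proof (rule pasting_lemma[where I = U and T = V and f = "\<lambda>_. f"])
    show "openin (subtopology (cspace I) U) (V p)" if "p \<in> U" for p
      using V[OF that] o holo_onD(1)[of I "V p" f] by (simp add: openin_open_subtopology)
    show "continuous_map (subtopology (subtopology (cspace I) U) (V p)) euclidean f" if "p \<in> U" for p
      using V[OF that] holo_onD(2)[of I "V p" f] by (simp add: subtopology_subtopology inf.absorb2)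
    show "\<exists>j. j \<in> U \<and> x \<in> V j \<and> f x = f x" if "x \<in> topspace (subtopology (cspace I) U)" for x
      using that V unfolding top by blast
  qed auto
  then show ?thesis using o V holo_onD(3) unfolding holo_on_def by blast
qed

text \<open>By \<open>sep\<close>, moving one variable moves the image along a line parallel to a
  coordinate axis, so the one-variable chain rule replaces joint differentiability of G.\<close>

lemma holo_on_compose:
  assumes G: "holo_on J V G" and J: "finite J" and U: "openin (cspace I) U"
    and L: "\<And>s. s \<in> U \<Longrightarrow> L s \<in> V"
    and coord: "\<And>j. j \<in> J \<Longrightarrow> holo_on I U (\<lambda>s. L s j)"
    and sep: "\<And>i s. i \<in> I \<Longrightarrow> s \<in> U \<Longrightarrow> \<exists>j\<in>J. \<forall>z. \<forall>k. k \<noteq> j \<longrightarrow> L (s(i := z)) k = L s k"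
  shows "holo_on I U (\<lambda>s. G (L s))"
proof -
  have V: "V \<subseteq> extensional J"
    using holo_onD(1)[OF G] J by (simp add: openin_cspace_iff)
  have "continuous_map (subtopology (cspace I) U) (cspace J) L"
    unfolding cspace_def continuous_map_componentwise using L V coord[THEN holo_onD(2)]
    by (force simp: cspace_def)
  then have "continuous_map (subtopology (cspace I) U) (subtopology (cspace J) V) L"
    using L by (auto simp: continuous_map_in_subtopology)
  from continuous_map_compose[OF this holo_onD(2)[OF G]]
  have "continuous_map (subtopology (cspace I) U) euclidean (\<lambda>s. G (L s))"
    by (simp add: o_def)
  moreover have "(\<lambda>z. G (L (s(i := z)))) field_differentiable at (s i)" if s: "s \<in> U" "i \<in> I" for s i
  proof -
    obtain j where j: "j \<in> J" "\<And>z k. k \<noteq> j \<Longrightarrow> L (s(i := z)) k = L s k"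
      using sep s by metis
    have eq: "L (s(i := z)) = (L s)(j := L (s(i := z)) j)" for z
      using j(2) by (auto simp: fun_eq_iff)
    have "(\<lambda>z. L (s(i := z)) j) field_differentiable at (s i)"
      using holo_onD(3)[OF coord[OF j(1)] s] .
    moreover have "(\<lambda>z. G ((L s)(j := z))) field_differentiable at (L (s(i := s i)) j)"
      using holo_onD(3)[OF G L[OF s(1)] j(1)] by simp
    ultimately have "((\<lambda>z. G ((L s)(j := z))) \<circ> (\<lambda>z. L (s(i := z)) j)) field_differentiable at (s i)"
      by (rule field_differentiable_compose)
    then show ?thesis by (subst eq) (simp add: o_def)
  qed
  ultimately show ?thesis using U by (auto simp: holo_on_def)
qed

text \<open>The Weierstrass M-test gives uniform convergence along finite subsets of X. Continuity
  passes to the limit directly, and separate holomorphy follows from the one-variable theorem on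
  uniform limits in each coordinate.\<close>

lemma holo_on_infsum:
  assumes I: "finite I" and U: "openin (cspace I) U"
    and f: "\<And>x. x \<in> X \<Longrightarrow> holo_on I U (f x)"
    and M: "\<And>x s. x \<in> X \<Longrightarrow> s \<in> U \<Longrightarrow> norm (f x s) \<le> M x" "M summable_on X"
  shows "holo_on I U (\<lambda>s. \<Sum>\<^sub>\<infinity>x\<in>X. f x s)"
proof -
  have top: "topspace (subtopology (cspace I) U) = U"
    using U by (metis openin_subset topspace_subtopology_subset)
  have ul: "uniform_limit U (\<lambda>F s. \<Sum>x\<in>F. f x s) (\<lambda>s. \<Sum>\<^sub>\<infinity>x\<in>X. f x s) (finite_subsets_at_top X)"
    by (rule Weierstrass_m_test_general) (use M in auto)
  have hF: "\<forall>\<^sub>F F in finite_subsets_at_top X. holo_on I U (\<lambda>s. \<Sum>x\<in>F. f x s)"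
    by (rule eventually_finite_subsets_at_top_weakI) (use f U in \<open>auto intro: holo_on_sum\<close>)
  have "continuous_map (subtopology (cspace I) U) Met_TC.mtopology (\<lambda>s. \<Sum>\<^sub>\<infinity>x\<in>X. f x s)"
  proof (rule Met_TC.continuous_map_uniform_limit)
    show "\<forall>\<^sub>F F in finite_subsets_at_top X.
        continuous_map (subtopology (cspace I) U) Met_TC.mtopology (\<lambda>s. \<Sum>x\<in>F. f x s)"
      using hF by eventually_elim (auto dest: holo_onD)
  qed (use ul top in \<open>auto simp: uniform_limit_iff\<close>)
  then have "continuous_map (subtopology (cspace I) U) euclidean (\<lambda>s. \<Sum>\<^sub>\<infinity>x\<in>X. f x s)"
    by simp
  moreover have "(\<lambda>z. \<Sum>\<^sub>\<infinity>x\<in>X. f x (s(i := z))) field_differentiable at (s i)" if s: "s \<in> U" "i \<in> I" for s i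
  proof -
    obtain e where e: "e > 0" "polydisc I s e \<subseteq> U" and se: "s \<in> extensional I"
      using U s openin_cspace_iff[OF I] by blast
    \<comment> \<open>Half the radius keeps the closed disc inside the open polydisc.\<close>
    have in_U: "s(i := z) \<in> U" if "z \<in> cball (s i) (e/2)" for z
      using that e s se by (intro subsetD[OF e(2)]) (auto simp: mem_polydisc extensional_def)
    have hol: "(\<lambda>z. \<Sum>x\<in>F. f x (s(i := z))) holomorphic_on cball (s i) (e/2)"
      if "holo_on I U (\<lambda>s. \<Sum>x\<in>F. f x s)" for F
      unfolding holomorphic_on_def
    proof
      fix z assume z: "z \<in> cball (s i) (e/2)"
      have "(\<lambda>z'. \<Sum>x\<in>F. f x (s(i := z, i := z'))) field_differentiable at ((s(i := z)) i)"
        by (rule holo_onD(3)[OF that in_U[OF z] s(2)])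
      then show "(\<lambda>z. \<Sum>x\<in>F. f x (s(i := z))) field_differentiable at z within cball (s i) (e/2)"
        by (auto intro: field_differentiable_at_within)
    qed
    obtain "(\<lambda>z. \<Sum>\<^sub>\<infinity>x\<in>X. f x (s(i := z))) holomorphic_on ball (s i) (e/2)"
    proof (rule holomorphic_uniform_limit)
      show "\<forall>\<^sub>F F in finite_subsets_at_top X. continuous_on (cball (s i) (e/2)) (\<lambda>z. \<Sum>x\<in>F. f x (s(i := z)))
          \<and> (\<lambda>z. \<Sum>x\<in>F. f x (s(i := z))) holomorphic_on ball (s i) (e/2)"
        using hF by eventually_elim
          (auto intro: holomorphic_on_imp_continuous_on hol holomorphic_on_subset[OF hol])
      show "uniform_limit (cball (s i) (e/2)) (\<lambda>F z. \<Sum>x\<in>F. f x (s(i := z)))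
          (\<lambda>z. \<Sum>\<^sub>\<infinity>x\<in>X. f x (s(i := z))) (finite_subsets_at_top X)"
        by (rule uniform_limit_compose'[OF ul]) (use in_U in auto)
    qed auto
    then show ?thesis
      using e(1) by (simp add: holomorphic_on_imp_differentiable_at)
  qed
  ultimately show ?thesis using U by (auto simp: holo_on_def)
qed


text \<open>The identity theorem on a product of connected open sets: coordinates are released one
  after the other from E i to D i, each time by analytic continuation in one variable.\<close>

lemma holo_on_eq_0_PiE:
  assumes I: "finite I" and f: "holo_on I U f" and DU: "Pi\<^sub>E I D \<subseteq> U"
    and D: "\<And>i. i \<in> I \<Longrightarrow> open (D i) \<and> connected (D i)"
    and E: "\<And>i. i \<in> I \<Longrightarrow> open (E i) \<and> E i \<noteq> {} \<and> E i \<subseteq> D i"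
    and zero: "\<And>s. s \<in> Pi\<^sub>E I E \<Longrightarrow> f s = 0" and s: "s \<in> Pi\<^sub>E I D"
  shows "f s = 0"
proof -
  \<comment> \<open>J is the set of coordinates already released to D i.\<close>
  have "\<forall>s\<in>Pi\<^sub>E I D. (\<forall>i\<in>I - J. s i \<in> E i) \<longrightarrow> f s = 0" if "finite J" "J \<subseteq> I" for J
    using that
  proof (induction J rule: finite_induct)
    case empty
    then show ?case using zero by (auto simp: PiE_def)
  next
    case (insert j J)
    then have j: "j \<in> I" by simp
    show ?case
    proof (intro ballI impI)
      fix s assume s: "s \<in> Pi\<^sub>E I D" and sE: "\<forall>i\<in>I - insert j J. s i \<in> E i"
      have upd: "s(j := z) \<in> Pi\<^sub>E I D" if "z \<in> D j" for z
        using s that j by (auto simp: PiE_def Pi_def extensional_def)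
      have "(\<lambda>z. f (s(j := z))) holomorphic_on D j"
        unfolding holomorphic_on_def
      proof
        fix z assume z: "z \<in> D j"
        have "(\<lambda>z'. f (s(j := z, j := z'))) field_differentiable at ((s(j := z)) j)"
          using holo_onD(3)[OF f _ j] upd[OF z] DU by blast
        then show "(\<lambda>z. f (s(j := z))) field_differentiable at z within D j"
          by (auto intro: field_differentiable_at_within)
      qed
      moreover have "f (s(j := z)) = 0" if "z \<in> E j" for z
      proof -
        have "z \<in> D j" using E[OF j] that by auto
        moreover have "\<forall>i\<in>I - J. (s(j := z)) i \<in> E i"
          using sE that by auto
        ultimately show ?thesis
          using insert upd by blast
      qed
      ultimately have "f (s(j := s j)) = 0"
        using D[OF j] E[OF j] s j
        by (intro analytic_continuation_open[of "E j" "D j" "\<lambda>z. f (s(j := z))" "\<lambda>_. 0" "s j"]) auto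
      then show "f s = 0" by simp
    qed
  qed
  from this[of I] I s show ?thesis by auto
qed

lemma holo_on_eq_0_open:
  assumes I: "finite I" and f: "holo_on I U f" and DU: "Pi\<^sub>E I D \<subseteq> U"
    and D: "\<And>i. i \<in> I \<Longrightarrow> open (D i) \<and> connected (D i)"
    and W: "openin (cspace I) W" "p \<in> W" "W \<subseteq> Pi\<^sub>E I D" "\<And>s. s \<in> W \<Longrightarrow> f s = 0"
    and s: "s \<in> Pi\<^sub>E I D"
  shows "f s = 0"
proof -
  obtain e where e: "e > 0" "polydisc I p e \<subseteq> W"
    using W openin_cspace_iff[OF I] by meson
  have sub: "Pi\<^sub>E I (\<lambda>i. ball (p i) e \<inter> D i) \<subseteq> W"
    using e(2) by (auto simp: polydisc_def PiE_def Pi_def)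
  have pD: "p \<in> Pi\<^sub>E I D" using W by auto
  show ?thesis
  proof (rule holo_on_eq_0_PiE[OF I f DU D, where E = "\<lambda>i. ball (p i) e \<inter> D i"])
    fix i assume i: "i \<in> I"
    then have "p i \<in> ball (p i) e \<inter> D i" using pD e(1) by auto
    then show "open (ball (p i) e \<inter> D i) \<and> ball (p i) e \<inter> D i \<noteq> {} \<and> ball (p i) e \<inter> D i \<subseteq> D i"
      using D[OF i] by blast
  qed (use sub W(4) s in auto)
qed

section \<open>Entire functions and agreement on dense open sets\<close>

definition entire :: "nat set \<Rightarrow> ((nat \<Rightarrow> complex) \<Rightarrow> complex) \<Rightarrow> bool"
  where "entire I f \<longleftrightarrow> holo_on I (topspace (cspace I)) f"

lemma entire_holo_on:
  assumes "entire I f" "openin (cspace I) U"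
  shows "holo_on I U f"
  using holo_on_subset[OF assms(1)[unfolded entire_def] assms(2)] openin_subset[OF assms(2)] by blast

text \<open>One point with h p \<noteq> 0 is enough, by the identity theorem on the whole space.
  Every density condition on a denominator is obtained from this.\<close>

lemma entire_nonzero_dense:
  assumes I: "finite I" and h: "entire I h" "p \<in> extensional I" "h p \<noteq> 0"
    and W: "openin (cspace I) W" "W \<noteq> {}"
  obtains s where "s \<in> W" "h s \<noteq> 0"
proof -
  obtain q where q: "q \<in> W" using W by auto
  have "\<exists>s\<in>W. h s \<noteq> 0"
  proof (rule ccontr)
    assume *: "\<not> ?thesis"
    have "h p = 0"
      by (rule holo_on_eq_0_open[OF I h(1)[unfolded entire_def], where D = "\<lambda>_. UNIV" and W = W and p = q])
        (use * W q openin_subset[OF W(1)] h(2) in \<open>auto simp: PiE_def\<close>)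
    with h(3) show False by simp
  qed
  then show ?thesis using that by blast
qed

lemma openin_entire_nonzero:
  assumes "entire I h" "openin (cspace I) W"
  shows "openin (cspace I) {s\<in>W. h s \<noteq> 0}"
  by (rule openin_vanishing_complement[OF entire_holo_on[OF assms]])

lemma subset_closure_of_iff:
  assumes "openin X U"
  shows "U \<subseteq> X closure_of W \<longleftrightarrow> (\<forall>V. openin X V \<and> V \<subseteq> U \<and> V \<noteq> {} \<longrightarrow> V \<inter> W \<noteq> {})"
proof safe
  fix V x assume "U \<subseteq> X closure_of W" "openin X V" "V \<subseteq> U" "x \<in> V" "V \<inter> W = {}"
  then show "x \<in> {}" by (auto simp: in_closure_of subset_iff)
next
  fix x assume *: "\<forall>V. openin X V \<and> V \<subseteq> U \<and> V \<noteq> {} \<longrightarrow> V \<inter> W \<noteq> {}" and x: "x \<in> U"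
  show "x \<in> X closure_of W"
    unfolding in_closure_of
  proof (intro conjI allI impI)
    fix T assume T: "x \<in> T \<and> openin X T"
    then have "(T \<inter> U) \<inter> W \<noteq> {}"
      using * assms x by (intro *[rule_format]) auto
    then show "\<exists>y. y \<in> W \<and> y \<in> T" by blast
  qed (use x openin_subset[OF assms] in auto)
qed

text \<open>The union of all open sets of agreement is the largest one, and it is dense as soon as
  every nonempty open V contains a piece of it. In this local form restriction and transitivity are
  immediate.\<close>

lemma agree_densely_iff:
  assumes "openin (cspace I) U"
  shows "agree_densely I U f g \<longleftrightarrow>
    (\<forall>V. openin (cspace I) V \<and> V \<subseteq> U \<and> V \<noteq> {} \<longrightarrow>
      (\<exists>W. openin (cspace I) W \<and> W \<subseteq> V \<and> W \<noteq> {} \<and> (\<forall>s\<in>W. f s = g s)))" (is "_ \<longleftrightarrow> ?R")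
proof
  assume "agree_densely I U f g"
  then obtain W where W: "openin (cspace I) W" "W \<subseteq> U" "U \<subseteq> cspace I closure_of W" "\<forall>s\<in>W. f s = g s"
    unfolding agree_densely_def by blast
  show ?R
  proof (intro allI impI)
    fix V assume V: "openin (cspace I) V \<and> V \<subseteq> U \<and> V \<noteq> {}"
    then have "V \<inter> W \<noteq> {}" using W(3) subset_closure_of_iff[OF assms] by blast
    then show "\<exists>W. openin (cspace I) W \<and> W \<subseteq> V \<and> W \<noteq> {} \<and> (\<forall>s\<in>W. f s = g s)"
      using V W by (intro exI[of _ "V \<inter> W"]) auto
  qed
next
  assume R: ?R
  define W where "W = \<Union>{W. openin (cspace I) W \<and> W \<subseteq> U \<and> (\<forall>s\<in>W. f s = g s)}"
  have "openin (cspace I) W" "W \<subseteq> U" "\<forall>s\<in>W. f s = g s"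
    unfolding W_def by auto
  moreover have "U \<subseteq> cspace I closure_of W"
    unfolding subset_closure_of_iff[OF assms]
  proof (intro allI impI)
    fix V assume V: "openin (cspace I) V \<and> V \<subseteq> U \<and> V \<noteq> {}"
    with R obtain W' where "openin (cspace I) W'" "W' \<subseteq> V" "W' \<noteq> {}" "\<forall>s\<in>W'. f s = g s"
      by meson
    with V have "W' \<subseteq> W" unfolding W_def by blast
    with \<open>W' \<subseteq> V\<close> \<open>W' \<noteq> {}\<close> show "V \<inter> W \<noteq> {}" by blast
  qed
  ultimately show "agree_densely I U f g" unfolding agree_densely_def by blast
qed

lemma agree_densely_sym: "agree_densely I U f g \<Longrightarrow> agree_densely I U g f"
  unfolding agree_densely_def by metis

lemma agree_densely_subset:
  assumes "openin (cspace I) U" "openin (cspace I) V" "V \<subseteq> U" "agree_densely I U f g"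
  shows "agree_densely I V f g"
  using assms(3,4) unfolding agree_densely_iff[OF assms(1)] agree_densely_iff[OF assms(2)]
  by (meson subset_trans)

lemma agree_densely_trans:
  assumes U: "openin (cspace I) U" and fg: "agree_densely I U f g" and gk: "agree_densely I U g k"
  shows "agree_densely I U f k"
  unfolding agree_densely_iff[OF U]
proof (intro allI impI)
  fix V assume V: "openin (cspace I) V \<and> V \<subseteq> U \<and> V \<noteq> {}"
  obtain W where W: "openin (cspace I) W" "W \<subseteq> V" "W \<noteq> {}" "\<forall>s\<in>W. f s = g s"
    using fg V unfolding agree_densely_iff[OF U] by meson
  obtain W' where "openin (cspace I) W'" "W' \<subseteq> W" "W' \<noteq> {}" "\<forall>s\<in>W'. g s = k s"
    using gk V W unfolding agree_densely_iff[OF U] by (meson subset_trans)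
  then show "\<exists>W. openin (cspace I) W \<and> W \<subseteq> V \<and> W \<noteq> {} \<and> (\<forall>s\<in>W. f s = k s)"
    using W by (intro exI[of _ W']) auto
qed

text \<open>The set where f and g differ is open, so if it were nonempty it would meet the dense set
  of agreement.\<close>

lemma agree_densely_eq:
  assumes f: "holo_on I U f" and g: "holo_on I U g" and ag: "agree_densely I U f g" and s: "s \<in> U"
  shows "f s = g s"
proof (rule ccontr)
  assume "f s \<noteq> g s"
  then have "{s\<in>U. f s - g s \<noteq> 0} \<noteq> {}" using s by auto
  moreover have "openin (cspace I) {s\<in>U. f s - g s \<noteq> 0}"
    by (rule openin_vanishing_complement[OF holo_on_diff[OF f g]])
  ultimately obtain W where "W \<subseteq> {s\<in>U. f s - g s \<noteq> 0}" "W \<noteq> {}" "\<forall>s\<in>W. f s = g s"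
    using ag unfolding agree_densely_iff[OF holo_onD(1)[OF f]]
    by (metis (no_types, lifting) mem_Collect_eq subsetI)
  then show False by auto
qed

text \<open>Global quotients of entire functions: closed under ring operations, and simpler to compare
  than functions that are only locally quotients.\<close>

definition quot_of :: "nat set \<Rightarrow> ((nat \<Rightarrow> complex) \<Rightarrow> complex) \<Rightarrow> ((nat \<Rightarrow> complex) \<Rightarrow> complex)
    \<Rightarrow> ((nat \<Rightarrow> complex) \<Rightarrow> complex) \<Rightarrow> bool"
  where "quot_of I f g h \<longleftrightarrow> entire I g \<and> entire I h \<and> (\<exists>p\<in>extensional I. h p \<noteq> 0) \<and>
    (\<forall>s\<in>extensional I. h s \<noteq> 0 \<longrightarrow> f s = g s / h s)"

definition quot :: "nat set \<Rightarrow> ((nat \<Rightarrow> complex) \<Rightarrow> complex) \<Rightarrow> bool"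
  where "quot I f \<longleftrightarrow> (\<exists>g h. quot_of I f g h)"

text \<open>Entire functions form an integral domain: the set where h does not vanish is open and
  nonempty, so k cannot vanish on all of it.\<close>

lemma entire_mult_nonzero:
  assumes I: "finite I" and h: "entire I h" "\<exists>p\<in>extensional I. h p \<noteq> 0"
    and k: "entire I k" "\<exists>p\<in>extensional I. k p \<noteq> 0"
  shows "\<exists>p\<in>extensional I. h p * k p \<noteq> 0"
proof -
  have "openin (cspace I) {s \<in> topspace (cspace I). h s \<noteq> 0}" (is "openin _ ?W")
    by (rule openin_entire_nonzero[OF h(1) openin_topspace])
  moreover have "?W \<noteq> {}" using h by (auto simp: PiE_def)
  ultimately obtain s where "s \<in> ?W" "k s \<noteq> 0"
    using entire_nonzero_dense[OF I k(1), where W = ?W] k(2) by blast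
  then show ?thesis by (intro bexI[of _ s]) (auto simp: PiE_def)
qed

lemma entire_mult: "entire I f \<Longrightarrow> entire I g \<Longrightarrow> entire I (\<lambda>s. f s * g s)"
  unfolding entire_def by (rule holo_on_mult)

lemma entire_add: "entire I f \<Longrightarrow> entire I g \<Longrightarrow> entire I (\<lambda>s. f s + g s)"
  unfolding entire_def by (rule holo_on_add)

lemma entire_const: "entire I (\<lambda>_. c)"
  unfolding entire_def by (rule holo_on_const) (rule openin_topspace)

lemma entire_coord: "i \<in> I \<Longrightarrow> entire I (\<lambda>s. s i)"
  unfolding entire_def by (rule holo_on_coord) (rule openin_topspace)

lemma entire_sum: "(\<And>k. k \<in> K \<Longrightarrow> entire I (f k)) \<Longrightarrow> entire I (\<lambda>s. \<Sum>k\<in>K. f k s)"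
  unfolding entire_def by (rule holo_on_sum) (rule openin_topspace)

lemma entire_prod: "(\<And>k. k \<in> K \<Longrightarrow> entire I (f k)) \<Longrightarrow> entire I (\<lambda>s. \<Prod>k\<in>K. f k s)"
  unfolding entire_def by (rule holo_on_prod) (rule openin_topspace)

lemma entire_diff: "entire I f \<Longrightarrow> entire I g \<Longrightarrow> entire I (\<lambda>s. f s - g s)"
  unfolding entire_def by (rule holo_on_diff)

lemma entire_compose_1: "entire I f \<Longrightarrow> \<phi> holomorphic_on UNIV \<Longrightarrow> entire I (\<lambda>s. \<phi> (f s))"
  unfolding entire_def by (rule holo_on_compose_1[where A = UNIV]) auto

lemma quot_const: "quot I (\<lambda>_. c)"
  unfolding quot_def quot_of_def
  by (rule exI[of _ "\<lambda>_. c"], rule exI[of _ "\<lambda>_. 1"]) (auto intro: entire_const)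

lemma quot_add:
  assumes I: "finite I" and f: "quot I f" and g: "quot I g"
  shows "quot I (\<lambda>s. f s + g s)"
proof -
  obtain a b c d where "quot_of I f a b" "quot_of I g c d" using assms unfolding quot_def by blast
  then have "quot_of I (\<lambda>s. f s + g s) (\<lambda>s. a s * d s + c s * b s) (\<lambda>s. b s * d s)"
    unfolding quot_of_def using entire_mult_nonzero[OF I, of b d]
    by (auto intro!: entire_add entire_mult simp: add_frac_eq)
  then show ?thesis unfolding quot_def by blast
qed

lemma quot_mult:
  assumes I: "finite I" and f: "quot I f" and g: "quot I g"
  shows "quot I (\<lambda>s. f s * g s)"
proof -
  obtain a b c d where "quot_of I f a b" "quot_of I g c d" using assms unfolding quot_def by blast
  then have "quot_of I (\<lambda>s. f s * g s) (\<lambda>s. a s * c s) (\<lambda>s. b s * d s)"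
    unfolding quot_of_def using entire_mult_nonzero[OF I, of b d]
    by (auto intro!: entire_mult)
  then show ?thesis unfolding quot_def by blast
qed

lemma quot_diff:
  assumes I: "finite I" and f: "quot I f" and g: "quot I g"
  shows "quot I (\<lambda>s. f s - g s)"
  using quot_add[OF I f quot_mult[OF I quot_const[of I "-1"] g]] by simp

lemma quot_sum:
  assumes I: "finite I" and f: "\<And>k. k \<in> K \<Longrightarrow> quot I (f k)"
  shows "quot I (\<lambda>s. \<Sum>k\<in>K. f k s)"
  using f by (induction K rule: infinite_finite_induct) (auto intro: quot_const quot_add[OF I])

lemma quot_of_dense:
  assumes I: "finite I" and q: "quot_of I f g h" and U: "openin (cspace I) U"
  shows "U \<subseteq> cspace I closure_of {s\<in>U. h s \<noteq> 0}"
  unfolding subset_closure_of_iff[OF U]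
proof (intro allI impI)
  fix V assume V: "openin (cspace I) V \<and> V \<subseteq> U \<and> V \<noteq> {}"
  then obtain s where "s \<in> V" "h s \<noteq> 0"
    using entire_nonzero_dense[OF I, of h] q unfolding quot_of_def by metis
  then show "V \<inter> {s\<in>U. h s \<noteq> 0} \<noteq> {}" using V by auto
qed

lemma quot_imp_mero:
  assumes I: "finite I" and f: "quot I f"
  shows "mero I f"
  unfolding mero_def
proof
  fix p assume p: "p \<in> topspace (cspace I)"
  obtain g h where q: "quot_of I f g h" using f unfolding quot_def by blast
  show "\<exists>U g h. p \<in> U \<and> holo_on I U g \<and> holo_on I U h \<and>
       U \<subseteq> cspace I closure_of {s \<in> U. h s \<noteq> 0} \<and> (\<forall>s\<in>U. h s \<noteq> 0 \<longrightarrow> f s = g s / h s)"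
    using p q quot_of_dense[OF I q openin_topspace]
    by (intro exI[of _ "topspace (cspace I)"] exI[of _ g] exI[of _ h])
      (auto simp: quot_of_def entire_def PiE_def)
qed

text \<open>After clearing denominators the difference a * d - c * b is entire and vanishes on a
  nonempty open subset of W, hence everywhere. A meromorphic identity thus needs to be checked on
  one open set only.\<close>

lemma quot_mero_eqI:
  assumes I: "finite I" and f: "quot I f" and g: "quot I g"
    and W: "openin (cspace I) W" "W \<noteq> {}" "\<And>s. s \<in> W \<Longrightarrow> f s = g s"
  shows "mero_eq I f g"
proof -
  obtain a b c d where *: "quot_of I f a b" "quot_of I g c d" using f g unfolding quot_def by blast
  have e: "entire I a" "entire I b" "entire I c" "entire I d"
    using * unfolding quot_of_def by blast+
  obtain p where p: "p \<in> extensional I" "b p * d p \<noteq> 0"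
    using * entire_mult_nonzero[OF I, of b d] unfolding quot_of_def by blast
  let ?N = "{s \<in> W. b s * d s \<noteq> 0}"
  have N: "openin (cspace I) ?N"
    by (rule openin_entire_nonzero[OF entire_mult[OF e(2,4)] W(1)])
  obtain q where q: "q \<in> ?N"
    using entire_nonzero_dense[OF I entire_mult[OF e(2,4)] p W(1,2)] by blast
  have eq: "a s * d s - c s * b s = 0" if "s \<in> extensional I" for s
  proof (rule holo_on_eq_0_open[OF I, where f = "\<lambda>s. a s * d s - c s * b s" and s = s
      and U = "topspace (cspace I)" and D = "\<lambda>_. UNIV" and W = ?N and p = q])
    show "holo_on I (topspace (cspace I)) (\<lambda>s. a s * d s - c s * b s)"
      using e unfolding entire_def by (intro holo_on_diff holo_on_mult)
    show "?N \<subseteq> I \<rightarrow>\<^sub>E UNIV" using openin_subset[OF N] by simp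
    show "a s * d s - c s * b s = 0" if s: "s \<in> ?N" for s
    proof -
      have "s \<in> extensional I" using s openin_subset[OF N] by (auto simp: PiE_def)
      then have "a s / b s = c s / d s"
        using s * W(3)[of s] unfolding quot_of_def by auto
      then show ?thesis using s by (simp add: frac_eq_eq)
    qed
  qed (use that N q in \<open>auto simp: PiE_def\<close>)
  have "agree_densely I (topspace (cspace I)) f g"
    unfolding agree_densely_iff[OF openin_topspace]
  proof (intro allI impI)
    fix V assume V: "openin (cspace I) V \<and> V \<subseteq> topspace (cspace I) \<and> V \<noteq> {}"
    have "openin (cspace I) {s \<in> V. b s * d s \<noteq> 0}"
      using V by (intro openin_entire_nonzero[OF entire_mult[OF e(2,4)]]) auto
    moreover have "{s \<in> V. b s * d s \<noteq> 0} \<noteq> {}"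
    proof -
      have "openin (cspace I) V" "V \<noteq> {}" using V by blast+
      then obtain s where "s \<in> V" "b s * d s \<noteq> 0"
        by (rule entire_nonzero_dense[OF I entire_mult[OF e(2,4)] p])
      then show ?thesis by blast
    qed
    moreover have "f s = g s" if "s \<in> {s \<in> V. b s * d s \<noteq> 0}" for s
    proof -
      have "s \<in> extensional I" using that V by (auto simp: PiE_def)
      then show ?thesis using that * eq[of s] unfolding quot_of_def by (auto simp: frac_eq_eq)
    qed
    ultimately show "\<exists>W. openin (cspace I) W \<and> W \<subseteq> V \<and> W \<noteq> {} \<and> (\<forall>s\<in>W. f s = g s)"
      by (intro exI[of _ "{s \<in> V. b s * d s \<noteq> 0}"]) auto
  qed
  then show ?thesis
    unfolding mero_eq_def using quot_imp_mero[OF I] f g by blast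
qed

lemma nicely_mero_exists:
  assumes I: "finite I" and q: "quot_of I f g h"
  obtains F where "nicely_mero I F" "\<And>s. s \<in> extensional I \<Longrightarrow> h s \<noteq> 0 \<Longrightarrow> F s = g s / h s"
proof -
  \<comment> \<open>\<open>ext p U k\<close> says that k is a holomorphic extension of f to the
    neighbourhood U of p.\<close>
  define ext where "ext = (\<lambda>p U k. p \<in> U \<and> holo_on I U k \<and> agree_densely I U f k)"
  define F where "F p = (if \<exists>U k. ext p U k then (SOME v. \<exists>U k. ext p U k \<and> v = k p) else 0)" for p
  have e: "entire I g" "entire I h" using q unfolding quot_of_def by auto
  \<comment> \<open>The choice is harmless: two extensions near p agree densely on the intersection
    of their domains, hence at p.\<close>
  have F_eq: "F p = k p" if pk: "ext p U k" for p U k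
  proof -
    have "\<exists>v. \<exists>U k. ext p U k \<and> v = k p" using pk by blast
    from someI_ex[OF this] pk obtain U' k' where U': "ext p U' k'" "(SOME v. \<exists>U k. ext p U k \<and> v = k p) = k' p"
      by blast
    have Fp: "F p = k' p" using pk U'(2) unfolding F_def by (metis (mono_tags, lifting))
    have o: "openin (cspace I) U" "openin (cspace I) U'" "openin (cspace I) (U \<inter> U')"
      using pk U' by (auto simp: ext_def dest: holo_onD(1))
    have "agree_densely I (U \<inter> U') f k" "agree_densely I (U \<inter> U') f k'"
      using pk U' o agree_densely_subset[of I _ "U \<inter> U'"] unfolding ext_def by blast+
    then have "agree_densely I (U \<inter> U') k' k"
      using agree_densely_trans[OF o(3)] agree_densely_sym by blast
    moreover have "holo_on I (U \<inter> U') k" "holo_on I (U \<inter> U') k'"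
      using pk U' o holo_on_subset unfolding ext_def by blast+
    ultimately have "k' p = k p"
      using pk U' by (intro agree_densely_eq[of I "U \<inter> U'" k' k]) (auto simp: ext_def)
    with Fp show ?thesis by simp
  qed
  let ?N = "{s \<in> topspace (cspace I). h s \<noteq> 0}"
  have N: "openin (cspace I) ?N" by (rule openin_entire_nonzero[OF e(2) openin_topspace])
  have ext_N: "ext p ?N (\<lambda>s. g s / h s)" if "p \<in> ?N" for p
  proof -
    have "holo_on I ?N (\<lambda>s. g s / h s)"
      by (rule holo_on_divide) (use e N in \<open>auto intro: entire_holo_on\<close>)
    moreover have "agree_densely I ?N f (\<lambda>s. g s / h s)"
      unfolding agree_densely_def
    proof (intro exI[of _ ?N] conjI)
      show "?N \<subseteq> cspace I closure_of ?N"
        using N by (intro closure_of_subset openin_subset)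
      show "\<forall>s\<in>?N. f s = g s / h s"
        using q unfolding quot_of_def by (auto simp: PiE_def)
    qed (use N in auto)
    ultimately show ?thesis using that by (auto simp: ext_def)
  qed
  have FN: "F s = g s / h s" if "s \<in> extensional I" "h s \<noteq> 0" for s
    using F_eq[OF ext_N, of s] that by (auto simp: PiE_def)
  have qF: "quot_of I F g h" using q FN unfolding quot_of_def by auto
  have agree_Ff: "agree_densely I U F f" if "openin (cspace I) U" for U
    unfolding agree_densely_def
  proof (intro exI[of _ "{s\<in>U. h s \<noteq> 0}"] conjI)
    show "openin (cspace I) {s\<in>U. h s \<noteq> 0}" by (rule openin_entire_nonzero[OF e(2) that])
    show "U \<subseteq> cspace I closure_of {s\<in>U. h s \<noteq> 0}" by (rule quot_of_dense[OF I q that])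
    show "\<forall>s\<in>{s\<in>U. h s \<noteq> 0}. F s = f s"
      using FN q openin_subset[OF that] unfolding quot_of_def by (auto simp: PiE_def subset_iff)
  qed auto
  have "nicely_mero I F"
    unfolding nicely_mero_def
  proof (intro conjI ballI)
    show "mero I F" using quot_imp_mero[OF I] qF unfolding quot_def by blast
    fix p assume p: "p \<in> topspace (cspace I)"
    show "(\<exists>U. p \<in> U \<and> holo_on I U F) \<or>
       (F p = 0 \<and> \<not> (\<exists>U g. p \<in> U \<and> holo_on I U g \<and> agree_densely I U F g))"
    proof (cases "\<exists>U k. ext p U k")
      case True
      then obtain U k where k: "ext p U k" by blast
      then have "ext s U k" if "s \<in> U" for s using that by (auto simp: ext_def)
      then have "k s = F s" if "s \<in> U" for s using F_eq[of s U k] that by simp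
      then have "holo_on I U F"
        using k by (intro holo_on_cong[of U k F, OF _ I]) (auto simp: ext_def)
      then show ?thesis using k by (auto simp: ext_def)
    next
      case False
      then have "F p = 0" by (simp add: F_def)
      moreover have "ext p U k" if "p \<in> U" "holo_on I U k" "agree_densely I U F k" for U k
        using that agree_Ff[of U] agree_densely_trans[of I U f F k] agree_densely_sym holo_onD(1)[of I U k]
        unfolding ext_def by blast
      ultimately show ?thesis using False by blast
    qed
  qed
  with FN show ?thesis using that by blast
qed

lemma connected_space_cspace: "connected_space (cspace I)"
  unfolding cspace_def connected_space_product_topology
  using connectedin_iff_connected[of "UNIV :: complex set"] connectedin_topspace[of "euclidean :: complex topology"] connected_UNIV[where ?'a = complex]
  by simp

text \<open>F is only locally a quotient, so denominators cannot be cleared globally. Instead the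
  union V of the open sets on which F and f agree densely is shown to be closed, and connectedness
  makes it the whole space. Near a point with h p \<noteq> 0 the quotient g / h is then a
  holomorphic extension of F, and a canonical representative takes its value.\<close>

lemma nicely_mero_eq_quot:
  assumes I: "finite I" and F: "nicely_mero I F" and q: "quot_of I f g h"
    and W: "openin (cspace I) W" "W \<noteq> {}" "\<And>s. s \<in> W \<Longrightarrow> F s = f s"
    and p: "p \<in> extensional I" "h p \<noteq> 0"
  shows "F p = g p / h p"
proof -
  have e: "entire I g" "entire I h" using q unfolding quot_of_def by auto
  have f_eq: "f s = g s / h s" if "s \<in> extensional I" "h s \<noteq> 0" for s
    using q that unfolding quot_of_def by auto
  define V where "V = \<Union>{U. openin (cspace I) U \<and> agree_densely I U F f}"
  have V: "openin (cspace I) V" unfolding V_def by blast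
  have "agree_densely I W F f"
    unfolding agree_densely_def using W closure_of_subset[OF openin_subset[OF W(1)]] by blast
  then have WV: "W \<subseteq> V" unfolding V_def using W(1) by blast
  \<comment> \<open>A polydisc is a product of connected sets, so if F = k / l on it, the relation k
    * h = g * l spreads from a small open piece to all of it.\<close>
  have step: "U \<subseteq> V" if U: "U = polydisc I x r" and k: "holo_on I U k" and l: "holo_on I U l"
    and dl: "U \<subseteq> cspace I closure_of {s \<in> U. l s \<noteq> 0}" and Fkl: "\<And>s. s \<in> U \<Longrightarrow> l s \<noteq> 0 \<Longrightarrow> F s = k s / l s"
    and meet: "U \<inter> V \<noteq> {}" for U x r k l
  proof -
    have oU: "openin (cspace I) U" using k by (rule holo_onD)
    have Uext: "s \<in> extensional I" if "s \<in> U" for s using that U by (auto simp: mem_polydisc)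
    obtain A where A: "openin (cspace I) A" "agree_densely I A F f" "U \<inter> A \<noteq> {}"
      using meet unfolding V_def by blast
    then obtain B where B: "openin (cspace I) B" "B \<subseteq> U \<inter> A" "B \<noteq> {}" "\<forall>s\<in>B. F s = f s"
      using agree_densely_iff[OF A(1), of F f] oU
      by (metis (no_types, lifting) inf_le2 openin_Int)
    let ?B' = "{s\<in>B. l s \<noteq> 0}"
    have oB': "openin (cspace I) ?B'"
      using B l by (intro openin_vanishing_complement[OF holo_on_subset]) auto
    have "?B' \<noteq> {}"
      using dl B subset_closure_of_iff[OF oU, of "{s \<in> U. l s \<noteq> 0}"] by blast
    then obtain b where b: "b \<in> ?B'" "h b \<noteq> 0"
      using entire_nonzero_dense[OF I e(2) p oB'] by metis
    let ?C = "{s\<in>?B'. h s \<noteq> 0}"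
    have oC: "openin (cspace I) ?C" by (rule openin_entire_nonzero[OF e(2) oB'])
    have eq: "k s * h s - g s * l s = 0" if "s \<in> U" for s
    proof (rule holo_on_eq_0_open[OF I, where f = "\<lambda>s. k s * h s - g s * l s" and s = s
        and U = U and D = "\<lambda>i. ball (x i) r" and W = ?C and p = b])
      show "holo_on I U (\<lambda>s. k s * h s - g s * l s)"
        using e k l oU by (intro holo_on_diff holo_on_mult) (auto intro: entire_holo_on)
      show "k s * h s - g s * l s = 0" if s: "s \<in> ?C" for s
      proof -
        have "s \<in> U" "F s = f s" using s B by auto
        then have "k s / l s = g s / h s"
          using s Fkl[of s] f_eq[of s] Uext[of s] by auto
        then show ?thesis using s by (simp add: frac_eq_eq)
      qed
    qed (use U that oC b B in \<open>auto simp: polydisc_def\<close>)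
    have "agree_densely I U F f"
      unfolding agree_densely_iff[OF oU]
    proof (intro allI impI)
      fix O' assume O': "openin (cspace I) O' \<and> O' \<subseteq> U \<and> O' \<noteq> {}"
      let ?O1 = "{s\<in>O'. l s \<noteq> 0}" and ?O2 = "{s\<in>{s\<in>O'. l s \<noteq> 0}. h s \<noteq> 0}"
      have o1: "openin (cspace I) ?O1"
        using O' l by (intro openin_vanishing_complement[OF holo_on_subset]) auto
      have "?O1 \<noteq> {}"
        using dl O' subset_closure_of_iff[OF oU, of "{s \<in> U. l s \<noteq> 0}"] by blast
      then have "?O2 \<noteq> {}"
        using entire_nonzero_dense[OF I e(2) p o1] by blast
      moreover have "openin (cspace I) ?O2" by (rule openin_entire_nonzero[OF e(2) o1])
      moreover have "F s = f s" if "s \<in> ?O2" for s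
        using that O' Fkl[of s] f_eq[of s] eq[of s] Uext[of s] by (auto simp: frac_eq_eq)
      ultimately show "\<exists>W. openin (cspace I) W \<and> W \<subseteq> O' \<and> W \<noteq> {} \<and> (\<forall>s\<in>W. F s = f s)"
        by (intro exI[of _ ?O2]) auto
    qed
    then show ?thesis unfolding V_def using oU by blast
  qed
  have "closedin (cspace I) V"
  proof -
    have "openin (cspace I) (topspace (cspace I) - V)"
    proof (subst openin_subopen, intro ballI)
      fix x assume x: "x \<in> topspace (cspace I) - V"
      obtain U k l where U: "x \<in> U" "holo_on I U k" "holo_on I U l"
        "U \<subseteq> cspace I closure_of {s \<in> U. l s \<noteq> 0}" "\<forall>s\<in>U. l s \<noteq> 0 \<longrightarrow> F s = k s / l s"
        using F x unfolding nicely_mero_def mero_def by blast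
      have oU: "openin (cspace I) U" using U by (auto dest: holo_onD)
      obtain r where r: "r > 0" "polydisc I x r \<subseteq> U"
        using oU U(1) openin_cspace_iff[OF I] by meson
      let ?P = "polydisc I x r"
      have oP: "openin (cspace I) ?P" by (rule openin_polydisc[OF I])
      have xP: "x \<in> ?P" using x r by (intro polydisc_centre) (auto simp: PiE_def)
      have dense: "?P \<subseteq> cspace I closure_of {s \<in> ?P. l s \<noteq> 0}"
        unfolding subset_closure_of_iff[OF oP]
      proof (intro allI impI)
        fix O' assume O': "openin (cspace I) O' \<and> O' \<subseteq> ?P \<and> O' \<noteq> {}"
        then have "O' \<inter> {s \<in> U. l s \<noteq> 0} \<noteq> {}"
          using U(4) r(2) unfolding subset_closure_of_iff[OF oU] by blast
        then show "O' \<inter> {s \<in> ?P. l s \<noteq> 0} \<noteq> {}" using O' by blast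
      qed
      have "?P \<inter> V = {}"
      proof (rule ccontr)
        assume "?P \<inter> V \<noteq> {}"
        then have "?P \<subseteq> V"
          using U r oP dense by (intro step[OF refl, of x r k l]) (auto intro: holo_on_subset)
        with xP x show False by blast
      qed
      then show "\<exists>T. openin (cspace I) T \<and> x \<in> T \<and> T \<subseteq> topspace (cspace I) - V"
        using oP xP openin_subset[OF oP] by blast
    qed
    then show ?thesis using openin_subset[OF V] by (simp add: closedin_def)
  qed
  moreover have "V \<noteq> {}" using WV W by blast
  ultimately have "V = topspace (cspace I)"
    using connected_space_cspace V unfolding connected_space_clopen_in by blast
  then have "p \<in> V" using p by (simp add: PiE_def)
  then obtain A where A: "openin (cspace I) A" "agree_densely I A F f" "p \<in> A"
    unfolding V_def by blast
  define B where "B = {s\<in>A. h s \<noteq> 0}"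
  have oB: "openin (cspace I) B" and pB: "p \<in> B"
    unfolding B_def using openin_entire_nonzero[OF e(2) A(1)] A p by auto
  have hB: "holo_on I B (\<lambda>s. g s / h s)"
    by (rule holo_on_divide) (use e oB in \<open>auto intro: entire_holo_on simp: B_def\<close>)
  have "agree_densely I B F f" using A oB by (intro agree_densely_subset[of I A B]) (auto simp: B_def)
  moreover have "agree_densely I B f (\<lambda>s. g s / h s)"
    unfolding agree_densely_def
    using oB f_eq openin_subset[OF oB] closure_of_subset[OF openin_subset[OF oB]]
    by (intro exI[of _ B]) (auto simp: B_def PiE_def subset_iff)
  ultimately have agB: "agree_densely I B F (\<lambda>s. g s / h s)"
    using agree_densely_trans[OF oB] by blast
  \<comment> \<open>The second alternative of \<open>nicely_mero\<close> is excluded, because g / h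
    extends F near p.\<close>
  have "\<exists>U. p \<in> U \<and> holo_on I U F"
    using F pB hB agB p unfolding nicely_mero_def by (auto simp: PiE_def)
  then obtain U where U: "p \<in> U" "holo_on I U F" by blast
  have o: "openin (cspace I) (U \<inter> B)" using U oB by (auto dest: holo_onD)
  show ?thesis
    by (rule agree_densely_eq[of I "U \<inter> B" F "\<lambda>s. g s / h s"])
      (use U pB o hB agB oB in \<open>auto intro: holo_on_subset agree_densely_subset[of I B "U \<inter> B"]\<close>)
qed


section \<open>Taylor estimates and telescoping sums\<close>

text \<open>\<open>fact i * (z gchoose i)\<close> is the falling factorial, the coefficient of the
  i-th derivative of x powr z.\<close>

lemma fact_gbinomial_Suc:
  fixes z :: "'a :: field_char_0"
  shows "fact (Suc i) * (z gchoose Suc i) = fact i * (z gchoose i) * (z - of_nat i)"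
proof -
  have "of_nat (Suc i) * (z gchoose Suc i) = (z - of_nat i) * (z gchoose i)"
    using gbinomial_absorption[of i z] gbinomial_absorb_comp[of z i] by (simp del: of_nat_Suc)
  then show ?thesis by (simp add: mult_ac del: of_nat_Suc)
qed

text \<open>Since t / m lies between 1/2 and 1, its powers are at most 2 powr \<bar>a\<bar> for
  either sign of a.\<close>

lemma powr_le_near:
  fixes t m a :: real
  assumes "m \<ge> 2" "m - 1 \<le> t" "t \<le> m"
  shows "t powr a \<le> 2 powr \<bar>a\<bar> * m powr a"
proof -
  have t: "1/2 \<le> t / m" "t / m \<le> 1" "0 \<le> t / m" using assms by (auto simp: field_simps)
  have "(t / m) powr a \<le> 2 powr \<bar>a\<bar>"
  proof (cases "a \<ge> 0")
    case True
    then have "(t / m) powr a \<le> 1 powr a" using t by (intro powr_mono2) auto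
    also have "\<dots> \<le> 2 powr \<bar>a\<bar>" by (simp add: ge_one_powr_ge_zero)
    finally show ?thesis .
  next
    case False
    then have "(t / m) powr a \<le> (1/2) powr a" using t by (intro powr_mono2') auto
    also have "\<dots> = 2 powr \<bar>a\<bar>" using False by (simp add: powr_minus powr_divide divide_simps)
    finally show ?thesis .
  qed
  moreover have "t powr a = (t / m) powr a * m powr a"
    using assms by (simp add: powr_divide)
  ultimately show ?thesis by (simp add: mult_right_mono)
qed

text \<open>Taylor's formula for x powr z at m, evaluated at m - 1. The condition m \<ge> 2 keeps
  the segment on the positive axis, away from the branch cut.\<close>

lemma powr_pred_Taylor:
  fixes z :: complex
  assumes m: "m \<ge> 2"
  shows "norm (of_nat (m - 1) powr z - (\<Sum>l\<le>k. (z gchoose l) * (-1) ^ l * of_nat m powr (z - of_nat l)))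
    \<le> norm (z gchoose Suc k) * real (Suc k) * 2 powr \<bar>Re z - real (Suc k)\<bar> * real m powr (Re z - real (Suc k))"
proof -
  define S where "S = closed_segment (of_nat m :: complex) (of_nat (m - 1))"
  define f where "f i x = fact i * (z gchoose i) * x powr (z - of_nat i)" for i and x :: complex
  define B where "B = norm (fact (Suc k) * (z gchoose Suc k)) *
    (2 powr \<bar>Re z - real (Suc k)\<bar> * real m powr (Re z - real (Suc k)))"
  have S: "\<exists>t. x = of_real t \<and> real m - 1 \<le> t \<and> t \<le> real m" if "x \<in> S" for x
  proof -
    have "x \<in> of_real ` closed_segment (real m) (real (m - 1))"
      using that by (simp add: S_def closed_segment_of_real[symmetric])
    then show ?thesis using m by (auto simp: closed_segment_eq_real_ivl of_nat_diff split: if_splits)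
  qed
  have deriv: "(f i has_field_derivative f (Suc i) x) (at x within S)" if x: "x \<in> S" for i x
  proof -
    obtain t where "x = of_real t" "real m - 1 \<le> t" using S[OF x] by blast
    then have nz: "x \<notin> \<real>\<^sub>\<le>\<^sub>0" using m by (auto simp: complex_nonpos_Reals_iff)
    have "((\<lambda>x. x powr (z - of_nat i)) has_field_derivative (z - of_nat i) * x powr (z - of_nat i - 1)) (at x within S)"
      by (rule has_field_derivative_at_within[OF has_field_derivative_powr[OF nz]])
    from DERIV_cmult[OF this, of "fact i * (z gchoose i)"]
    show ?thesis
      unfolding f_def fact_gbinomial_Suc by (simp add: algebra_simps)
  qed
  have "norm (f 0 (of_nat (m-1)) - (\<Sum>i\<le>k. f i (of_nat m) * (of_nat (m-1) - of_nat m) ^ i / fact i))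
    \<le> B * norm (of_nat (m-1) - of_nat m :: complex) ^ Suc k / fact k"
  proof (rule complex_Taylor[of S])
    show "norm (f (Suc k) x) \<le> B" if x: "x \<in> S" for x
    proof -
      obtain t where t: "x = of_real t" "real m - 1 \<le> t" "t \<le> real m" using S[OF x] by blast
      have "norm (x powr (z - of_nat (Suc k))) = t powr (Re z - real (Suc k))"
        using t m by (subst norm_powr_real_powr) auto
      also have "\<dots> \<le> 2 powr \<bar>Re z - real (Suc k)\<bar> * real m powr (Re z - real (Suc k))"
        by (rule powr_le_near) (use t m in auto)
      finally show ?thesis unfolding f_def B_def norm_mult[of _ "x powr _"]
        by (intro mult_left_mono) auto
    qed
  next
    show "(f i has_field_derivative f (Suc i) x) (at x within S)" if "x \<in> S" for i x
      using deriv[OF that] .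
  qed (auto simp: S_def)
  moreover have "norm (of_nat (m-1) - of_nat m :: complex) = 1" using m by (simp add: of_nat_diff)
  moreover have "B * 1 ^ Suc k / fact k =
     norm (z gchoose Suc k) * real (Suc k) * 2 powr \<bar>Re z - real (Suc k)\<bar> * real m powr (Re z - real (Suc k))"
    by (simp add: B_def norm_mult del: of_nat_Suc)
  moreover have "of_nat (m-1) - of_nat m = (-1 :: complex)" using m by (simp add: of_nat_diff)
  moreover have "f 0 (of_nat (m-1)) = of_nat (m - 1) powr z" by (simp add: f_def)
  moreover have "f i (of_nat m) * (-1) ^ i / fact i = (z gchoose i) * (-1) ^ i * of_nat m powr (z - of_nat i)" for i
    by (simp add: f_def)
  ultimately show ?thesis by (metis (no_types, lifting) sum.cong)
qed

lemma has_sum_greaterThan: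
  fixes f :: "nat \<Rightarrow> 'a :: topological_comm_monoid_add"
  assumes "((\<lambda>n. f (Suc (n + M))) has_sum S) UNIV"
  shows "(f has_sum S) {M<..}"
proof -
  have "bij_betw (\<lambda>n. Suc (n + M)) UNIV {M<..}"
    by (rule bij_betwI[of _ _ _ "\<lambda>k. k - Suc M"]) auto
  from has_sum_reindex_bij_betw[OF this, of f S] assms show ?thesis by simp
qed

text \<open>\<open>has_sum\<close> is unconditional, so telescoping has to be supplemented by
  absolute convergence: the Taylor estimate of order 0 bounds the differences by a multiple of l
  powr (Re z - 1). For M = 0 the sum is \<open>0 powr z = 0\<close>.\<close>

lemma has_sum_telescope_powr:
  fixes z :: complex
  assumes z: "Re z < 0"
  shows "((\<lambda>l. of_nat (l - 1) powr z - of_nat l powr z) has_sum of_nat M powr z) {M<..}"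
proof (rule has_sum_greaterThan)
  define f where "f n = (of_nat (n + M) :: complex) powr z" for n
  have lim: "f \<longlonglongrightarrow> 0"
  proof -
    have "(\<lambda>n. real n powr Re z) \<longlonglongrightarrow> 0" using z by real_asymp
    then have "(\<lambda>n. real (n + M) powr Re z) \<longlonglongrightarrow> 0" by (rule LIMSEQ_ignore_initial_segment)
    moreover have "norm (f n) = real (n + M) powr Re z" for n
      unfolding f_def by (subst norm_powr_real_powr) auto
    ultimately show ?thesis by (simp add: tendsto_norm_zero_iff[symmetric, of f])
  qed
  have tel: "(\<lambda>n. f n - f (Suc n)) sums (of_nat M powr z)"
    using telescope_sums'[OF lim] by (simp add: f_def)
  define C where "C = norm z * 2 powr \<bar>Re z - 1\<bar>"
  have "summable (\<lambda>n. norm (f n - f (Suc n)))"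
  proof (rule summable_comparison_test_ev)
    show "\<forall>\<^sub>F n in sequentially. norm (norm (f n - f (Suc n))) \<le> C * real (n + Suc M) powr (Re z - 1)"
      \<comment> \<open>For n \<ge> 1 the Taylor estimate applies, as it asks for Suc (n + M) \<ge>
        2.\<close>
      using eventually_ge_at_top[of 1]
    proof eventually_elim
      case (elim n)
      then have "norm (of_nat (Suc (n + M) - 1) powr z - of_nat (Suc (n + M)) powr z)
        \<le> C * real (Suc (n + M)) powr (Re z - 1)"
        using powr_pred_Taylor[of "Suc (n + M)" z 0] by (simp add: C_def)
      then show ?case by (simp add: f_def)
    qed
    have "summable (\<lambda>n. C * real n powr (Re z - 1))"
      using z by (intro summable_mult) (simp add: summable_real_powr_iff)
    then show "summable (\<lambda>n. C * real (n + Suc M) powr (Re z - 1))"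
      by (rule summable_ignore_initial_segment)
  qed
  from norm_summable_imp_has_sum[OF this tel]
  show "((\<lambda>n. of_nat (Suc (n + M) - 1) powr z - of_nat (Suc (n + M)) powr z) has_sum of_nat M powr z) UNIV"
    by (simp add: f_def)
qed

text \<open>A discrete integral test: by the mean value theorem each term is at most the drop of x
  powr (1 - \<sigma>) / (\<sigma> - 1) over the unit interval that ends there.\<close>

lemma powr_tail:
  fixes \<sigma> :: real
  assumes \<sigma>: "\<sigma> > 1"
  shows "(\<lambda>l. real l powr - \<sigma>) summable_on {M<..}"
    and "M \<ge> 1 \<Longrightarrow> (\<Sum>\<^sub>\<infinity>l\<in>{M<..}. real l powr - \<sigma>) \<le> real M powr (1 - \<sigma>) / (\<sigma> - 1)"
proof -
  have "(\<lambda>l. real l powr - \<sigma>) summable_on UNIV"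
    using \<sigma> by (intro summable_nonneg_imp_summable_on) (auto simp: summable_real_powr_iff)
  then show summ: "(\<lambda>l. real l powr - \<sigma>) summable_on {M<..}"
    by (rule summable_on_subset_banach) auto
  show "(\<Sum>\<^sub>\<infinity>l\<in>{M<..}. real l powr - \<sigma>) \<le> real M powr (1 - \<sigma>) / (\<sigma> - 1)" if M: "M \<ge> 1"
  proof -
    define f where "f n = real (n + M) powr (1 - \<sigma>) / (\<sigma> - 1)" for n
    have "f \<longlonglongrightarrow> 0"
    proof -
      have "(\<lambda>n. real n powr (1 - \<sigma>) / (\<sigma> - 1)) \<longlonglongrightarrow> 0" using \<sigma> by real_asymp
      then show ?thesis unfolding f_def by (rule LIMSEQ_ignore_initial_segment)
    qed
    then have tel: "(\<lambda>n. f n - f (Suc n)) sums (real M powr (1 - \<sigma>) / (\<sigma> - 1))"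
      using telescope_sums' by (fastforce simp: f_def)
    have le: "real (Suc (n + M)) powr - \<sigma> \<le> f n - f (Suc n)" for n
    proof -
      define a where "a = real (n + M)"
      have a: "a \<ge> 1" using M by (auto simp: a_def)
      have "\<exists>x>a. x < a + 1 \<and> (a + 1) powr (1 - \<sigma>) / (\<sigma> - 1) - a powr (1 - \<sigma>) / (\<sigma> - 1) = (a + 1 - a) * (- (x powr - \<sigma>))"
      proof (rule MVT2)
        fix x assume "a \<le> x"
        show "((\<lambda>x. x powr (1 - \<sigma>) / (\<sigma> - 1)) has_real_derivative - (x powr - \<sigma>)) (at x)"
        proof -
          have "((\<lambda>x. x powr (1 - \<sigma>)) has_real_derivative (1 - \<sigma>) * x powr (1 - \<sigma> - 1)) (at x)"
            using a \<open>a \<le> x\<close> by (intro has_real_derivative_powr) auto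
          from DERIV_cdivide[OF this, of "\<sigma> - 1"]
          have "((\<lambda>x. x powr (1 - \<sigma>) / (\<sigma> - 1)) has_real_derivative (1 - \<sigma>) * x powr - \<sigma> / (\<sigma> - 1)) (at x)"
            by simp
          moreover have "(1 - \<sigma>) * x powr - \<sigma> / (\<sigma> - 1) = - (x powr - \<sigma>)"
            using \<sigma> by (simp add: divide_eq_eq) (simp add: algebra_simps)
          ultimately show ?thesis by simp
        qed
      qed auto
      then obtain x where x: "x > a" "x < a + 1"
        "a powr (1 - \<sigma>) / (\<sigma> - 1) - (a + 1) powr (1 - \<sigma>) / (\<sigma> - 1) = x powr - \<sigma>"
        by (auto simp: algebra_simps)
      have "(a + 1) powr - \<sigma> \<le> x powr - \<sigma>"
        using x a \<sigma> by (intro powr_mono2') auto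
      then show ?thesis using x(3) by (simp add: f_def a_def add_ac)
    qed
    then have "0 \<le> f n - f (Suc n)" for n by (meson order_trans powr_ge_zero)
    from sums_nonneg_imp_has_sum[OF tel this]
    have hs: "((\<lambda>n. f n - f (Suc n)) has_sum (real M powr (1 - \<sigma>) / (\<sigma> - 1))) UNIV" .
    have "((\<lambda>l. f (l - Suc M) - f (Suc (l - Suc M))) has_sum (real M powr (1 - \<sigma>) / (\<sigma> - 1))) {M<..}"
      by (rule has_sum_greaterThan) (use hs in simp)
    moreover have "real l powr - \<sigma> \<le> f (l - Suc M) - f (Suc (l - Suc M))" if "l \<in> {M<..}" for l
      using le[of "l - Suc M"] that by (simp add: Suc_diff_Suc)
    ultimately show ?thesis
      using has_sum_mono[OF has_sum_infsum[OF summ]] by blast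
  qed
qed


section \<open>Increasing tuples\<close>

definition inctup :: "nat \<Rightarrow> (nat \<Rightarrow> nat) set"
  where "inctup r = {m \<in> {1..r} \<rightarrow>\<^sub>E {1..}. strict_mono_on {1..r} m}"

lemma inctupD:
  assumes "m \<in> inctup r"
  shows "m \<in> extensional {1..r}" "\<And>i. 1 \<le> i \<Longrightarrow> i \<le> r \<Longrightarrow> m i \<ge> 1"
    "\<And>i k. 1 \<le> i \<Longrightarrow> i < k \<Longrightarrow> k \<le> r \<Longrightarrow> m i < m k"
    "\<And>i k. 1 \<le> i \<Longrightarrow> i \<le> k \<Longrightarrow> k \<le> r \<Longrightarrow> m i \<le> m k"
proof -
  show *: "m i < m k" if "1 \<le> i" "i < k" "k \<le> r" for i k
    using assms that by (auto simp: inctup_def intro!: strict_mono_onD[of "{1..r}" m])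
  show "m i \<le> m k" if "1 \<le> i" "i \<le> k" "k \<le> r" for i k
    using *[of i k] that by (cases "i = k") auto
qed (use assms in \<open>auto simp: inctup_def PiE_def Pi_def\<close>)

lemma inctupI:
  assumes "m \<in> extensional {1..r}" "\<And>i. 1 \<le> i \<Longrightarrow> i \<le> r \<Longrightarrow> m i \<ge> 1"
    "\<And>i k. 1 \<le> i \<Longrightarrow> i < k \<Longrightarrow> k \<le> r \<Longrightarrow> m i < m k"
  shows "m \<in> inctup r"
  using assms by (auto simp: inctup_def PiE_def Pi_def strict_mono_on_def)

lemma inctup_0: "inctup 0 = {\<lambda>_. undefined}"
  by (auto simp: inctup_def strict_mono_on_def)

definition insert_at :: "nat \<Rightarrow> nat \<Rightarrow> nat \<Rightarrow> (nat \<Rightarrow> nat) \<Rightarrow> nat \<Rightarrow> nat"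
  where "insert_at j r l m = (\<lambda>i\<in>{1..Suc r}. if i < j then m i else if i = j then l else m (i - 1))"

definition remove_at :: "nat \<Rightarrow> nat \<Rightarrow> (nat \<Rightarrow> nat) \<Rightarrow> nat \<Rightarrow> nat"
  where "remove_at j r m = (\<lambda>i\<in>{1..r}. if i < j then m i else m (Suc i))"

text \<open>The value 0 in front of the first entry treats j = 1 like the other positions; since
  \<open>0 powr z = 0\<close> it also removes the boundary term in depth one.\<close>

definition pred_entry :: "nat \<Rightarrow> (nat \<Rightarrow> nat) \<Rightarrow> nat"
  where "pred_entry j m = (if j = 1 then 0 else m (j - 1))"

text \<open>The values admissible at position j. The set is finite for j \<le> r and infinite for j
  = Suc r, which separates the Faulhaber case from the Euler-Maclaurin case.\<close>

definition gap :: "nat \<Rightarrow> nat \<Rightarrow> (nat \<Rightarrow> nat) \<Rightarrow> nat set"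
  where "gap j r m = {l. pred_entry j m < l \<and> (j \<le> r \<longrightarrow> l < m j)}"

lemma gap_last: "gap (Suc r) r m = {pred_entry (Suc r) m<..}"
  by (auto simp: gap_def)

text \<open>Every exchange of summation below rests on this splitting: an outer sum over shorter
  tuples and an inner sum over the gap.\<close>

lemma bij_betw_insert_at:
  assumes j: "j \<in> {1..Suc r}"
  shows "bij_betw (\<lambda>(m, l). insert_at j r l m) (Sigma (inctup r) (gap j r)) (inctup (Suc r))"
proof (rule bij_betwI[where g = "\<lambda>m. (remove_at j r m, m j)"])
  show "(\<lambda>(m, l). insert_at j r l m) \<in> Sigma (inctup r) (gap j r) \<rightarrow> inctup (Suc r)"
  proof (intro funcsetI, clarify)
    fix m l assume m: "m \<in> inctup r" and l: "l \<in> gap j r m"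
    note mD = inctupD[OF m]
    have below: "m i < l" if "1 \<le> i" "i < j" for i
    proof -
      have "m i \<le> m (j - 1)" using mD(4)[of i "j - 1"] that j by simp
      then show ?thesis using l that by (simp add: gap_def pred_entry_def)
    qed
    have above: "l < m i" if "j \<le> i" "i \<le> r" for i
    proof -
      have "m j \<le> m i" using mD(4)[of j i] that j by simp
      then show ?thesis using l that by (simp add: gap_def)
    qed
    show "insert_at j r l m \<in> inctup (Suc r)"
    proof (rule inctupI)
      fix i assume i: "1 \<le> i" "i \<le> Suc r"
      show "1 \<le> insert_at j r l m i"
        using i j l mD(2)[of i] mD(2)[of "i - 1"] by (auto simp: insert_at_def gap_def)
    next
      fix i k assume ik: "1 \<le> i" "i < k" "k \<le> Suc r"
      consider "k < j" | "i < j" "k = j" | "i < j" "k > j" | "i = j" | "i > j" using ik by linarith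
      then show "insert_at j r l m i < insert_at j r l m k"
      proof cases
        case 1
        then show ?thesis using mD(3)[of i k] ik j by (simp add: insert_at_def)
      next
        case 2
        then show ?thesis using below[of i] ik j by (simp add: insert_at_def)
      next
        case 3
        then show ?thesis using mD(3)[of i "k - 1"] ik j by (simp add: insert_at_def)
      next
        case 4
        then show ?thesis using above[of "k - 1"] ik j by (simp add: insert_at_def)
      next
        case 5
        then show ?thesis using mD(3)[of "i - 1" "k - 1"] ik j by (simp add: insert_at_def)
      qed
    qed (simp add: insert_at_def)
  qed
  show "(\<lambda>m. (remove_at j r m, m j)) \<in> inctup (Suc r) \<rightarrow> Sigma (inctup r) (gap j r)"
  proof (intro funcsetI)
    fix m assume m: "m \<in> inctup (Suc r)"
    note mD = inctupD[OF m]
    have "remove_at j r m \<in> inctup r"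
    proof (rule inctupI)
      fix i k assume ik: "1 \<le> i" "i < k" "k \<le> r"
      show "remove_at j r m i < remove_at j r m k"
        using mD(3)[of i k] mD(3)[of i "Suc k"] mD(3)[of "Suc i" "Suc k"] ik by (simp add: remove_at_def)
    qed (use mD(2) in \<open>auto simp: remove_at_def\<close>)
    moreover have "m j \<in> gap j r (remove_at j r m)"
      using mD(2)[of j] mD(3)[of j "Suc j"] mD(3)[of "j - 1" j] j
      by (auto simp: gap_def remove_at_def pred_entry_def)
    ultimately show "(remove_at j r m, m j) \<in> Sigma (inctup r) (gap j r)" by simp
  qed
  show "(case (remove_at j r m, m j) of (m, l) \<Rightarrow> insert_at j r l m) = m" if "m \<in> inctup (Suc r)" for m
    using inctupD(1)[OF that] j
    by (auto simp: insert_at_def remove_at_def extensional_def fun_eq_iff)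
  show "(remove_at j r (case ml of (m, l) \<Rightarrow> insert_at j r l m), (case ml of (m, l) \<Rightarrow> insert_at j r l m) j) = ml"
    if "ml \<in> Sigma (inctup r) (gap j r)" for ml
    using that inctupD(1)[of "fst ml" r] j
    by (cases ml) (auto simp: insert_at_def remove_at_def extensional_def fun_eq_iff)
qed

lemma prod_insert_at:
  fixes f :: "nat \<Rightarrow> nat \<Rightarrow> 'a :: comm_monoid_mult"
  assumes j: "j \<in> {1..Suc r}"
  shows "(\<Prod>i=1..Suc r. f i (insert_at j r l m i)) =
    f j l * (\<Prod>i=1..r. f (if i < j then i else Suc i) (m i))"
proof -
  let ?s = "\<lambda>i. if i < j then i else Suc i"
  have img: "{1..Suc r} - {j} = ?s ` {1..r}"
  proof (intro equalityI subsetI)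
    fix x assume x: "x \<in> {1..Suc r} - {j}"
    show "x \<in> ?s ` {1..r}"
    proof (cases "x < j")
      case True
      then show ?thesis using x j by (intro image_eqI[of _ _ x]) auto
    next
      case False
      then show ?thesis using x j by (intro image_eqI[of _ _ "x - 1"]) auto
    qed
  qed (use j in \<open>auto split: if_splits\<close>)
  have inj: "inj_on ?s {1..r}" by (auto simp: inj_on_def split: if_splits)
  have "(\<Prod>i=1..Suc r. f i (insert_at j r l m i)) =
      f j (insert_at j r l m j) * (\<Prod>i\<in>{1..Suc r} - {j}. f i (insert_at j r l m i))"
    using j by (intro prod.remove) auto
  also have "(\<Prod>i\<in>{1..Suc r} - {j}. f i (insert_at j r l m i)) = (\<Prod>i=1..r. f (?s i) (insert_at j r l m (?s i)))"
    unfolding img by (rule prod.reindex[OF inj, unfolded o_def])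
  also have "\<dots> = (\<Prod>i=1..r. f (?s i) (m i))"
    by (rule prod.cong) (auto simp: insert_at_def)
  finally show ?thesis using j by (simp add: insert_at_def)
qed

text \<open>Induction on the depth: by \<open>powr_tail\<close>, summing out the last entry costs a
  factor m_r powr (1 - \<sigma> (Suc r)), up to a constant.\<close>

lemma summable_inctup:
  fixes \<sigma> :: "nat \<Rightarrow> real"
  assumes "\<And>k. k \<in> {1..r} \<Longrightarrow> (\<Sum>i=k..r. \<sigma> i) > real (r + 1 - k)"
  shows "(\<lambda>m. \<Prod>i=1..r. real (m i) powr - \<sigma> i) summable_on inctup r"
  using assms
proof (induction r arbitrary: \<sigma>)
  case 0
  then show ?case by (simp add: inctup_0)
next
  case (Suc r)
  have \<sigma>: "\<sigma> (Suc r) > 1" using Suc.prems[of "Suc r"] by simp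
  let ?P = "\<lambda>\<sigma> m. \<Prod>i=1..r. real (m i) powr - \<sigma> i"
  define g where "g m = (\<Sum>\<^sub>\<infinity>l\<in>gap (Suc r) r m. ?P \<sigma> m * real l powr - \<sigma> (Suc r))" for m
  have hs: "((\<lambda>l. ?P \<sigma> m * real l powr - \<sigma> (Suc r)) has_sum g m) (gap (Suc r) r m)" for m
    unfolding g_def gap_last
    by (intro has_sum_infsum summable_on_cmult_right powr_tail \<sigma>)
  have g: "g summable_on inctup r"
  proof (cases "r = 0")
    case True
    then show ?thesis by (simp add: inctup_0)
  next
    case False
    \<comment> \<open>The cost of the last sum is merged into exponent r. The conditions on \<tau>
      are those on \<sigma> for k \<le> r, both sides lowered by 1.\<close>
    define \<tau> where "\<tau> = \<sigma>(r := \<sigma> r + \<sigma> (Suc r) - 1)"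
    have "?P \<tau> summable_on inctup r"
    proof (rule Suc.IH)
      fix k assume k: "k \<in> {1..r}"
      have "(\<Sum>i=k..r. \<tau> i) = \<tau> r + (\<Sum>i\<in>{k..r} - {r}. \<tau> i)"
        using k by (intro sum.remove) auto
      also have "(\<Sum>i\<in>{k..r} - {r}. \<tau> i) = (\<Sum>i\<in>{k..r} - {r}. \<sigma> i)"
        by (rule sum.cong) (auto simp: \<tau>_def)
      also have "\<tau> r + \<dots> = (\<sigma> r + (\<Sum>i\<in>{k..r} - {r}. \<sigma> i)) + \<sigma> (Suc r) - 1"
        by (simp add: \<tau>_def)
      also have "\<sigma> r + (\<Sum>i\<in>{k..r} - {r}. \<sigma> i) = (\<Sum>i=k..r. \<sigma> i)"
        using k by (intro sum.remove[symmetric]) auto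
      also have "\<dots> + \<sigma> (Suc r) = (\<Sum>i=k..Suc r. \<sigma> i)" using k by simp
      finally show "(\<Sum>i=k..r. \<tau> i) > real (r + 1 - k)"
        using Suc.prems[of k] k by (simp add: of_nat_diff)
    qed
    then have "(\<lambda>m. ?P \<tau> m * (1 / (\<sigma> (Suc r) - 1))) summable_on inctup r"
      by (rule summable_on_cmult_left)
    then show ?thesis
    proof (rule summable_on_comparison_test)
      fix m assume m: "m \<in> inctup r"
      show "0 \<le> g m" unfolding g_def by (intro infsum_nonneg mult_nonneg_nonneg prod_nonneg) auto
      have mr: "m r \<ge> 1" using inctupD(2)[OF m, of r] False by simp
      have eq: "?P \<sigma>' m = real (m r) powr - \<sigma>' r * (\<Prod>i\<in>{1..r} - {r}. real (m i) powr - \<sigma>' i)" for \<sigma>'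
        using False by (intro prod.remove) auto
      have P\<tau>: "?P \<tau> m = ?P \<sigma> m * real (m r) powr (1 - \<sigma> (Suc r))"
      proof -
        have "real (m r) powr - \<tau> r = real (m r) powr - \<sigma> r * real (m r) powr (1 - \<sigma> (Suc r))"
          by (simp add: \<tau>_def powr_add[symmetric] algebra_simps)
        moreover have "(\<Prod>i\<in>{1..r} - {r}. real (m i) powr - \<tau> i) = (\<Prod>i\<in>{1..r} - {r}. real (m i) powr - \<sigma> i)"
          by (rule prod.cong) (auto simp: \<tau>_def)
        ultimately show ?thesis using eq[of \<tau>] eq[of \<sigma>] by (simp add: mult_ac)
      qed
      have "g m = ?P \<sigma> m * (\<Sum>\<^sub>\<infinity>l\<in>{m r<..}. real l powr - \<sigma> (Suc r))"
        unfolding g_def gap_last pred_entry_def using False by (simp add: infsum_cmult_right')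
      also have "\<dots> \<le> ?P \<sigma> m * (real (m r) powr (1 - \<sigma> (Suc r)) / (\<sigma> (Suc r) - 1))"
        by (intro mult_left_mono powr_tail(2)[OF \<sigma> mr] prod_nonneg) auto
      also have "\<dots> = ?P \<tau> m * (1 / (\<sigma> (Suc r) - 1))" unfolding P\<tau> by simp
      finally show "g m \<le> ?P \<tau> m * (1 / (\<sigma> (Suc r) - 1))" .
    qed
  qed
  have "(\<lambda>(m, l). ?P \<sigma> m * real l powr - \<sigma> (Suc r)) summable_on Sigma (inctup r) (gap (Suc r) r)"
    by (rule summable_on_SigmaI[where g = g]) (use hs g in \<open>auto intro!: prod_nonneg mult_nonneg_nonneg\<close>)
  moreover have "(\<Prod>i=1..Suc r. real (insert_at (Suc r) r l m i) powr - \<sigma> i) =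
      ?P \<sigma> m * real l powr - \<sigma> (Suc r)" for m l
    by (subst prod_insert_at) (auto simp: mult.commute intro!: prod.cong)
  ultimately have "(\<lambda>ml. \<Prod>i=1..Suc r. real ((case ml of (m, l) \<Rightarrow> insert_at (Suc r) r l m) i) powr - \<sigma> i)
      summable_on Sigma (inctup r) (gap (Suc r) r)"
    by (simp add: case_prod_unfold)
  then show ?case
    by (subst (asm) summable_on_reindex_bij_betw[OF bij_betw_insert_at]) simp_all
qed


section \<open>Euler--Maclaurin corrections\<close>

text \<open>Lets the termination proof of \<open>bern\<close> use i < n inside the sum.\<close>

lemmas [fundef_cong] = sum.cong

text \<open>The Bernoulli numbers with the convention \<open>B\<^sub>1 = 1/2\<close>.\<close>

fun bern :: "nat \<Rightarrow> complex" where
  "bern n = (if n = 0 then 1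
     else (\<Sum>i<n. of_nat (Suc n choose i) * (-1) ^ (Suc n - i) * bern i) / of_nat (Suc n))"

declare bern.simps [simp del]

lemma bern_0: "bern 0 = 1"
  by (simp add: bern.simps)

text \<open>For N \<ge> 2 this is the recursion of \<open>bern\<close> at N - 1; only N = 1 has a
  nonzero right-hand side.\<close>

lemma bern_sum:
  assumes "N \<ge> 1"
  shows "(\<Sum>i<N. of_nat (N choose i) * (-1) ^ (N - i) * bern i) = (if N = 1 then - 1 else 0)"
proof (cases "N = 1")
  case True
  then show ?thesis by (simp add: bern_0)
next
  case False
  define n where "n = N - 1"
  have N: "N = Suc n" "n > 0" using False assms by (auto simp: n_def)
  have "of_nat (Suc n) * bern n = (\<Sum>i<n. of_nat (Suc n choose i) * (-1) ^ (Suc n - i) * bern i)"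
    using N by (subst bern.simps) (simp del: of_nat_Suc)
  then show ?thesis using N by (simp add: algebra_simps)
qed

text \<open>Grouping by n = i + l and using trinomial revision extracts \<open>w gchoose n\<close>;
  the inner sum is \<open>bern_sum\<close>, so only n = 1 survives. The sequence p is free because
  it serves for powers of x as well as for m powr (w - n).\<close>

lemma bern_convolution:
  fixes w :: complex and p :: "nat \<Rightarrow> complex"
  assumes K: "K \<ge> 1"
  shows "(\<Sum>i<K. \<Sum>l=1..K - i. (w gchoose i) * bern i * ((w - of_nat i gchoose l) * (-1) ^ l * p (i + l))) = - w * p 1"
proof -
  have "(\<Sum>i<K. \<Sum>l=1..K - i. (w gchoose i) * bern i * ((w - of_nat i gchoose l) * (-1) ^ l * p (i + l))) =
    (\<Sum>(i, l)\<in>(SIGMA i:{..<K}. {1..K - i}). (w gchoose i) * bern i * ((w - of_nat i gchoose l) * (-1) ^ l * p (i + l)))"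
    by (rule sum.Sigma) auto
  also have "\<dots> = (\<Sum>(n, i)\<in>(SIGMA n:{1..K}. {..<n}). (w gchoose n) * p n * (of_nat (n choose i) * (-1) ^ (n - i) * bern i))"
  proof (rule sum.reindex_bij_witness[where i = "\<lambda>(n, i). (i, n - i)" and j = "\<lambda>(i, l). (i + l, i)"])
    fix x assume x: "x \<in> (SIGMA i:{..<K}. {1..K - i})"
    obtain i l where il: "x = (i, l)" by (cases x)
    have "(w gchoose (i + l)) * (of_nat (i + l) gchoose i) = (w gchoose i) * (w - of_nat i gchoose l)"
      using gbinomial_trinomial_revision[of i "i + l" w] by simp
    then have "(w gchoose i) * (w - of_nat i gchoose l) = (w gchoose (i + l)) * of_nat ((i + l) choose i)"
      by (simp add: binomial_gbinomial)
    then show "(case case x of (i, l) \<Rightarrow> (i + l, i) of (n, i) \<Rightarrow> (w gchoose n) * p n * (of_nat (n choose i) * (-1) ^ (n - i) * bern i)) =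
      (case x of (i, l) \<Rightarrow> (w gchoose i) * bern i * ((w - of_nat i gchoose l) * (-1) ^ l * p (i + l)))"
      by (simp add: il mult_ac)
  qed auto
  also have "\<dots> = (\<Sum>n=1..K. \<Sum>i<n. (w gchoose n) * p n * (of_nat (n choose i) * (-1) ^ (n - i) * bern i))"
    by (rule sum.Sigma[symmetric]) auto
  also have "\<dots> = (\<Sum>n=1..K. (w gchoose n) * p n * (if n = 1 then - 1 else 0))"
    unfolding sum_distrib_left[symmetric] by (rule sum.cong) (auto simp: bern_sum)
  also have "\<dots> = (\<Sum>n=1..K. if n = 1 then - w * p 1 else 0)"
    by (rule sum.cong) auto
  also have "\<dots> = - w * p 1" using K by (simp add: sum.delta)
  finally show ?thesis .
qed

text \<open>The difference equation of the Bernoulli polynomials, in backward form because B_1 =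
  1/2.\<close>

lemma bern_difference:
  fixes x :: complex
  assumes N: "N \<ge> 1"
  shows "(\<Sum>i\<le>N. of_nat (N choose i) * bern i * (x ^ (N - i) - (x - 1) ^ (N - i))) = of_nat N * x ^ (N - 1)"
proof -
  have "(x - 1) ^ (N - i) - x ^ (N - i) = (\<Sum>l=1..N - i. (of_nat N - of_nat i gchoose l) * (-1) ^ l * x ^ (N - (i + l)))"
    if "i < N" for i
  proof -
    have "(x - 1) ^ (N - i) = (\<Sum>l\<le>N - i. of_nat ((N - i) choose l) * (-1) ^ l * x ^ (N - i - l))"
      using binomial_ring[of "-1" x "N - i"] by simp
    also have "\<dots> = (\<Sum>l=0..N - i. of_nat ((N - i) choose l) * (-1) ^ l * x ^ (N - i - l))"
      by (simp add: atLeast0AtMost)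
    also have "\<dots> = x ^ (N - i) + (\<Sum>l=1..N - i. of_nat ((N - i) choose l) * (-1) ^ l * x ^ (N - i - l))"
      by (subst sum.atLeast_Suc_atMost) auto
    finally have "(x - 1) ^ (N - i) - x ^ (N - i) = (\<Sum>l=1..N - i. of_nat ((N - i) choose l) * (-1) ^ l * x ^ (N - i - l))"
      by simp
    then show ?thesis
      using that by (simp add: binomial_gbinomial of_nat_diff diff_diff_left)
  qed
  then have "(\<Sum>i<N. of_nat (N choose i) * bern i * ((x - 1) ^ (N - i) - x ^ (N - i))) =
    (\<Sum>i<N. \<Sum>l=1..N - i. (of_nat N gchoose i) * bern i * ((of_nat N - of_nat i gchoose l) * (-1) ^ l * x ^ (N - (i + l))))"
    by (intro sum.cong refl) (simp add: binomial_gbinomial sum_distrib_left)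
  also have "\<dots> = - of_nat N * x ^ (N - 1)"
    using bern_convolution[OF N, of "of_nat N" "\<lambda>k. x ^ (N - k)"] .
  finally have *: "(\<Sum>i<N. of_nat (N choose i) * bern i * ((x - 1) ^ (N - i) - x ^ (N - i))) = - of_nat N * x ^ (N - 1)" .
  have "(\<Sum>i\<le>N. of_nat (N choose i) * bern i * (x ^ (N - i) - (x - 1) ^ (N - i))) =
    (\<Sum>i<N. - (of_nat (N choose i) * bern i * ((x - 1) ^ (N - i) - x ^ (N - i))))"
    unfolding lessThan_Suc_atMost[symmetric] sum.lessThan_Suc by (simp add: algebra_simps)
  also have "\<dots> = of_nat N * x ^ (N - 1)" unfolding sum_negf * by simp
  finally show ?thesis .
qed

lemma faulhaber:
  assumes N: "N \<ge> 1" and ab: "a \<le> b"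
  shows "(\<Sum>l\<in>{a<..b}. of_nat N * of_nat l ^ (N - 1)) =
    (\<Sum>i\<le>N. of_nat (N choose i) * bern i * (of_nat b ^ (N - i) - of_nat a ^ (N - i)))"
  using ab
proof (induction b rule: dec_induct)
  case (step b)
  have "{a<..Suc b} = insert (Suc b) {a<..b}" using step by auto
  moreover have "(\<Sum>i\<le>N. of_nat (N choose i) * bern i * (of_nat (Suc b) ^ (N - i) - of_nat a ^ (N - i))) =
      (\<Sum>i\<le>N. of_nat (N choose i) * bern i * (of_nat (Suc b) ^ (N - i) - (of_nat (Suc b) - 1) ^ (N - i))) +
      (\<Sum>i\<le>N. of_nat (N choose i) * bern i * (of_nat b ^ (N - i) - of_nat a ^ (N - i)))"
    by (simp add: sum.distrib[symmetric] distrib_left[symmetric])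
  ultimately show ?case
    using step.IH bern_difference[OF N, of "of_nat (Suc b)"] by simp
qed simp

text \<open>The Euler-Maclaurin expansion, cut after K terms and without its constant, of w times
  the sum of l powr (w - 1) over 1 \<le> l \<le> M.\<close>

definition em_main :: "nat \<Rightarrow> complex \<Rightarrow> nat \<Rightarrow> complex"
  where "em_main K w M = (\<Sum>i<K. (w gchoose i) * bern i * of_nat M powr (w - of_nat i))"

text \<open>Since \<open>0 powr z = 0\<close>, the case \<open>m = 1\<close> contains the boundary term of the summation.\<close>

definition em_err :: "nat \<Rightarrow> complex \<Rightarrow> nat \<Rightarrow> complex"
  where "em_err K s m = (s - 1) * of_nat m powr (- s) - em_main K (1 - s) (m - 1) + em_main K (1 - s) m"

lemma em_err_0: "em_err 0 s m = (s - 1) * of_nat m powr (- s)"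
  by (simp add: em_err_def em_main_def)

text \<open>The term split off is a difference of consecutive powers, so it telescopes when summed
  over m.\<close>

lemma em_err_Suc:
  "em_err K s m = (1 - s gchoose K) * bern K *
     (of_nat (m - 1) powr (1 - s - of_nat K) - of_nat m powr (1 - s - of_nat K)) + em_err (Suc K) s m"
  by (simp add: em_err_def em_main_def algebra_simps)

text \<open>Expanding the powers of m - 1 around m, \<open>bern_convolution\<close> cancels
  everything except Taylor remainders. By trinomial revision each of them carries the factor
  \<open>1 - s gchoose Suc K\<close>; keeping it explicit is what makes the error vanish at negative
  integers. The summand 1 in the constant covers K = 0.\<close>

lemma em_err_bound:
  assumes m: "m \<ge> 2"
  shows "norm (em_err K s m) \<le> norm (1 - s gchoose Suc K) *
    (1 + (\<Sum>i<K. norm (bern i) * real (Suc K choose i) * real (Suc K))) * 2 powr \<bar>Re s + real K\<bar> * real m powr (- Re s - real K)"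
    (is "_ \<le> _ * (1 + ?S) * ?T * ?P")
proof (cases "K = 0")
  case True
  have "norm (em_err K s m) = norm (1 - s) * real m powr (- Re s)"
    unfolding True em_err_0 norm_mult using m by (subst norm_powr_real_powr) (auto simp: norm_minus_commute)
  also have "\<dots> \<le> norm (1 - s) * (2 powr \<bar>Re s\<bar> * real m powr (- Re s))"
    using mult_right_mono[of 1 "2 powr \<bar>Re s\<bar>" "real m powr - Re s"]
    by (intro mult_left_mono) (auto simp: ge_one_powr_ge_zero)
  finally show ?thesis using True by (simp add: mult_ac)
next
  case False
  define w where "w = 1 - s"
  \<comment> \<open>The i-th power is expanded to order K - i, so that all remainders have the same
    order m powr (w - Suc K).\<close>
  define R where "R i = of_nat (m - 1) powr (w - of_nat i) -
    (\<Sum>l\<le>K - i. (w - of_nat i gchoose l) * (-1) ^ l * of_nat m powr (w - of_nat i - of_nat l))" for i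
  have diff: "of_nat (m - 1) powr (w - of_nat i) - of_nat m powr (w - of_nat i) =
     R i + (\<Sum>l=1..K - i. (w - of_nat i gchoose l) * (-1) ^ l * of_nat m powr (w - of_nat (i + l)))" for i
  proof -
    have "(\<Sum>l\<le>K - i. (w - of_nat i gchoose l) * (-1) ^ l * of_nat m powr (w - of_nat i - of_nat l)) =
      of_nat m powr (w - of_nat i) + (\<Sum>l=1..K - i. (w - of_nat i gchoose l) * (-1) ^ l * of_nat m powr (w - of_nat i - of_nat l))"
      unfolding atMost_atLeast0 by (subst sum.atLeast_Suc_atMost) auto
    then show ?thesis by (simp add: R_def diff_diff_eq)
  qed
  have "em_err K s m = - w * of_nat m powr (w - of_nat 1) -
      (\<Sum>i<K. (w gchoose i) * bern i * (of_nat (m - 1) powr (w - of_nat i) - of_nat m powr (w - of_nat i)))"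
    by (simp add: em_err_def em_main_def w_def right_diff_distrib sum_subtractf)
  also have "(\<Sum>i<K. (w gchoose i) * bern i * (of_nat (m - 1) powr (w - of_nat i) - of_nat m powr (w - of_nat i))) =
     (\<Sum>i<K. (w gchoose i) * bern i * R i) +
     (\<Sum>i<K. \<Sum>l=1..K - i. (w gchoose i) * bern i * ((w - of_nat i gchoose l) * (-1) ^ l * of_nat m powr (w - of_nat (i + l))))"
    unfolding diff by (simp add: distrib_left sum.distrib sum_distrib_left)
  also have "(\<Sum>i<K. \<Sum>l=1..K - i. (w gchoose i) * bern i * ((w - of_nat i gchoose l) * (-1) ^ l * of_nat m powr (w - of_nat (i + l)))) =
      - w * of_nat m powr (w - of_nat 1)"
    using bern_convolution[of K w "\<lambda>n. of_nat m powr (w - of_nat n)"] False by simp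
  finally have err: "em_err K s m = - (\<Sum>i<K. (w gchoose i) * bern i * R i)" by simp
  have term_le: "norm ((w gchoose i) * bern i * R i) \<le>
     norm (w gchoose Suc K) * (norm (bern i) * real (Suc K choose i) * real (Suc K)) * (?T * ?P)" if i: "i < K" for i
  proof -
    have Suc_i: "Suc (K - i) = Suc K - i" using i by simp
    have e1: "Re (w - of_nat i) - real (Suc (K - i)) = - Re s - real K"
      using i by (simp add: w_def of_nat_diff)
    have e2: "\<bar>- Re s - real K\<bar> = \<bar>Re s + real K\<bar>" by linarith
    have "norm (R i) \<le> norm (w - of_nat i gchoose Suc (K - i)) * real (Suc (K - i)) * ?T * ?P"
      using powr_pred_Taylor[OF m, of "w - of_nat i" "K - i"] unfolding R_def e1 e2 .
    also have "\<dots> \<le> norm (w - of_nat i gchoose Suc (K - i)) * real (Suc K) * ?T * ?P"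
      by (intro mult_right_mono mult_left_mono) auto
    finally have Ri: "norm (R i) \<le> norm (w - of_nat i gchoose Suc (K - i)) * real (Suc K) * ?T * ?P" .
    have tri: "(w gchoose i) * (w - of_nat i gchoose Suc (K - i)) = (w gchoose Suc K) * of_nat (Suc K choose i)"
      using gbinomial_trinomial_revision[of i "Suc K" w] i Suc_i by (simp add: binomial_gbinomial)
    have "norm ((w gchoose i) * bern i * R i) \<le>
       norm (w gchoose i) * norm (bern i) * (norm (w - of_nat i gchoose Suc (K - i)) * real (Suc K) * ?T * ?P)"
      unfolding norm_mult by (intro mult_left_mono Ri) auto
    also have "\<dots> = norm ((w gchoose i) * (w - of_nat i gchoose Suc (K - i))) * (norm (bern i) * real (Suc K)) * (?T * ?P)"
      by (simp add: norm_mult mult_ac del: of_nat_Suc)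
    also have "\<dots> = norm (w gchoose Suc K) * (norm (bern i) * real (Suc K choose i) * real (Suc K)) * (?T * ?P)"
      unfolding tri by (simp add: norm_mult mult_ac del: of_nat_Suc binomial_Suc_Suc)
    finally show ?thesis .
  qed
  have "norm (em_err K s m) \<le> (\<Sum>i<K. norm ((w gchoose i) * bern i * R i))"
    unfolding err norm_minus_cancel by (rule norm_sum)
  also have "\<dots> \<le> (\<Sum>i<K. norm (w gchoose Suc K) * (norm (bern i) * real (Suc K choose i) * real (Suc K)) * (?T * ?P))"
    by (rule sum_mono) (use term_le in auto)
  also have "\<dots> = norm (w gchoose Suc K) * ?S * (?T * ?P)"
    by (simp add: sum_distrib_left sum_distrib_right del: binomial_Suc_Suc of_nat_Suc)
  also have "\<dots> \<le> norm (w gchoose Suc K) * (1 + ?S) * (?T * ?P)"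
    by (intro mult_right_mono mult_left_mono mult_nonneg_nonneg) auto
  finally show ?thesis by (simp add: w_def mult_ac)
qed

text \<open>The last summand takes care of m = 1, which the Taylor estimate does not reach. The
  constant is continuous in s, hence bounded on compact sets.\<close>

definition em_const :: "nat \<Rightarrow> complex \<Rightarrow> real"
  where "em_const K s = norm (1 - s gchoose Suc K) *
    (1 + (\<Sum>i<K. norm (bern i) * real (Suc K choose i) * real (Suc K))) * 2 powr \<bar>Re s + real K\<bar> + norm (em_err K s 1)"

lemma em_const_bound:
  assumes "m \<ge> 1"
  shows "norm (em_err K s m) \<le> em_const K s * real m powr (- Re s - real K)"
proof (cases "m = 1")
  case True
  have "norm (1 - s gchoose Suc K) *
    (1 + (\<Sum>i<K. norm (bern i) * real (Suc K choose i) * real (Suc K))) * 2 powr \<bar>Re s + real K\<bar> \<ge> 0"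
    by (intro mult_nonneg_nonneg add_nonneg_nonneg sum_nonneg) auto
  then show ?thesis by (simp add: True em_const_def)
next
  case False
  then have "norm (em_err K s m) \<le> (em_const K s - norm (em_err K s 1)) * real m powr (- Re s - real K)"
    using em_err_bound[of m K s] assms unfolding em_const_def by simp
  also have "\<dots> \<le> em_const K s * real m powr (- Re s - real K)"
    by (intro mult_right_mono) auto
  finally show ?thesis .
qed

lemma holomorphic_gbinomial [holomorphic_intros]:
  "f holomorphic_on A \<Longrightarrow> (\<lambda>z. f z gchoose k) holomorphic_on A"
  unfolding gbinomial_prod_rev by (intro holomorphic_intros) auto

lemma holomorphic_of_nat_powr:
  "f holomorphic_on A \<Longrightarrow> (\<lambda>z. (of_nat k :: complex) powr f z) holomorphic_on A"
  by (cases "k = 0") (auto intro!: holomorphic_intros)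

lemma holomorphic_em_err: "(\<lambda>s. em_err K s m) holomorphic_on A"
  unfolding em_err_def em_main_def
  by (intro holomorphic_intros holomorphic_of_nat_powr)

lemma continuous_on_em_const: "continuous_on A (em_const K)"
proof -
  have "continuous_on A (\<lambda>s. em_err K s 1)" "continuous_on A (\<lambda>s. 1 - s gchoose Suc K)"
    by (rule holomorphic_on_imp_continuous_on, intro holomorphic_em_err holomorphic_intros)+
  then show ?thesis unfolding em_const_def by (intro continuous_intros) auto
qed

text \<open>The factor in \<open>em_err_bound\<close> is the binomial coefficient of n + 1 over K +
  1, which is 0.\<close>

lemma em_err_neg_nat:
  assumes "K \<ge> Suc n" "m \<ge> 2"
  shows "em_err K (- of_nat n) m = 0"
proof -
  have "(1 - (- of_nat n) :: complex) = of_nat (Suc n)" by simp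
  then have "(1 - (- of_nat n) :: complex) gchoose Suc K = 0"
    using assms by (simp only: binomial_gbinomial[symmetric]) (simp add: binomial_eq_0)
  then have "norm (em_err K (- of_nat n) m) \<le> 0"
    using em_err_bound[OF assms(2), of K "- of_nat n"] by simp
  then show ?thesis by simp
qed

text \<open>At m = 1 the error survives: \<open>em_main\<close> is 0 at 0, because
  \<open>0 powr z = 0\<close> even for z = 0, and at 1 it is (n + 1) + B_(n+1) by the difference
  equation.\<close>

lemma em_err_neg_nat_1:
  assumes "K \<ge> n + 2"
  shows "em_err K (- of_nat n) 1 = bern (Suc n)"
proof -
  have w: "1 - (- of_nat n) = (of_nat (Suc n) :: complex)" by simp
  have "em_main K (of_nat (Suc n)) 1 = (\<Sum>i<K. of_nat (Suc n choose i) * bern i)"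
    by (simp add: em_main_def binomial_gbinomial del: of_nat_Suc binomial_Suc_Suc One_nat_def)
  also have "\<dots> = (\<Sum>i\<le>Suc n. of_nat (Suc n choose i) * bern i)"
    using assms by (intro sum.mono_neutral_right) (auto simp: binomial_eq_0 simp del: binomial_Suc_Suc)
  also have "\<dots> = (\<Sum>i<Suc n. of_nat (Suc n choose i) * bern i) + bern (Suc n)"
    by (simp add: lessThan_Suc_atMost[symmetric] del: binomial_Suc_Suc)
  also have "(\<Sum>i<Suc n. of_nat (Suc n choose i) * bern i) = of_nat (Suc n)"
  proof -
    \<comment> \<open>At x = 1 the difference of powers is 1 for i \<le> n and 0 for i = Suc
      n.\<close>
    have "(\<Sum>i<Suc n. of_nat (Suc n choose i) * bern i) =
      (\<Sum>i\<le>Suc n. of_nat (Suc n choose i) * bern i * (1 ^ (Suc n - i) - (1 - 1) ^ (Suc n - i)))"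
      unfolding lessThan_Suc_atMost[of "Suc n", symmetric] sum.lessThan_Suc[of _ "Suc n"]
      by (simp del: binomial_Suc_Suc sum.lessThan_Suc power_Suc) (auto intro!: sum.cong simp: Suc_diff_le)
    then show ?thesis using bern_difference[of "Suc n" 1] by simp
  qed
  finally have "em_main K (of_nat (Suc n)) 1 = of_nat (Suc n) + bern (Suc n)" .
  moreover have "em_main K (of_nat (Suc n)) 0 = 0" by (simp add: em_main_def)
  ultimately show ?thesis by (simp add: em_err_def w)
qed


section \<open>The meromorphic continuation\<close>

text \<open>Positive real parts of these linear forms describe the domain of convergence; poles with
  k < r can occur only where the form is a nonpositive integer.\<close>

definition zsum :: "nat \<Rightarrow> nat \<Rightarrow> (nat \<Rightarrow> complex) \<Rightarrow> complex"
  where "zsum r k s = (\<Sum>i=k..r. s i) - of_nat (r + 1 - k)"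

text \<open>\<open>mzeta_dom\<close> for the tuple with last entry increased by \<open>K\<close>.\<close>

definition em_dom :: "nat \<Rightarrow> nat \<Rightarrow> (nat \<Rightarrow> complex) set"
  where "em_dom r K = {s \<in> extensional {1..r}. \<forall>k\<in>{1..r}. Re (zsum r k s) + real K > 0}"

lemma mzeta_dom_eq: "mzeta_dom r = em_dom r 0"
  by (auto simp: mzeta_dom_def em_dom_def zsum_def PiE_def)

lemma em_dom_mono: "K \<le> L \<Longrightarrow> em_dom r K \<subseteq> em_dom r L"
  by (auto simp: em_dom_def)

lemma mzeta_series_eq: "mzeta_series r s = (\<Sum>\<^sub>\<infinity>m\<in>inctup r. \<Prod>i=1..r. of_nat (m i) powr - s i)"
  by (simp add: mzeta_series_def inctup_def)

text \<open>For K = 0 this is (s (Suc q) - 1) times the term of the zeta series.\<close>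

definition em_term :: "nat \<Rightarrow> nat \<Rightarrow> (nat \<Rightarrow> complex) \<Rightarrow> (nat \<Rightarrow> nat) \<Rightarrow> complex"
  where "em_term q K s m = (\<Prod>i=1..q. of_nat (m i) powr - s i) * em_err K (s (Suc q)) (m (Suc q))"

definition em_rem :: "nat \<Rightarrow> nat \<Rightarrow> (nat \<Rightarrow> complex) \<Rightarrow> complex"
  where "em_rem q K s = (\<Sum>\<^sub>\<infinity>m\<in>inctup (Suc q). em_term q K s m)"

lemma norm_of_nat_powr: "norm ((of_nat n :: complex) powr z) = real n powr Re z"
  by (subst norm_powr_real_powr) auto

lemma norm_prod_powr:
  "norm (\<Prod>i\<in>A. (of_nat (m i) :: complex) powr - s i) = (\<Prod>i\<in>A. real (m i) powr - Re (s i))"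
  unfolding prod_norm[symmetric] norm_of_nat_powr by simp

text \<open>A summable majorant that is uniform near p, as the M-test requires.\<close>

lemma em_term_bound:
  assumes p: "p \<in> em_dom (Suc q) K"
  obtains e M where "e > 0" "M summable_on inctup (Suc q)" "polydisc {1..Suc q} p e \<subseteq> em_dom (Suc q) K"
    "\<And>s m. s \<in> polydisc {1..Suc q} p e \<Longrightarrow> m \<in> inctup (Suc q) \<Longrightarrow> norm (em_term q K s m) \<le> M m"
proof -
  define r where "r = Suc q"
  define d where "d = Min ((\<lambda>k. Re (zsum r k p) + real K) ` {1..r})"
  have d: "d > 0" "\<And>k. k \<in> {1..r} \<Longrightarrow> d \<le> Re (zsum r k p) + real K"
    using p by (auto simp: d_def em_dom_def r_def)
  \<comment> \<open>Here d is the smallest margin in the conditions defining \<open>em_dom\<close>.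
    Lowering each of the r entries by e costs at most r * e < d.\<close>
  define e where "e = min 1 (d / (real r + 1))"
  have e: "e > 0" "e \<le> 1" using d by (auto simp: e_def)
  have re: "real r * e < d"
  proof -
    have "real r * e \<le> real r * (d / (real r + 1))" by (intro mult_left_mono) (auto simp: e_def)
    also have "\<dots> < d" using d(1) by (simp add: field_simps)
    finally show ?thesis .
  qed
  \<comment> \<open>\<open>em_err\<close> decays K powers faster than the series term, so K is
    credited to the last exponent.\<close>
  define \<sigma> where "\<sigma> i = Re (p i) - e + (if i = r then real K else 0)" for i
  have \<sigma>_sum: "(\<Sum>i=k..r. \<sigma> i) > real (r + 1 - k)" if k: "k \<in> {1..r}" for k
  proof -
    have "(\<Sum>i=k..r. \<sigma> i) = (\<Sum>i=k..r. Re (p i)) - real (r + 1 - k) * e + real K"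
      using k by (simp add: \<sigma>_def sum.distrib sum_subtractf)
    moreover have "real (r + 1 - k) * e \<le> real r * e" using e k by (intro mult_right_mono) auto
    ultimately show ?thesis using d(2)[OF k] re by (simp add: zsum_def)
  qed
  have summ: "(\<lambda>m. \<Prod>i=1..r. real (m i) powr - \<sigma> i) summable_on inctup r"
    by (rule summable_inctup) (use \<sigma>_sum in auto)
  have "compact (em_const K ` cball (p r) e)"
    by (intro compact_continuous_image continuous_on_em_const compact_cball)
  then obtain C where C: "\<And>z. z \<in> cball (p r) e \<Longrightarrow> em_const K z \<le> C"
    by (meson bounded_imp_bdd_above bdd_above.E compact_imp_bounded imageI)
  have re_ge: "Re (p i) - e \<le> Re (s i)" if "s \<in> polydisc {1..r} p e" "i \<in> {1..r}" for s i
  proof -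
    have "norm (p i - s i) < e" using that by (auto simp: mem_polydisc dist_norm)
    then show ?thesis using abs_Re_le_cmod[of "p i - s i"] by simp
  qed
  show ?thesis
  proof (rule that)
    show "e > 0" by (rule e)
    show "(\<lambda>m. C * (\<Prod>i=1..r. real (m i) powr - \<sigma> i)) summable_on inctup (Suc q)"
      using summ unfolding r_def by (rule summable_on_cmult_right)
    show "polydisc {1..Suc q} p e \<subseteq> em_dom (Suc q) K"
    proof
      fix s assume s: "s \<in> polydisc {1..Suc q} p e"
      have "Re (zsum r k s) + real K > 0" if k: "k \<in> {1..r}" for k
      proof -
        have "(\<Sum>i=k..r. Re (p i) - e) \<le> (\<Sum>i=k..r. Re (s i))"
          by (rule sum_mono) (use re_ge[of s] s k in \<open>auto simp: r_def\<close>)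
        moreover have "(\<Sum>i=k..r. \<sigma> i) = (\<Sum>i=k..r. Re (p i) - e) + real K"
          using k by (simp add: \<sigma>_def sum.distrib)
        ultimately show ?thesis using \<sigma>_sum[OF k] by (simp add: zsum_def)
      qed
      then show "s \<in> em_dom (Suc q) K" using s by (auto simp: em_dom_def r_def mem_polydisc)
    qed
    fix s m assume s: "s \<in> polydisc {1..Suc q} p e" and m: "m \<in> inctup (Suc q)"
    have m1: "real (m i) \<ge> 1" if "i \<in> {1..r}" for i
      using inctupD(2)[OF m, of i] that by (simp add: r_def)
    have C0: "0 \<le> C"
    proof -
      have "norm (em_err K (p r) 1) \<le> em_const K (p r)" using em_const_bound[of 1 K "p r"] by simp
      moreover have "em_const K (p r) \<le> C" using e by (intro C) simp
      ultimately show ?thesis using norm_ge_zero[of "em_err K (p r) 1"] by linarith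
    qed
    have "norm (em_term q K s m) = (\<Prod>i=1..q. real (m i) powr - Re (s i)) * norm (em_err K (s r) (m r))"
      by (simp add: em_term_def norm_mult norm_prod_powr r_def)
    also have "\<dots> \<le> (\<Prod>i=1..q. real (m i) powr - \<sigma> i) * (C * real (m r) powr - \<sigma> r)"
    proof (rule mult_mono)
      show "(\<Prod>i=1..q. real (m i) powr - Re (s i)) \<le> (\<Prod>i=1..q. real (m i) powr - \<sigma> i)"
      proof (intro prod_mono conjI)
        fix i assume i: "i \<in> {1..q}"
        then show "real (m i) powr - Re (s i) \<le> real (m i) powr - \<sigma> i"
          using m1[of i] re_ge[of s i] s by (intro powr_mono) (auto simp: \<sigma>_def r_def)
      qed auto
      have "norm (em_err K (s r) (m r)) \<le> em_const K (s r) * real (m r) powr (- Re (s r) - real K)"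
        by (rule em_const_bound) (use m1[of r] in \<open>auto simp: r_def\<close>)
      also have "\<dots> \<le> C * real (m r) powr - \<sigma> r"
      proof (rule mult_mono)
        show "em_const K (s r) \<le> C"
          using s by (intro C) (auto simp: mem_polydisc r_def less_imp_le)
        show "real (m r) powr (- Re (s r) - real K) \<le> real (m r) powr - \<sigma> r"
          using m1[of r] re_ge[of s r] s by (intro powr_mono) (auto simp: \<sigma>_def r_def)
      qed (use C0 in auto)
      finally show "norm (em_err K (s r) (m r)) \<le> C * real (m r) powr - \<sigma> r" .
    qed (auto intro!: prod_nonneg)
    also have "\<dots> = C * (\<Prod>i=1..r. real (m i) powr - \<sigma> i)"
      by (simp add: r_def)
    finally show "norm (em_term q K s m) \<le> C * (\<Prod>i=1..r. real (m i) powr - \<sigma> i)" .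
  qed
qed

lemma em_term_summable:
  assumes "s \<in> em_dom (Suc q) K"
  shows "em_term q K s summable_on inctup (Suc q)"
proof -
  obtain e M where M: "e > 0" "M summable_on inctup (Suc q)"
    "\<And>s' m. s' \<in> polydisc {1..Suc q} s e \<Longrightarrow> m \<in> inctup (Suc q) \<Longrightarrow> norm (em_term q K s' m) \<le> M m"
    using em_term_bound[OF assms] by metis
  have "s \<in> polydisc {1..Suc q} s e"
    using assms M(1) by (intro polydisc_centre) (auto simp: em_dom_def)
  then have "(\<lambda>m. norm (em_term q K s m)) summable_on inctup (Suc q)"
    using M by (intro summable_on_comparison_test[OF M(2)]) auto
  then show ?thesis by (rule abs_summable_summable)
qed

lemma holo_on_em_rem: "holo_on {1..Suc q} (em_dom (Suc q) K) (em_rem q K)"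
proof (rule holo_on_localI)
  show "em_dom (Suc q) K \<subseteq> extensional {1..Suc q}" by (auto simp: em_dom_def)
  fix p assume p: "p \<in> em_dom (Suc q) K"
  obtain e M where M: "e > 0" "M summable_on inctup (Suc q)" "polydisc {1..Suc q} p e \<subseteq> em_dom (Suc q) K"
    "\<And>s m. s \<in> polydisc {1..Suc q} p e \<Longrightarrow> m \<in> inctup (Suc q) \<Longrightarrow> norm (em_term q K s m) \<le> M m"
    using em_term_bound[OF p] by metis
  let ?V = "polydisc {1..Suc q} p e"
  have o: "openin (cspace {1..Suc q}) ?V" by (rule openin_polydisc) simp
  have "holo_on {1..Suc q} ?V (\<lambda>s. \<Sum>\<^sub>\<infinity>m\<in>inctup (Suc q). em_term q K s m)"
  proof (rule holo_on_infsum[OF _ o])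
    show "holo_on {1..Suc q} ?V (\<lambda>s. em_term q K s m)" for m
      unfolding em_term_def
    proof (intro holo_on_mult holo_on_prod o)
      show "holo_on {1..Suc q} ?V (\<lambda>s. of_nat (m i) powr - s i)" if "i \<in> {1..q}" for i
        by (rule holo_on_compose_1[where A = UNIV and \<phi> = "\<lambda>z. of_nat (m i) powr - z" and f = "\<lambda>s. s i"])
          (use that o in \<open>auto intro!: holo_on_coord holomorphic_of_nat_powr holomorphic_intros\<close>)
      show "holo_on {1..Suc q} ?V (\<lambda>s. em_err K (s (Suc q)) (m (Suc q)))"
        by (rule holo_on_compose_1[where A = UNIV and \<phi> = "\<lambda>z. em_err K z (m (Suc q))" and f = "\<lambda>s. s (Suc q)"])
          (use o in \<open>auto intro!: holo_on_coord holomorphic_em_err\<close>)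
    qed
  qed (use M in auto)
  moreover have "p \<in> ?V" using p M(1) by (intro polydisc_centre) (auto simp: em_dom_def)
  ultimately show "\<exists>V. p \<in> V \<and> V \<subseteq> em_dom (Suc q) K \<and> holo_on {1..Suc q} V (em_rem q K)"
    using M(3) unfolding em_rem_def[abs_def] by blast
qed simp

text \<open>Telescoping the i-th correction over the last index leaves m_q powr (1 - s_(q+1) - i),
  which is absorbed into the exponent of m_q.\<close>

definition merge_last :: "nat \<Rightarrow> nat \<Rightarrow> (nat \<Rightarrow> complex) \<Rightarrow> nat \<Rightarrow> complex"
  where "merge_last q i s = (\<lambda>x\<in>{1..q}. if x = q then s q + s (Suc q) - 1 + of_nat i else s x)"

lemma zsum_merge:
  assumes "k \<in> {1..q}"
  shows "zsum q k (merge_last q i s) = zsum (Suc q) k s + of_nat i"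
proof -
  have "(\<Sum>x=k..q. merge_last q i s x) = merge_last q i s q + (\<Sum>x\<in>{k..q} - {q}. merge_last q i s x)"
    using assms by (intro sum.remove) auto
  also have "(\<Sum>x\<in>{k..q} - {q}. merge_last q i s x) = (\<Sum>x\<in>{k..q} - {q}. s x)"
    using assms by (intro sum.cong) (auto simp: merge_last_def)
  also have "merge_last q i s q + \<dots> = (s q + (\<Sum>x\<in>{k..q} - {q}. s x)) + s (Suc q) - 1 + of_nat i"
    using assms by (simp add: merge_last_def)
  also have "s q + (\<Sum>x\<in>{k..q} - {q}. s x) = (\<Sum>x=k..q. s x)"
    using assms by (intro sum.remove[symmetric]) auto
  also have "\<dots> + s (Suc q) = (\<Sum>x=k..Suc q. s x)" using assms by simp
  finally show ?thesis using assms by (simp add: zsum_def of_nat_diff)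
qed

lemma merge_in_dom:
  assumes "s \<in> em_dom (Suc q) K"
  shows "merge_last q K s \<in> mzeta_dom q"
  using assms zsum_merge[of _ q K s] by (auto simp: mzeta_dom_eq em_dom_def merge_last_def)

lemma em_rem_0: "em_rem q 0 s = (s (Suc q) - 1) * mzeta_series (Suc q) s"
proof -
  have "em_term q 0 s m = (s (Suc q) - 1) * (\<Prod>i=1..Suc q. of_nat (m i) powr - s i)" for m
    by (simp add: em_term_def em_err_0 mult_ac)
  then show ?thesis
    by (simp only: em_rem_def mzeta_series_eq infsum_cmult_right')
qed

text \<open>Split off one correction by \<open>em_err_Suc\<close> and sum it over the last index
  first: the inner sum telescopes to a power of m_q, which turns the outer sum into a zeta series of
  depth q.\<close>

lemma em_rem_Suc:
  assumes s: "s \<in> em_dom (Suc q) K"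
  shows "em_rem q K s = (1 - s (Suc q) gchoose K) * bern K * (if q = 0 then 0 else mzeta_series q (merge_last q K s))
    + em_rem q (Suc K) s"
proof -
  define c where "c = (1 - s (Suc q) gchoose K) * bern K"
  define z where "z = 1 - s (Suc q) - of_nat K"
  define D where "D l = of_nat (l - 1) powr z - of_nat l powr z" for l
  define P where "P m = (\<Prod>i=1..q. of_nat (m i) powr - s i)" for m :: "nat \<Rightarrow> nat"
  have z: "Re z < 0"
  proof -
    have "Re (zsum (Suc q) (Suc q) s) + real K > 0" using s by (auto simp: em_dom_def)
    then show ?thesis by (simp add: zsum_def z_def)
  qed
  have s': "s \<in> em_dom (Suc q) (Suc K)" using s em_dom_mono[of K "Suc K"] by auto
  have diff: "em_term q K s m = c * (P m * D (m (Suc q))) + em_term q (Suc K) s m" for m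
    unfolding em_term_def P_def[symmetric] em_err_Suc[of K "s (Suc q)" "m (Suc q)"]
    by (simp add: c_def z_def D_def algebra_simps)
  \<comment> \<open>Summability comes for free, as this is the difference of two summable
    families.\<close>
  have summ: "(\<lambda>m. c * (P m * D (m (Suc q)))) summable_on inctup (Suc q)"
    using summable_on_add[OF em_term_summable[OF s] summable_on_uminus[THEN iffD2, OF em_term_summable[OF s']]]
    by (simp add: diff)
  have "(\<Sum>\<^sub>\<infinity>m\<in>inctup (Suc q). c * (P m * D (m (Suc q)))) = c * (if q = 0 then 0 else mzeta_series q (merge_last q K s))"
  proof -
    let ?A = "Sigma (inctup q) (gap (Suc q) q)"
    have ins: "P (insert_at (Suc q) q l m) = P m" "insert_at (Suc q) q l m (Suc q) = l" for m l
      unfolding P_def by (auto intro!: prod.cong simp: insert_at_def)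
    have "(\<lambda>ml. (\<lambda>m. c * (P m * D (m (Suc q)))) ((\<lambda>(m, l). insert_at (Suc q) q l m) ml)) summable_on ?A"
      by (subst summable_on_reindex_bij_betw[OF bij_betw_insert_at]) (use summ in auto)
    then have summA: "(\<lambda>(m, l). c * (P m * D l)) summable_on ?A"
      by (simp add: case_prod_unfold ins)
    have "(\<Sum>\<^sub>\<infinity>m\<in>inctup (Suc q). c * (P m * D (m (Suc q)))) =
        (\<Sum>\<^sub>\<infinity>ml\<in>?A. (\<lambda>m. c * (P m * D (m (Suc q)))) ((\<lambda>(m, l). insert_at (Suc q) q l m) ml))"
      by (rule infsum_reindex_bij_betw[symmetric, OF bij_betw_insert_at]) auto
    also have "\<dots> = (\<Sum>\<^sub>\<infinity>(m, l)\<in>?A. c * (P m * D l))" by (simp add: case_prod_unfold ins)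
    also have "\<dots> = (\<Sum>\<^sub>\<infinity>m\<in>inctup q. \<Sum>\<^sub>\<infinity>l\<in>gap (Suc q) q m. c * (P m * D l))"
      by (rule infsum_Sigma'_banach[symmetric, OF summA])
    also have "\<dots> = (\<Sum>\<^sub>\<infinity>m\<in>inctup q. c * (P m * of_nat (pred_entry (Suc q) m) powr z))"
    proof (rule infsum_cong)
      fix m
      have "(\<Sum>\<^sub>\<infinity>l\<in>gap (Suc q) q m. D l) = of_nat (pred_entry (Suc q) m) powr z"
        unfolding gap_last D_def using has_sum_telescope_powr[OF z] by (rule infsumI)
      then show "(\<Sum>\<^sub>\<infinity>l\<in>gap (Suc q) q m. c * (P m * D l)) = c * (P m * of_nat (pred_entry (Suc q) m) powr z)"
        by (simp add: infsum_cmult_right')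
    qed
    also have "\<dots> = c * (\<Sum>\<^sub>\<infinity>m\<in>inctup q. P m * of_nat (pred_entry (Suc q) m) powr z)"
      by (rule infsum_cmult_right')
    also have "(\<Sum>\<^sub>\<infinity>m\<in>inctup q. P m * of_nat (pred_entry (Suc q) m) powr z) =
        (if q = 0 then 0 else mzeta_series q (merge_last q K s))"
    \<comment> \<open>In depth one the telescoped value is \<open>0 powr z = 0\<close>, so no
      correction remains.\<close>
    proof (cases "q = 0")
      case True
      then show ?thesis by (simp add: pred_entry_def)
    next
      case False
      have "P m * of_nat (m q) powr z = (\<Prod>i=1..q. of_nat (m i) powr - merge_last q K s i)" for m
      proof -
        have 1: "(\<Prod>i=1..q. of_nat (m i) powr - t i) = of_nat (m q) powr - t q * (\<Prod>i\<in>{1..q} - {q}. of_nat (m i) powr - t i)" for t :: "nat \<Rightarrow> complex"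
          using False by (intro prod.remove) auto
        have 2: "of_nat (m q) powr - merge_last q K s q = of_nat (m q) powr - s q * of_nat (m q) powr z"
          using False by (simp add: merge_last_def powr_add[symmetric] z_def algebra_simps)
        have 3: "(\<Prod>i\<in>{1..q} - {q}. of_nat (m i) powr - merge_last q K s i) = (\<Prod>i\<in>{1..q} - {q}. of_nat (m i) powr - s i)"
          by (rule prod.cong) (auto simp: merge_last_def)
        show ?thesis using 1[of s] 1[of "merge_last q K s"] unfolding P_def 2 3 by (simp add: mult_ac)
      qed
      then show ?thesis using False by (simp add: pred_entry_def mzeta_series_eq)
    qed
    finally show ?thesis .
  qed
  moreover have "em_rem q K s = (\<Sum>\<^sub>\<infinity>m\<in>inctup (Suc q). c * (P m * D (m (Suc q)))) + em_rem q (Suc K) s"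
    unfolding em_rem_def diff by (rule infsum_add[OF summ em_term_summable[OF s']])
  ultimately show ?thesis by (simp add: c_def)
qed

text \<open>\<open>rGamma\<close> is entire with zeros exactly at the nonpositive integers, so a
  single factor clears all poles belonging to one k.\<close>

definition hprod :: "nat \<Rightarrow> (nat \<Rightarrow> complex) \<Rightarrow> complex"
  where "hprod r s = (\<Prod>k=1..<r. rGamma (zsum r k s))"

text \<open>The polar divisor of \<open>\<zeta>\<^sub>r\<close> is contained in the zero set of the following entire function.\<close>

definition mzeta_den :: "nat \<Rightarrow> (nat \<Rightarrow> complex) \<Rightarrow> complex"
  where "mzeta_den r s = (if r = 0 then 1 else (s r - 1) * hprod r s)"

text \<open>The quotient of \<open>hprod (Suc q)\<close> by the shifted denominator of depth q, in a
  form that is visibly entire: \<open>rGamma z\<close> equals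
  \<open>pochhammer z i * rGamma (z + of_nat i)\<close>. For k = q one more step is used, whose
  factor z + i is the linear factor of \<open>mzeta_den q\<close>.\<close>

definition hquot :: "nat \<Rightarrow> nat \<Rightarrow> (nat \<Rightarrow> complex) \<Rightarrow> complex"
  where "hquot q i s = (\<Prod>k=1..q. pochhammer (zsum (Suc q) k s) i) * rGamma (zsum (Suc q) q s + of_nat (Suc i))"

lemma hquot: 
  assumes "q \<ge> 1"
  shows "hprod (Suc q) s = hquot q i s * mzeta_den q (merge_last q i s)"
proof -
  have set: "{1..<Suc q} = insert q {1..<q}" "{1..q} = insert q {1..<q}" using assms by auto
  have z: "merge_last q i s q - 1 = zsum (Suc q) q s + of_nat i"
    using zsum_merge[of q q i s] assms by (simp add: zsum_def)
  have "(\<Prod>k=1..<q. rGamma (zsum q k (merge_last q i s))) = (\<Prod>k=1..<q. rGamma (zsum (Suc q) k s + of_nat i))"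
    by (rule prod.cong) (auto simp: zsum_merge)
  then have den: "mzeta_den q (merge_last q i s) =
      (zsum (Suc q) q s + of_nat i) * (\<Prod>k=1..<q. rGamma (zsum (Suc q) k s + of_nat i))"
    using assms by (simp add: mzeta_den_def hprod_def z)
  have "hprod (Suc q) s = rGamma (zsum (Suc q) q s) * (\<Prod>k=1..<q. rGamma (zsum (Suc q) k s))"
    unfolding hprod_def set by simp
  also have "(\<Prod>k=1..<q. rGamma (zsum (Suc q) k s)) =
      (\<Prod>k=1..<q. pochhammer (zsum (Suc q) k s) i) * (\<Prod>k=1..<q. rGamma (zsum (Suc q) k s + of_nat i))"
    unfolding prod.distrib[symmetric] by (rule prod.cong[OF refl pochhammer_rGamma])
  also have "rGamma (zsum (Suc q) q s) = pochhammer (zsum (Suc q) q s) i * (zsum (Suc q) q s + of_nat i) *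
      rGamma (zsum (Suc q) q s + of_nat (Suc i))"
    using pochhammer_rGamma[of "zsum (Suc q) q s" "Suc i"] by (simp only: pochhammer_Suc)
  finally show ?thesis unfolding den hquot_def set by (simp add: mult_ac)
qed

text \<open>The K-term expansion of (s_r - 1) * zeta_r for r = Suc q, multiplied by
  \<open>hprod\<close>; \<open>hquot\<close> has absorbed the denominators, and g stands for the
  numerator of depth q.\<close>

definition em_sum :: "nat \<Rightarrow> ((nat \<Rightarrow> complex) \<Rightarrow> complex) \<Rightarrow> nat \<Rightarrow> (nat \<Rightarrow> complex) \<Rightarrow> complex"
  where "em_sum q g K s =
    (if q = 0 then 0 else \<Sum>i<K. (1 - s (Suc q) gchoose i) * bern i * (hquot q i s * g (merge_last q i s)))
    + hprod (Suc q) s * em_rem q K s"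

text \<open>Any admissible K would do, by \<open>em_sum_mono\<close>; the least one merely makes the
  numerator a function of s.\<close>

definition em_order :: "nat \<Rightarrow> (nat \<Rightarrow> complex) \<Rightarrow> nat"
  where "em_order q s = (LEAST K. s \<in> em_dom (Suc q) K)"

primrec mzeta_num :: "nat \<Rightarrow> (nat \<Rightarrow> complex) \<Rightarrow> complex" where
  "mzeta_num 0 = (\<lambda>_. 1)"
| "mzeta_num (Suc q) = (\<lambda>s. em_sum q (mzeta_num q) (em_order q s) s)"

lemma em_dom_exhaust:
  assumes "s \<in> extensional {1..r}"
  obtains K where "s \<in> em_dom r K"
proof -
  obtain K where K: "real K > (\<Sum>k=1..r. \<bar>Re (zsum r k s)\<bar>)" using reals_Archimedean2 by blast
  have "Re (zsum r k s) + real K > 0" if k: "k \<in> {1..r}" for k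
  proof -
    have "\<bar>Re (zsum r k s)\<bar> \<le> (\<Sum>k=1..r. \<bar>Re (zsum r k s)\<bar>)"
      by (rule member_le_sum) (use k in auto)
    then show ?thesis using K by linarith
  qed
  then show ?thesis using assms that[of K] by (auto simp: em_dom_def)
qed

text \<open>Raising K by one moves a term from the remainder into the sum. The merged tuple then
  lies in the domain of convergence, where g is the denominator times the series.\<close>

lemma em_sum_mono:
  assumes g: "\<And>t. t \<in> mzeta_dom q \<Longrightarrow> g t = mzeta_den q t * mzeta_series q t"
    and s: "s \<in> em_dom (Suc q) K" and L: "K \<le> L"
  shows "em_sum q g L s = em_sum q g K s"
  using L
proof (induction L rule: dec_induct)
  case (step L)
  then have sL: "s \<in> em_dom (Suc q) L" using s em_dom_mono by blast
  have "em_sum q g (Suc L) s = em_sum q g L s"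
  proof (cases "q = 0")
    case True
    then show ?thesis using em_rem_Suc[OF sL] by (simp add: em_sum_def)
  next
    case False
    have "hprod (Suc q) s * em_rem q L s = (1 - s (Suc q) gchoose L) * bern L *
      (hquot q L s * g (merge_last q L s)) + hprod (Suc q) s * em_rem q (Suc L) s"
      using False unfolding em_rem_Suc[OF sL] g[OF merge_in_dom[OF sL]]
      by (simp add: distrib_left hquot[of q s L])
    then show ?thesis using False by (simp add: em_sum_def)
  qed
  with step show ?case by simp
qed simp

lemma mzeta_num_em_sum:
  assumes g: "\<And>t. t \<in> mzeta_dom q \<Longrightarrow> mzeta_num q t = mzeta_den q t * mzeta_series q t"
    and s: "s \<in> em_dom (Suc q) K"
  shows "mzeta_num (Suc q) s = em_sum q (mzeta_num q) K s"
proof -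
  have "s \<in> em_dom (Suc q) (em_order q s)" "em_order q s \<le> K"
    unfolding em_order_def using s by (auto intro: LeastI Least_le)
  from em_sum_mono[OF g this] show ?thesis by simp
qed

lemma entire_zsum: "k \<ge> 1 \<Longrightarrow> entire {1..r} (zsum r k)"
  unfolding zsum_def[abs_def] by (intro entire_diff entire_sum entire_const entire_coord) auto

lemma holomorphic_pochhammer: "(\<lambda>z :: complex. pochhammer z i) holomorphic_on A"
  unfolding pochhammer_prod by (intro holomorphic_intros)

lemma entire_hprod: "entire {1..r} (hprod r)"
  unfolding hprod_def[abs_def]
  by (intro entire_prod entire_compose_1[where \<phi> = rGamma] entire_zsum holomorphic_rGamma) auto

lemma entire_mzeta_den: "entire {1..r} (mzeta_den r)"
  unfolding mzeta_den_def[abs_def]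
  by (cases "r = 0") (simp_all add: entire_const entire_mult entire_hprod entire_diff entire_coord del: One_nat_def)

lemma entire_hquot: "q \<ge> 1 \<Longrightarrow> entire {1..Suc q} (hquot q i)"
  unfolding hquot_def[abs_def]
proof (rule entire_mult)
  show "entire {1..Suc q} (\<lambda>s. \<Prod>k = 1..q. pochhammer (zsum (Suc q) k s) i)"
    by (rule entire_prod, rule entire_compose_1[where \<phi> = "\<lambda>z. pochhammer z i", OF entire_zsum holomorphic_pochhammer])
      simp
  show "entire {1..Suc q} (\<lambda>s. rGamma (zsum (Suc q) q s + of_nat (Suc i)))" if "q \<ge> 1"
    by (rule entire_compose_1[where \<phi> = rGamma, OF entire_add[OF entire_zsum[OF that] entire_const] holomorphic_rGamma])
qed

lemma entire_compose_merge:
  assumes g: "entire {1..q} g" and q: "q \<ge> 1"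
  shows "entire {1..Suc q} (\<lambda>s. g (merge_last q i s))"
  unfolding entire_def
proof (rule holo_on_compose[OF g[unfolded entire_def] _ openin_topspace])
  show "holo_on {1..Suc q} (topspace (cspace {1..Suc q})) (\<lambda>s. merge_last q i s j)" if "j \<in> {1..q}" for j
    using that unfolding entire_def[symmetric] merge_last_def
    by (cases "j = q") (auto intro!: entire_add entire_diff entire_const entire_coord)
  show "\<exists>j\<in>{1..q}. \<forall>z k. k \<noteq> j \<longrightarrow> merge_last q i (s(x := z)) k = merge_last q i s k"
    if "x \<in> {1..Suc q}" for x s
    \<comment> \<open>The variables q and Suc q both affect only coordinate q of the merged
      tuple.\<close>
    using that q by (intro bexI[of _ "min x q"]) (auto simp: merge_last_def)
qed (auto simp: merge_last_def)

lemma openin_em_dom: "openin (cspace {1..Suc q}) (em_dom (Suc q) K)"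
  using holo_onD(1)[OF holo_on_em_rem] .

lemma holo_on_em_sum:
  assumes g: "entire {1..q} g"
  shows "holo_on {1..Suc q} (em_dom (Suc q) K) (em_sum q g K)"
proof -
  note o = openin_em_dom[of q K]
  have "holo_on {1..Suc q} (em_dom (Suc q) K) (\<lambda>s. hprod (Suc q) s * em_rem q K s)"
    by (intro holo_on_mult holo_on_em_rem entire_holo_on[OF entire_hprod o])
  moreover have "entire {1..Suc q} (\<lambda>s. \<Sum>i<K. (1 - s (Suc q) gchoose i) * bern i * (hquot q i s * g (merge_last q i s)))"
    if q: "q \<ge> 1"
  proof (intro entire_sum entire_mult entire_const entire_hquot entire_compose_merge g q)
    show "entire {1..Suc q} (\<lambda>s. 1 - s (Suc q) gchoose i)" for i
      by (rule entire_compose_1[where \<phi> = "\<lambda>z. 1 - z gchoose i" and f = "\<lambda>s. s (Suc q)"])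
        (auto intro!: entire_coord holomorphic_intros)
  qed
  ultimately show ?thesis
    unfolding em_sum_def[abs_def] using entire_holo_on[OF _ o]
    by (cases "q = 0") (simp_all add: holo_on_add)
qed

text \<open>Both claims go through the induction together: entirety at depth q makes
  \<open>em_sum\<close> holomorphic, and the series identity makes it independent of K, so that near
  each point the numerator is \<open>em_sum\<close> with one fixed K.\<close>

lemma mzeta_num:
  shows "entire {1..r} (mzeta_num r)"
    and "t \<in> mzeta_dom r \<Longrightarrow> mzeta_num r t = mzeta_den r t * mzeta_series r t"
proof -
  have "entire {1..r} (mzeta_num r) \<and> (\<forall>t\<in>mzeta_dom r. mzeta_num r t = mzeta_den r t * mzeta_series r t)"
  proof (induction r)
    case 0
    have "mzeta_series 0 t = 1" for t by (simp add: mzeta_series_eq inctup_0)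
    then show ?case by (simp add: entire_const mzeta_den_def)
  next
    case (Suc q)
    then have eq: "mzeta_num (Suc q) s = em_sum q (mzeta_num q) K s" if "s \<in> em_dom (Suc q) K" for s K
      using mzeta_num_em_sum[OF _ that] by blast
    have "holo_on {1..Suc q} (topspace (cspace {1..Suc q})) (mzeta_num (Suc q))"
    proof (rule holo_on_localI)
      fix p assume "p \<in> topspace (cspace {1..Suc q})"
      then have "p \<in> extensional {1..Suc q}" by (auto simp: PiE_def)
      then obtain K where K: "p \<in> em_dom (Suc q) K" by (rule em_dom_exhaust)
      have "holo_on {1..Suc q} (em_dom (Suc q) K) (mzeta_num (Suc q))"
        by (rule holo_on_cong[OF eq[symmetric] _ holo_on_em_sum]) (use Suc in auto)
      then show "\<exists>V. p \<in> V \<and> V \<subseteq> topspace (cspace {1..Suc q}) \<and> holo_on {1..Suc q} V (mzeta_num (Suc q))"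
        using K openin_subset[OF openin_em_dom] by blast
    qed (auto simp: PiE_def)
    moreover have "mzeta_num (Suc q) t = mzeta_den (Suc q) t * mzeta_series (Suc q) t" if "t \<in> mzeta_dom (Suc q)" for t
      \<comment> \<open>For K = 0 only the remainder is left, which is the series times its linear
        factor.\<close>
      using eq[of t 0] that by (simp add: mzeta_dom_eq em_sum_def em_rem_0 mzeta_den_def mult_ac)
    ultimately show ?case unfolding entire_def by blast
  qed
  then show "entire {1..r} (mzeta_num r)"
    and "t \<in> mzeta_dom r \<Longrightarrow> mzeta_num r t = mzeta_den r t * mzeta_series r t" by auto
qed

section \<open>Values of the continuation off the zero set of its denominator\<close>

lemma mzeta_den_nonzero:
  assumes "r \<ge> 1 \<Longrightarrow> s r \<noteq> 1" "\<And>k. 1 \<le> k \<Longrightarrow> k < r \<Longrightarrow> zsum r k s \<notin> \<int>\<^sub>\<le>\<^sub>0"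
  shows "mzeta_den r s \<noteq> 0"
  using assms by (auto simp: mzeta_den_def hprod_def rGamma_eq_zero_iff)

lemma mzeta_den_nonzero_dom:
  assumes "s \<in> mzeta_dom r"
  shows "mzeta_den r s \<noteq> 0"
proof (rule mzeta_den_nonzero)
  have pos: "Re (zsum r k s) > 0" if "1 \<le> k" "k \<le> r" for k
    using assms that by (auto simp: mzeta_dom_eq em_dom_def)
  show "s r \<noteq> 1" if "r \<ge> 1"
    using pos[of r] that by (auto simp: zsum_def)
  show "zsum r k s \<notin> \<int>\<^sub>\<le>\<^sub>0" if "1 \<le> k" "k < r" for k
    using pos[of k] that by (auto elim!: nonpos_Ints_cases)
qed

lemma mzeta_dom_real:
  assumes "\<And>i. i \<in> {1..r} \<Longrightarrow> Re (s i) > 1" "s \<in> extensional {1..r}"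
  shows "s \<in> mzeta_dom r"
proof -
  have "Re (\<Sum>i=k..r. s i) > real (r + 1 - k)" if k: "k \<in> {1..r}" for k
  proof -
    have "(\<Sum>i=k..r. 1) < (\<Sum>i=k..r. Re (s i))"
      by (rule sum_strict_mono) (use assms k in auto)
    then show ?thesis by simp
  qed
  then show ?thesis using assms(2) by (auto simp: mzeta_dom_def PiE_def)
qed

lemma openin_mzeta_dom: "openin (cspace {1..r}) (mzeta_dom r)"
proof (cases r)
  case 0
  then have "mzeta_dom r = topspace (cspace {1..r})" by (auto simp: mzeta_dom_def)
  then show ?thesis by (metis openin_topspace)
next
  case (Suc q)
  then show ?thesis using openin_em_dom[of q 0] by (simp add: mzeta_dom_eq)
qed

lemma mzeta_dom_nonempty: "mzeta_dom r \<noteq> {}"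
  using mzeta_dom_real[of r "\<lambda>i\<in>{1..r}. 2"] by auto

text \<open>The explicit quotient has a canonical representative, so the choice in
  \<open>mzeta_cont\<close> succeeds; \<open>nicely_mero_eq_quot\<close> then forces whatever was
  chosen to equal the quotient.\<close>

lemma
  shows mzeta_cont_dom: "s \<in> mzeta_dom r \<Longrightarrow> mzeta_cont r s = mzeta_series r s"
    and mzeta_cont_eq: "s \<in> extensional {1..r} \<Longrightarrow> mzeta_den r s \<noteq> 0 \<Longrightarrow>
      mzeta_cont r s = mzeta_num r s / mzeta_den r s"
proof -
  let ?I = "{1..r}" and ?f = "\<lambda>s. mzeta_num r s / mzeta_den r s"
  have ext: "s \<in> extensional ?I" if "s \<in> mzeta_dom r" for s
    using that by (auto simp: mzeta_dom_def PiE_def)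
  have q: "quot_of ?I ?f (mzeta_num r) (mzeta_den r)"
    unfolding quot_of_def
    using mzeta_num(1) entire_mzeta_den mzeta_dom_nonempty mzeta_den_nonzero_dom ext by blast
  have f: "?f s = mzeta_series r s" if "s \<in> mzeta_dom r" for s
    using mzeta_num(2)[OF that] mzeta_den_nonzero_dom[OF that] by simp
  obtain F where "nicely_mero ?I F" "\<And>s. s \<in> extensional ?I \<Longrightarrow> mzeta_den r s \<noteq> 0 \<Longrightarrow> F s = ?f s"
    using nicely_mero_exists[OF _ q] by auto
  then have "\<exists>F. nicely_mero ?I F \<and> (\<forall>s\<in>mzeta_dom r. F s = mzeta_series r s)"
    using f ext mzeta_den_nonzero_dom by (intro exI[of _ F]) auto
  from someI_ex[OF this]
  have *: "nicely_mero ?I (mzeta_cont r)" "\<And>s. s \<in> mzeta_dom r \<Longrightarrow> mzeta_cont r s = mzeta_series r s"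
    unfolding mzeta_cont_def by auto
  show "s \<in> mzeta_dom r \<Longrightarrow> mzeta_cont r s = mzeta_series r s" by (rule *)
  show "mzeta_cont r s = ?f s" if "s \<in> extensional ?I" "mzeta_den r s \<noteq> 0"
    by (rule nicely_mero_eq_quot[OF _ *(1) q openin_mzeta_dom mzeta_dom_nonempty _ that])
      (use *(2) f in auto)
qed


section \<open>Specialisation to a hyperplane\<close>

text \<open>For q \<ge> 1 the last entry of an increasing tuple is at least 2, where the error
  vanishes.\<close>

lemma em_rem_neg_nat:
  assumes "q \<ge> 1" "s (Suc q) = - of_nat n" "K \<ge> Suc n"
  shows "em_rem q K s = 0"
proof -
  have "em_term q K s m = 0" if m: "m \<in> inctup (Suc q)" for m
  proof -
    have "m 1 \<ge> 1" "m 1 < m (Suc q)" using inctupD(2,3)[OF m] assms(1) by auto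
    then show ?thesis using assms em_err_neg_nat[of n K "m (Suc q)"] by (simp add: em_term_def)
  qed
  then show ?thesis unfolding em_rem_def by (simp add: infsum_0)
qed

text \<open>In depth one the tuple with entry 1 is the only one that contributes to the remainder,
  and it contributes B_(n+1); the denominator is s - 1 = -(n + 1).\<close>

lemma zeta_neg_nat: "zeta (- of_nat n) = - bern (Suc n) / of_nat (Suc n)"
proof -
  define s :: "nat \<Rightarrow> complex" where "s = (\<lambda>i\<in>{1..1}. [- of_nat n] ! (i - 1))"
  have s1: "s 1 = - of_nat n" by (simp add: s_def)
  \<comment> \<open>Large enough for \<open>em_main\<close> to contain the whole binomial sum up to
    i = n + 1, and for s to lie in \<open>em_dom\<close>.\<close>
  define K where "K = n + 2"
  define m1 :: "nat \<Rightarrow> nat" where "m1 = (\<lambda>i\<in>{1..1}. 1)"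
  have m1: "m1 \<in> inctup 1" unfolding m1_def by (rule inctupI) auto
  have zero: "em_term 0 K s m = 0" if m: "m \<in> inctup 1 - {m1}" for m
  proof -
    have "m \<noteq> m1" "m \<in> extensional {1..1}" "m 1 \<ge> 1" using m inctupD(1,2)[of m 1] by auto
    then have "m 1 \<noteq> 1"
      unfolding m1_def by (metis atLeastAtMost_singleton extensionalityI restrict_apply restrict_extensional singletonD)
    then show ?thesis using \<open>m 1 \<ge> 1\<close> em_err_neg_nat[of n K "m 1"] s1 by (simp add: em_term_def K_def)
  qed
  have "em_rem 0 K s = (\<Sum>\<^sub>\<infinity>m\<in>{m1}. em_term 0 K s m)"
    unfolding em_rem_def using m1 zero by (intro infsum_cong_neutral) auto
  also have "\<dots> = bern (Suc n)"
    using em_err_neg_nat_1[of n K] s1 by (simp add: em_term_def m1_def K_def)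
  finally have rem: "em_rem 0 K s = bern (Suc n)" .
  have den: "mzeta_den 1 s = - of_nat (Suc n)"
    using s1 by (simp add: mzeta_den_def hprod_def)
  have ext: "s \<in> extensional {1..1}" by (simp add: s_def)
  have dom: "s \<in> em_dom (Suc 0) K"
    using ext s1 by (auto simp: em_dom_def zsum_def K_def)
  have "zeta (- of_nat n) = mzeta_cont 1 s" by (simp add: mzeta_def s_def)
  also have "\<dots> = mzeta_num 1 s / mzeta_den 1 s"
    by (rule mzeta_cont_eq[OF ext], unfold den) (simp del: of_nat_Suc)
  also have "mzeta_num 1 s = em_sum 0 (mzeta_num 0) K s"
    unfolding One_nat_def by (rule mzeta_num_em_sum[OF _ dom], erule mzeta_num(2))
  also have "\<dots> = bern (Suc n)" using rem by (simp add: em_sum_def hprod_def)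
  finally show ?thesis unfolding den by (simp only: divide_minus_right minus_divide_left)
qed

section \<open>Argument tuples of the identity and their meromorphy\<close>

definition fix_arg :: "nat \<Rightarrow> nat \<Rightarrow> complex \<Rightarrow> (nat \<Rightarrow> complex) \<Rightarrow> nat \<Rightarrow> complex"
  where "fix_arg r j c s = (\<lambda>i\<in>{1..r}. if i = j then c else s i)"

definition drop_arg :: "nat \<Rightarrow> (nat \<Rightarrow> complex) \<Rightarrow> nat \<Rightarrow> complex"
  where "drop_arg j s i = s (if i < j then i else Suc i)"

text \<open>Every tuple of depth r - 1 in the identity has this form, with c = -p for some 0 \<le> p
  \<le> n + 1 and a one of the two neighbours of the removed position.\<close>

definition shift_arg :: "nat \<Rightarrow> nat \<Rightarrow> nat \<Rightarrow> complex \<Rightarrow> (nat \<Rightarrow> complex) \<Rightarrow> nat \<Rightarrow> complex"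
  where "shift_arg q j a c s = (\<lambda>i\<in>{1..q}. drop_arg j s i + (if i = a then c else 0))"

lemma mzeta_fix_arg:
  assumes "j \<in> {1..r}"
  shows "mzeta (seg s 1 (j - 1) @ [c] @ seg s (j + 1) r) = mzeta_cont r (fix_arg r j c s)"
proof -
  have len: "length (seg s 1 (j - 1) @ [c] @ seg s (j + 1) r) = r" using assms by auto
  have "(seg s 1 (j - 1) @ [c] @ seg s (j + 1) r) ! (i - 1) = (if i = j then c else s i)" if "i \<in> {1..r}" for i
    using that assms by (auto simp: nth_append nth_Cons' simp del: upt_Suc)
  then show ?thesis unfolding mzeta_def len fix_arg_def
    by (intro arg_cong[where f = "mzeta_cont r"] restrict_ext)
qed

lemma mzeta_shift_arg_pred:
  assumes "j \<in> {2..Suc q}" "x = s (j - 1) + c"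
  shows "mzeta (seg s 1 (j - 2) @ [x] @ seg s (j + 1) (Suc q)) = mzeta_cont q (shift_arg q j (j - 1) c s)"
proof -
  have len: "length (seg s 1 (j - 2) @ [x] @ seg s (j + 1) (Suc q)) = q" using assms by auto
  have "(seg s 1 (j - 2) @ [x] @ seg s (j + 1) (Suc q)) ! (i - 1) = drop_arg j s i + (if i = j - 1 then c else 0)"
    if i: "i \<in> {1..q}" for i
  proof -
    consider "i < j - 1" | "i = j - 1" | "i \<ge> j" by linarith
    then show ?thesis
      using i assms by cases (auto simp: nth_append nth_Cons' drop_arg_def simp del: upt_Suc)
  qed
  then show ?thesis unfolding mzeta_def len shift_arg_def
    by (intro arg_cong[where f = "mzeta_cont q"] restrict_ext)
qed

lemma mzeta_shift_arg_succ:
  assumes "j \<in> {1..q}" "x = s (j + 1) + c"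
  shows "mzeta (seg s 1 (j - 1) @ [x] @ seg s (j + 2) (Suc q)) = mzeta_cont q (shift_arg q j j c s)"
proof -
  have len: "length (seg s 1 (j - 1) @ [x] @ seg s (j + 2) (Suc q)) = q" using assms by auto
  have "(seg s 1 (j - 1) @ [x] @ seg s (j + 2) (Suc q)) ! (i - 1) = drop_arg j s i + (if i = j then c else 0)"
    if i: "i \<in> {1..q}" for i
  proof -
    consider "i < j" | "i = j" | "i > j" by linarith
    then show ?thesis
      using i assms by cases (auto simp: nth_append nth_Cons' drop_arg_def simp del: upt_Suc)
  qed
  then show ?thesis unfolding mzeta_def len shift_arg_def
    by (intro arg_cong[where f = "mzeta_cont q"] restrict_ext)
qed

lemma mzeta_drop_first:
  "mzeta (seg s 2 (Suc q)) = mzeta_cont q (shift_arg q 1 a 0 s)"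
proof -
  have len: "length (seg s 2 (Suc q)) = q" by auto
  have "seg s 2 (Suc q) ! (i - 1) = drop_arg 1 s i + (if i = a then 0 else 0)" if "i \<in> {1..q}" for i
    using that by (auto simp: drop_arg_def simp del: upt_Suc)
  then show ?thesis unfolding mzeta_def len shift_arg_def
    by (intro arg_cong[where f = "mzeta_cont q"] restrict_ext)
qed

text \<open>A substitution yields a quotient again provided the denominator does not become
  identically 0; the point p certifies this.\<close>

lemma quot_mzeta_cont:
  assumes L: "\<And>s. s \<in> extensional I \<Longrightarrow> L s \<in> extensional {1..r}"
    and coord: "\<And>k. k \<in> {1..r} \<Longrightarrow> entire I (\<lambda>s. L s k)"
    and sep: "\<And>i s. i \<in> I \<Longrightarrow> \<exists>k\<in>{1..r}. \<forall>z. \<forall>l. l \<noteq> k \<longrightarrow> L (s(i := z)) l = L s l"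
    and p: "p \<in> extensional I" "mzeta_den r (L p) \<noteq> 0"
  shows "quot I (\<lambda>s. mzeta_cont r (L s))"
proof -
  have comp: "entire I (\<lambda>s. g (L s))" if "entire {1..r} g" for g
    unfolding entire_def
    by (rule holo_on_compose[OF that[unfolded entire_def] _ openin_topspace])
      (use L coord sep in \<open>auto simp: entire_def PiE_def\<close>)
  have "quot_of I (\<lambda>s. mzeta_cont r (L s)) (\<lambda>s. mzeta_num r (L s)) (\<lambda>s. mzeta_den r (L s))"
    unfolding quot_of_def
    using comp[OF mzeta_num(1)] comp[OF entire_mzeta_den] p L mzeta_cont_eq by blast
  then show ?thesis unfolding quot_def by blast
qed

text \<open>A nonreal tail sum is never an integer, so tuples with entries \<i> avoid the zeros of
  the denominator.\<close>

lemma mzeta_den_nonzero_Im: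
  assumes "\<And>k. 1 \<le> k \<Longrightarrow> k < r \<Longrightarrow> Im (\<Sum>i=k..r. s i) \<noteq> 0" "r \<ge> 1 \<Longrightarrow> s r \<noteq> 1"
  shows "mzeta_den r s \<noteq> 0"
proof (rule mzeta_den_nonzero)
  show "zsum r k s \<notin> \<int>\<^sub>\<le>\<^sub>0" if "1 \<le> k" "k < r" for k
    using assms(1)[OF that] by (auto simp: zsum_def elim!: nonpos_Ints_cases dest!: arg_cong[of _ _ Im])
qed (use assms in auto)

lemma quot_fix_arg:
  assumes j: "j \<in> {1..r}" and r: "r \<ge> 2"
  shows "quot ({1..r} - {j}) (\<lambda>s. mzeta_cont r (fix_arg r j (- of_nat n) s))"
proof (rule quot_mzeta_cont)
  let ?I = "{1..r} - {j}" and ?p = "\<lambda>i\<in>{1..r} - {j}. \<i>"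
  show "entire ?I (\<lambda>s. fix_arg r j (- of_nat n) s k)" if "k \<in> {1..r}" for k
    using that unfolding fix_arg_def by (cases "k = j") (auto intro: entire_const entire_coord)
  show "\<exists>k\<in>{1..r}. \<forall>z l. l \<noteq> k \<longrightarrow>
      fix_arg r j (- of_nat n) (s(i := z)) l = fix_arg r j (- of_nat n) s l" if "i \<in> ?I" for i s
    using that by (intro bexI[of _ i]) (auto simp: fix_arg_def)
  show "?p \<in> extensional ?I" by simp
  show "mzeta_den r (fix_arg r j (- of_nat n) ?p) \<noteq> 0"
  proof (rule mzeta_den_nonzero_Im)
    fix k assume k: "1 \<le> k" "k < r"
    have "Im (\<Sum>i=k..r. fix_arg r j (- of_nat n) ?p i) = (\<Sum>i=k..r. if i = j then 0 else 1)"
      unfolding Im_sum using k by (intro sum.cong) (auto simp: fix_arg_def)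
    also have "\<dots> > 0"
    \<comment> \<open>As k < r, the tail contains an index different from j; this witness names
      one.\<close>
    proof (rule sum_pos2[of _ "if j = r then k else r"])
    qed (use k in auto)
    finally show "Im (\<Sum>i=k..r. fix_arg r j (- of_nat n) ?p i) \<noteq> 0" by simp
  next
    show "fix_arg r j (- of_nat n) ?p r \<noteq> 1" if "r \<ge> 1"
      using that by (auto simp: fix_arg_def complex_eq_iff)
  qed
qed (auto simp: fix_arg_def)

lemma quot_shift_arg:
  assumes j: "j \<in> {1..Suc q}" and q: "q \<ge> 1" and c: "Im c = 0"
  shows "quot ({1..Suc q} - {j}) (\<lambda>s. mzeta_cont q (shift_arg q j a c s))"
proof (rule quot_mzeta_cont)
  let ?I = "{1..Suc q} - {j}" and ?p = "\<lambda>i\<in>{1..Suc q} - {j}. \<i>"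
  show "entire ?I (\<lambda>s. shift_arg q j a c s k)" if "k \<in> {1..q}" for k
    using that unfolding shift_arg_def drop_arg_def
    by (cases "k < j") (auto intro!: entire_add entire_const entire_coord)
  show "\<exists>k\<in>{1..q}. \<forall>z l. l \<noteq> k \<longrightarrow> shift_arg q j a c (s(i := z)) l = shift_arg q j a c s l"
    if "i \<in> ?I" for i s
    using that j by (intro bexI[of _ "if i < j then i else i - 1"]) (auto simp: shift_arg_def drop_arg_def)
  show "?p \<in> extensional ?I" by simp
  have Im1: "Im (shift_arg q j a c ?p i) = 1" if "i \<in> {1..q}" for i
    using that c by (auto simp: shift_arg_def drop_arg_def)
  show "mzeta_den q (shift_arg q j a c ?p) \<noteq> 0"
  proof (rule mzeta_den_nonzero_Im)
    fix k assume k: "1 \<le> k" "k < q"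
    have "Im (\<Sum>i=k..q. shift_arg q j a c ?p i) = (\<Sum>i=k..q. 1)"
      unfolding Im_sum by (rule sum.cong[OF refl Im1]) (use k in auto)
    then show "Im (\<Sum>i=k..q. shift_arg q j a c ?p i) \<noteq> 0" using k by simp
  next
    show "shift_arg q j a c ?p q \<noteq> 1" if "q \<ge> 1"
      using that Im1[of q] by auto
  qed
qed (auto simp: shift_arg_def)

text \<open>With the bound n + 2 an entry can be lowered by n + 1 and still have real part above
  1.\<close>

definition arg_dom :: "nat \<Rightarrow> nat \<Rightarrow> nat \<Rightarrow> (nat \<Rightarrow> complex) set"
  where "arg_dom r j n = (\<Pi>\<^sub>E i\<in>{1..r} - {j}. {z. Re z > real (n + 2)})"

lemma openin_arg_dom: "openin (cspace ({1..r} - {j})) (arg_dom r j n)"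
  unfolding arg_dom_def by (rule openin_cspace_PiE) (auto simp: open_halfspace_Re_gt)

lemma arg_dom_nonempty: "arg_dom r j n \<noteq> {}"
proof -
  have "(\<lambda>i\<in>{1..r} - {j}. of_nat (n + 3)) \<in> arg_dom r j n" by (simp add: arg_dom_def)
  then show ?thesis by blast
qed

lemma arg_domD: "s \<in> arg_dom r j n \<Longrightarrow> i \<in> {1..r} - {j} \<Longrightarrow> Re (s i) > real (n + 2)"
  by (auto simp: arg_dom_def PiE_def Pi_def)

lemma shift_arg_in_dom:
  assumes j: "j \<in> {1..Suc q}" and s: "s \<in> arg_dom (Suc q) j n" and p: "p \<le> Suc n"
  shows "shift_arg q j a (- of_nat p) s \<in> mzeta_dom q"
proof (rule mzeta_dom_real)
  fix i assume i: "i \<in> {1..q}"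
  then have "Re (drop_arg j s i) > real (n + 2)"
    unfolding drop_arg_def using j by (intro arg_domD[OF s]) auto
  then show "Re (shift_arg q j a (- of_nat p) s i) > 1"
    using i p of_nat_mono[OF p, where ?'a = real] by (auto simp: shift_arg_def)
qed (simp add: shift_arg_def)

text \<open>As j \<le> q, the last entry is free, so every tail contains an entry large enough to
  outweigh -n.\<close>

lemma fix_arg_in_dom:
  assumes j: "j \<in> {1..q}" and s: "s \<in> arg_dom (Suc q) j n"
  shows "fix_arg (Suc q) j (- of_nat n) s \<in> mzeta_dom (Suc q)"
proof -
  have "Re (\<Sum>i=k..Suc q. fix_arg (Suc q) j (- of_nat n) s i) > real (Suc q + 1 - k)" if k: "k \<in> {1..Suc q}" for k
  proof -
    let ?A = "{k..Suc q} - {j}"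
    have gt: "real (card ?A) * real (n + 2) < (\<Sum>i\<in>?A. Re (s i))"
    proof -
      have "Suc q \<in> ?A" using k j by auto
      then have "(\<Sum>i\<in>?A. real (n + 2)) < (\<Sum>i\<in>?A. Re (s i))"
        by (intro sum_strict_mono arg_domD[OF s]) (use k in auto)
      then show ?thesis by simp
    qed
    have eqA: "(\<Sum>i\<in>?A. Re (fix_arg (Suc q) j (- of_nat n) s i)) = (\<Sum>i\<in>?A. Re (s i))"
      using k by (intro sum.cong) (auto simp: fix_arg_def)
    show ?thesis
    proof (cases "k \<le> j")
      case True
      have "(\<Sum>i=k..Suc q. Re (fix_arg (Suc q) j (- of_nat n) s i)) = - real n + (\<Sum>i\<in>?A. Re (s i))"
        unfolding eqA[symmetric] using True j k by (subst sum.remove[of _ j]) (auto simp: fix_arg_def)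
      moreover have "card ?A = Suc q - k" using True j by simp
      \<comment> \<open>With d free entries the claim d * (n + 2) - n \<ge> d + 1 reduces to d * (n
        + 1) \<ge> n + 1.\<close>
      moreover have "real (Suc q - k) * real (n + 1) \<ge> 1 * real (n + 1)"
        using True j by (intro mult_right_mono) auto
      ultimately show ?thesis using gt k True j by (simp add: of_nat_diff algebra_simps)
    next
      case False
      then have A: "?A = {k..Suc q}" by auto
      have "real (Suc q + 1 - k) * 1 \<le> real (Suc q + 1 - k) * real (n + 2)"
        by (intro mult_left_mono) auto
      then have "real (Suc q + 1 - k) < (\<Sum>i=k..Suc q. Re (fix_arg (Suc q) j (- of_nat n) s i))"
        using gt unfolding eqA[unfolded A] A card_atLeastAtMost Suc_eq_plus1[of "Suc q"] by linarith
      then show ?thesis unfolding Re_sum .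
    qed
  qed
  then show ?thesis by (auto simp: mzeta_dom_def fix_arg_def)
qed

section \<open>Summation over the entry at position j\<close>

lemma mzeta_series_summable:
  assumes "s \<in> mzeta_dom r"
  shows "(\<lambda>m. \<Prod>i=1..r. of_nat (m i) powr - s i) summable_on inctup r"
proof -
  have "(\<lambda>m. \<Prod>i=1..r. real (m i) powr - Re (s i)) summable_on inctup r"
    using assms by (intro summable_inctup) (auto simp: mzeta_dom_def)
  then have "(\<lambda>m. norm (\<Prod>i=1..r. of_nat (m i) powr - s i :: complex)) summable_on inctup r"
    by (simp add: norm_prod_powr)
  then show ?thesis by (rule abs_summable_summable)
qed

lemma prod_shift_arg:
  assumes m: "m \<in> inctup q" and a: "a \<in> {1..q}"
  shows "(\<Prod>i=1..q. of_nat (m i) powr - shift_arg q j a (- of_nat p) s i) =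
    (\<Prod>i=1..q. of_nat (m i) powr - drop_arg j s i) * of_nat (m a) ^ p"
proof -
  \<comment> \<open>Positivity matters for p = 0, where \<open>0 powr 0 = 0\<close> but
    \<open>0 ^ 0 = 1\<close>.\<close>
  have ma: "m a \<ge> 1" using inctupD(2)[OF m] a by simp
  have "of_nat (m i) powr - shift_arg q j a (- of_nat p) s i =
      of_nat (m i) powr - drop_arg j s i * (if i = a then of_nat (m a) ^ p else 1)" if "i \<in> {1..q}" for i
  proof (cases "i = a")
    case True
    have "of_nat (m a) powr (- drop_arg j s a + of_nat p) = of_nat (m a) powr - drop_arg j s a * (of_nat (m a) powr of_nat p :: complex)"
      by (rule powr_add)
    also have "(of_nat (m a) powr of_nat p :: complex) = of_nat (m a) ^ p"
      using ma by (subst powr_nat) auto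
    finally show ?thesis using True that by (simp add: shift_arg_def)
  qed (use that in \<open>simp add: shift_arg_def\<close>)
  then have "(\<Prod>i=1..q. of_nat (m i) powr - shift_arg q j a (- of_nat p) s i) =
      (\<Prod>i=1..q. of_nat (m i) powr - drop_arg j s i) * (\<Prod>i=1..q. if i = a then of_nat (m a) ^ p else 1)"
    by (simp add: prod.distrib)
  then show ?thesis using a by (simp add: prod.delta)
qed

lemma has_sum_shift_arg:
  assumes j: "j \<in> {1..Suc q}" and s: "s \<in> arg_dom (Suc q) j n" and p: "p \<le> Suc n" and a: "a \<in> {1..q}"
  shows "((\<lambda>m. (\<Prod>i=1..q. of_nat (m i) powr - drop_arg j s i) * of_nat (m a) ^ p) has_sum
    mzeta_cont q (shift_arg q j a (- of_nat p) s)) (inctup q)"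
proof -
  have dom: "shift_arg q j a (- of_nat p) s \<in> mzeta_dom q" by (rule shift_arg_in_dom[OF j s p])
  have "((\<lambda>m. \<Prod>i=1..q. of_nat (m i) powr - shift_arg q j a (- of_nat p) s i) has_sum
    mzeta_cont q (shift_arg q j a (- of_nat p) s)) (inctup q)"
    unfolding mzeta_cont_dom[OF dom] mzeta_series_eq
    by (rule has_sum_infsum[OF mzeta_series_summable[OF dom]])
  then show ?thesis by (subst has_sum_cong[OF prod_shift_arg[OF _ a, symmetric]])
qed


lemma mzeta_series_insert:
  assumes j: "j \<in> {1..Suc q}" and dom: "t \<in> mzeta_dom (Suc q)"
  shows "mzeta_series (Suc q) t = (\<Sum>\<^sub>\<infinity>m\<in>inctup q. \<Sum>\<^sub>\<infinity>l\<in>gap j q m.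
    of_nat l powr - t j * (\<Prod>i=1..q. of_nat (m i) powr - drop_arg j t i))"
proof -
  let ?A = "Sigma (inctup q) (gap j q)"
  let ?F = "\<lambda>m. \<Prod>i=1..Suc q. of_nat (m i) powr - t i"
  let ?G = "\<lambda>m l. of_nat l powr - t j * (\<Prod>i=1..q. of_nat (m i) powr - drop_arg j t i)"
  have F: "?F ((\<lambda>(m, l). insert_at j q l m) ml) = (case ml of (m, l) \<Rightarrow> ?G m l)" for ml
    using prod_insert_at[OF j, of "\<lambda>i x. of_nat x powr - t i" "snd ml" "fst ml"]
    by (simp add: case_prod_unfold drop_arg_def del: prod.cl_ivl_Suc)
  have "(\<lambda>ml. ?F ((\<lambda>(m, l). insert_at j q l m) ml)) summable_on ?A"
    by (subst summable_on_reindex_bij_betw[OF bij_betw_insert_at[OF j]]) (rule mzeta_series_summable[OF dom])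
  then have summ: "(\<lambda>(m, l). ?G m l) summable_on ?A" unfolding F .
  have "mzeta_series (Suc q) t = (\<Sum>\<^sub>\<infinity>ml\<in>?A. ?F ((\<lambda>(m, l). insert_at j q l m) ml))"
    unfolding mzeta_series_eq by (rule infsum_reindex_bij_betw[symmetric, OF bij_betw_insert_at[OF j]])
  also have "\<dots> = (\<Sum>\<^sub>\<infinity>(m, l)\<in>?A. ?G m l)" unfolding F ..
  also have "\<dots> = (\<Sum>\<^sub>\<infinity>m\<in>inctup q. \<Sum>\<^sub>\<infinity>l\<in>gap j q m. ?G m l)"
    by (rule infsum_Sigma'_banach[symmetric, OF summ])
  finally show ?thesis .
qed

lemma has_sum_diff:
  fixes f g :: "'a \<Rightarrow> 'b :: real_normed_vector"
  assumes "(f has_sum a) A" "(g has_sum b) A"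
  shows "((\<lambda>x. f x - g x) has_sum (a - b)) A"
  using has_sum_add[OF assms(1), of "\<lambda>x. - g x" "- b"] assms(2) by (simp add: has_sum_uminus)

lemma has_sum_sum:
  fixes f :: "'i \<Rightarrow> 'a \<Rightarrow> 'b :: topological_comm_monoid_add"
  assumes "\<And>i. i \<in> B \<Longrightarrow> (f i has_sum a i) A"
  shows "((\<lambda>x. \<Sum>i\<in>B. f i x) has_sum (\<Sum>i\<in>B. a i)) A"
  using assms
  by (induction B rule: infinite_finite_induct) (auto intro: has_sum_0 has_sum_add)

text \<open>\<open>mzeta_above\<close> and \<open>mzeta_below\<close> are the sums in which the \<open>p\<close>-th power of the entry after
  respectively before the omitted position is inserted; the entry before the first one is \<open>0\<close>.\<close>

definition mzeta_above :: "nat \<Rightarrow> nat \<Rightarrow> nat \<Rightarrow> (nat \<Rightarrow> complex) \<Rightarrow> complex"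
  where "mzeta_above q j p s = (if j \<le> q then mzeta_cont q (shift_arg q j j (- of_nat p) s) else 0)"

definition mzeta_below :: "nat \<Rightarrow> nat \<Rightarrow> nat \<Rightarrow> (nat \<Rightarrow> complex) \<Rightarrow> complex"
  where "mzeta_below q j p s =
    (if j = 1 then if p = 0 then mzeta_above q j 0 s else 0
     else mzeta_cont q (shift_arg q j (j - 1) (- of_nat p) s))"

text \<open>Everything converges here, so m_j may be summed first: Faulhaber's formula expresses the
  inner sum by powers of the two neighbouring entries, and each power shifts an exponent.\<close>

lemma mzeta_fix_arg_middle:
  assumes j: "j \<in> {1..q}" and s: "s \<in> arg_dom (Suc q) j n"
  shows "mzeta_cont (Suc q) (fix_arg (Suc q) j (- of_nat n) s) =
    (\<Sum>i\<le>Suc n. of_nat (Suc n choose i) * bern i *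
       (mzeta_above q j (Suc n - i) s - mzeta_below q j (Suc n - i) s)) / of_nat (Suc n)
    - mzeta_above q j n s"
proof -
  have j': "j \<in> {1..Suc q}" using j by auto
  define N where "N = Suc n"
  define P where "P m = (\<Prod>i=1..q. of_nat (m i) powr - drop_arg j s i)" for m :: "nat \<Rightarrow> nat"
  let ?t = "fix_arg (Suc q) j (- of_nat n) s"
  have dom: "?t \<in> mzeta_dom (Suc q)" by (rule fix_arg_in_dom[OF j s])
  have tj: "?t j = - of_nat n" using j by (simp add: fix_arg_def)
  have Pt: "(\<Prod>i=1..q. of_nat (m i) powr - drop_arg j ?t i) = P m" for m :: "nat \<Rightarrow> nat"
    unfolding P_def using j by (intro prod.cong) (auto simp: drop_arg_def fix_arg_def)
  have above: "((\<lambda>m. P m * of_nat (m j) ^ p) has_sum mzeta_above q j p s) (inctup q)" if "p \<le> N" for p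
    using has_sum_shift_arg[OF j' s _ j, of p] that j by (simp add: N_def P_def mzeta_above_def)
  have below: "((\<lambda>m. P m * of_nat (pred_entry j m) ^ p) has_sum mzeta_below q j p s) (inctup q)" if p: "p \<le> N" for p
  proof (cases "j = 1")
    case True
    show ?thesis
    proof (cases "p = 0")
      case True
      \<comment> \<open>Here the neighbour below is 0 and \<open>0 ^ 0 = 1\<close>. This is the
        source of the product term for j = 1.\<close>
      then show ?thesis using above[of 0] \<open>j = 1\<close> by (simp add: mzeta_below_def)
    next
      case False
      then show ?thesis using \<open>j = 1\<close> by (simp add: mzeta_below_def pred_entry_def power_0_left has_sum_0)
    qed
  next
    case False
    then have "j - 1 \<in> {1..q}" using j by auto
    from has_sum_shift_arg[OF j' s _ this, of p] show ?thesis
      using p False by (simp add: N_def P_def mzeta_below_def pred_entry_def)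
  qed
  have inner: "(\<Sum>\<^sub>\<infinity>l\<in>gap j q m. of_nat l powr - ?t j * P m) =
     (\<Sum>i\<le>N. of_nat (N choose i) * bern i / of_nat N *
        (P m * of_nat (m j) ^ (N - i) - P m * of_nat (pred_entry j m) ^ (N - i))) - P m * of_nat (m j) ^ n"
    if m: "m \<in> inctup q" for m
  proof -
    let ?a = "pred_entry j m" and ?b = "m j"
    have ab: "?a < ?b"
      using inctupD(2)[OF m, of j] inctupD(3)[OF m, of "j - 1" j] j by (auto simp: pred_entry_def)
    \<comment> \<open>Faulhaber's sum includes the upper end m j; removing it produces the final -
      \<open>mzeta_above q j n s\<close>.\<close>
    have gap: "gap j q m = {?a<..?b} - {?b}" using j by (auto simp: gap_def)
    have "(\<Sum>\<^sub>\<infinity>l\<in>gap j q m. of_nat l powr - ?t j * P m) = (\<Sum>l\<in>gap j q m. of_nat l powr - ?t j * P m)"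
      by (rule infsum_finite) (simp add: gap)
    also have "\<dots> = (\<Sum>l\<in>{?a<..?b} - {?b}. P m * of_nat l ^ n)"
      unfolding gap tj by (rule sum.cong) (auto simp: powr_nat)
    also have "\<dots> = P m * (\<Sum>l\<in>{?a<..?b}. of_nat l ^ n) - P m * of_nat ?b ^ n"
      using ab by (simp add: sum_diff1 sum_distrib_left)
    also have "(\<Sum>l\<in>{?a<..?b}. of_nat l ^ n :: complex) =
        (\<Sum>i\<le>N. of_nat (N choose i) * bern i * (of_nat ?b ^ (N - i) - of_nat ?a ^ (N - i))) / of_nat N"
    proof -
      have "of_nat N * (\<Sum>l\<in>{?a<..?b}. of_nat l ^ n :: complex) =
          (\<Sum>i\<le>N. of_nat (N choose i) * bern i * (of_nat ?b ^ (N - i) - of_nat ?a ^ (N - i)))"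
        using faulhaber[of N ?a ?b] ab by (simp add: N_def sum_distrib_left del: of_nat_Suc binomial_Suc_Suc)
      moreover have "of_nat N \<noteq> (0 :: complex)" by (simp add: N_def del: of_nat_Suc)
      ultimately show ?thesis by (simp add: nonzero_eq_divide_eq mult.commute)
    qed
    also have "P m * (\<dots>) = (\<Sum>i\<le>N. of_nat (N choose i) * bern i / of_nat N *
        (P m * of_nat ?b ^ (N - i) - P m * of_nat ?a ^ (N - i)))"
      unfolding sum_divide_distrib sum_distrib_left
      by (rule sum.cong) (simp_all add: algebra_simps diff_divide_distrib)
    finally show ?thesis .
  qed
  have "((\<lambda>m. (\<Sum>i\<le>N. of_nat (N choose i) * bern i / of_nat N *
        (P m * of_nat (m j) ^ (N - i) - P m * of_nat (pred_entry j m) ^ (N - i))) - P m * of_nat (m j) ^ n)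
     has_sum ((\<Sum>i\<le>N. of_nat (N choose i) * bern i / of_nat N *
        (mzeta_above q j (N - i) s - mzeta_below q j (N - i) s)) - mzeta_above q j n s)) (inctup q)"
    by (intro has_sum_diff has_sum_sum has_sum_cmult_right above below) (auto simp: N_def)
  then have "(\<Sum>\<^sub>\<infinity>m\<in>inctup q. \<Sum>\<^sub>\<infinity>l\<in>gap j q m. of_nat l powr - ?t j * P m) =
      (\<Sum>i\<le>N. of_nat (N choose i) * bern i / of_nat N *
        (mzeta_above q j (N - i) s - mzeta_below q j (N - i) s)) - mzeta_above q j n s"
    by (subst infsum_cong[OF inner]) (auto intro: infsumI)
  then show ?thesis
    unfolding mzeta_cont_dom[OF dom] mzeta_series_insert[OF j' dom] Pt N_def[symmetric]
    by (simp add: sum_divide_distrib)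
qed

text \<open>No series is available at depth Suc q. The numerator is evaluated by
  \<open>em_sum\<close> with K so large that the remainder is 0, and binomial coefficients end the
  sum at N; only the merged tuples of depth q lie in the domain of convergence.\<close>

lemma mzeta_fix_arg_last:
  assumes q: "q \<ge> 1" and s: "s \<in> arg_dom (Suc q) (Suc q) n"
  shows "mzeta_cont (Suc q) (fix_arg (Suc q) (Suc q) (- of_nat n) s) =
    - (\<Sum>i\<le>Suc n. of_nat (Suc n choose i) * bern i *
         mzeta_cont q (shift_arg q (Suc q) q (- of_nat (Suc n - i)) s)) / of_nat (Suc n)"
proof -
  define N where "N = Suc n"
  let ?t = "fix_arg (Suc q) (Suc q) (- of_nat n) s"
  have ext: "?t \<in> extensional {1..Suc q}" by (simp add: fix_arg_def)
  have tq: "?t (Suc q) = - of_nat n" by (simp add: fix_arg_def)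
  obtain K0 where K0: "?t \<in> em_dom (Suc q) K0" using em_dom_exhaust[OF ext] .
  define K where "K = max K0 (Suc N)"
  have K: "?t \<in> em_dom (Suc q) K" "Suc N \<le> K"
    using K0 em_dom_mono[of K0 K] by (auto simp: K_def)
  have merge_last: "merge_last q i ?t = shift_arg q (Suc q) q (- of_nat (N - i)) s" if "i \<le> N" for i
    using that q by (auto simp: merge_last_def shift_arg_def fix_arg_def drop_arg_def N_def fun_eq_iff of_nat_diff)
  have summand: "hquot q i ?t * mzeta_num q (merge_last q i ?t) =
      hprod (Suc q) ?t * mzeta_cont q (shift_arg q (Suc q) q (- of_nat (N - i)) s)" if i: "i \<le> N" for i
  proof -
    have dom: "merge_last q i ?t \<in> mzeta_dom q"
      unfolding merge_last[OF i] by (rule shift_arg_in_dom[OF _ s]) (auto simp: N_def)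
    show ?thesis
      using mzeta_num(2)[OF dom] mzeta_cont_dom[OF dom] hquot[OF q, of ?t i] merge_last[OF i] by simp
  qed
  have w: "1 - ?t (Suc q) = of_nat N" by (simp add: tq N_def)
  \<comment> \<open>The conditions for k \<le> q still hold on the hyperplane; only the one for k =
    Suc q fails.\<close>
  have hp: "hprod (Suc q) ?t \<noteq> 0"
  proof -
    have "zsum (Suc q) k ?t \<notin> \<int>\<^sub>\<le>\<^sub>0" if k: "k \<in> {1..<Suc q}" for k
    proof -
      have "(\<Sum>i=k..q. real (n + 2)) < (\<Sum>i=k..q. Re (s i))"
        using k by (intro sum_strict_mono arg_domD[OF s]) auto
      then have 1: "real (Suc q - k) * real (n + 2) < (\<Sum>i=k..q. Re (s i))" by simp
      \<comment> \<open>Equivalent to (d - 1) * (n + 1) \<ge> 0 with d = Suc q - k \<ge> 1.\<close>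
      have 2: "real (Suc q - k) * real (n + 2) \<ge> real (Suc q - k) + real n + 1"
      proof -
        define d where "d = real (Suc q - k)"
        have "0 \<le> (d - 1) * (real n + 1)"
          using k by (intro mult_nonneg_nonneg) (auto simp: d_def)
        then show ?thesis unfolding d_def[symmetric] by (simp add: ring_distribs)
      qed
      have 3: "(\<Sum>i=k..q. Re (?t i)) = (\<Sum>i=k..q. Re (s i))"
        using k by (intro sum.cong) (auto simp: fix_arg_def)
      have "Re (zsum (Suc q) k ?t) = (\<Sum>i=k..q. Re (?t i)) - real n - real (Suc (Suc q) - k)"
        using k tq by (simp add: zsum_def)
      moreover have "real (Suc (Suc q) - k) = real (Suc q - k) + 1" using k by (simp add: Suc_diff_le)
      ultimately have "Re (zsum (Suc q) k ?t) > 0" using 1 2 3 by linarith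
      then show ?thesis by (auto elim!: nonpos_Ints_cases)
    qed
    then show ?thesis by (auto simp: hprod_def rGamma_eq_zero_iff)
  qed
  have den: "mzeta_den (Suc q) ?t = - of_nat N * hprod (Suc q) ?t"
    by (simp add: mzeta_den_def tq N_def)
  have N0: "of_nat N \<noteq> (0 :: complex)" by (simp add: N_def del: of_nat_Suc)
  have num: "mzeta_num (Suc q) ?t = em_sum q (mzeta_num q) K ?t"
    by (rule mzeta_num_em_sum[OF _ K(1)], erule mzeta_num(2))
  also have "\<dots> = (\<Sum>i<K. of_nat (N choose i) * bern i * (hquot q i ?t * mzeta_num q (merge_last q i ?t)))"
    using q em_rem_neg_nat[of q ?t n K, OF q tq] K(2) unfolding em_sum_def w
    by (simp add: N_def binomial_gbinomial)
  also have "\<dots> = (\<Sum>i\<le>N. of_nat (N choose i) * bern i * (hquot q i ?t * mzeta_num q (merge_last q i ?t)))"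
    using K(2) by (intro sum.mono_neutral_right) (auto simp: binomial_eq_0)
  also have "\<dots> = hprod (Suc q) ?t * (\<Sum>i\<le>N. of_nat (N choose i) * bern i *
         mzeta_cont q (shift_arg q (Suc q) q (- of_nat (N - i)) s))"
    unfolding sum_distrib_left by (rule sum.cong) (auto simp: summand)
  finally show ?thesis
    unfolding N_def[symmetric] using mzeta_cont_eq[OF ext] den hp N0 by simp
qed

text \<open>The term i = 0 is split off; for i = k + 1 the binomial coefficient of n + 1 over k + 1,
  divided by n + 1, is that of n over k divided by k + 1, and B_(k+1)/(k + 1) = -zeta(-k).\<close>

lemma bern_sum_zeta:
  "(\<Sum>i\<le>Suc n. of_nat (Suc n choose i) * bern i * X (Suc n - i)) / of_nat (Suc n) =
    X (Suc n) / of_nat (Suc n) - (\<Sum>k=0..n. of_nat (n choose k) * X (n - k) * zeta (- of_nat k))"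
proof -
  have N0: "of_nat (Suc n) \<noteq> (0 :: complex)" by (simp del: of_nat_Suc)
  have "of_nat (Suc n choose Suc k) * bern (Suc k) * X (Suc n - Suc k) / of_nat (Suc n) =
      - (of_nat (n choose k) * X (n - k) * zeta (- of_nat k))" for k
  proof -
    have k0: "of_nat (Suc k) \<noteq> (0 :: complex)" by (simp del: of_nat_Suc)
    have "Suc k * (Suc n choose Suc k) = Suc n * (n choose k)"
      using Suc_times_binomial_eq[of n k] by (simp only: mult.commute)
    then have "of_nat (Suc k) * of_nat (Suc n choose Suc k) = (of_nat (Suc n) * of_nat (n choose k) :: complex)"
      by (metis of_nat_mult)
    then have "of_nat (Suc n choose Suc k) / of_nat (Suc n) = (of_nat (n choose k) / of_nat (Suc k) :: complex)"
      using N0 k0 by (simp add: frac_eq_eq mult.commute del: of_nat_Suc binomial_Suc_Suc)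
    then show ?thesis unfolding zeta_neg_nat
      by (simp del: of_nat_Suc binomial_Suc_Suc add: field_simps) 
  qed
  then show ?thesis
    unfolding sum.atMost_Suc_shift add_divide_distrib sum_divide_distrib atLeast0AtMost
    by (simp add: bern_0 sum_negf del: of_nat_Suc binomial_Suc_Suc)
qed

lemma mzeta_fix_arg_eq:
  assumes j: "j \<in> {1..Suc q}" and q: "q \<ge> 1" and s: "s \<in> arg_dom (Suc q) j n"
  shows "mzeta_cont (Suc q) (fix_arg (Suc q) j (- of_nat n) s) =
    (mzeta_above q j (Suc n) s - mzeta_below q j (Suc n) s) / of_nat (Suc n)
    - (\<Sum>k=0..n. of_nat (n choose k) * (mzeta_above q j (n - k) s - mzeta_below q j (n - k) s) * zeta (- of_nat k))
    - mzeta_above q j n s"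
proof (cases "j = Suc q")
  case False
  then have "j \<in> {1..q}" using j by auto
  from mzeta_fix_arg_middle[OF this s] show ?thesis
    unfolding bern_sum_zeta[of n "\<lambda>p. mzeta_above q j p s - mzeta_below q j p s"] .
next
  case True
  define X where "X p = mzeta_cont q (shift_arg q (Suc q) q (- of_nat p) s)" for p
  have ab: "mzeta_above q (Suc q) p s = 0" "mzeta_below q (Suc q) p s = X p" for p
    using q by (auto simp: mzeta_above_def mzeta_below_def X_def)
  have "mzeta_cont (Suc q) (fix_arg (Suc q) (Suc q) (- of_nat n) s) =
      - ((\<Sum>i\<le>Suc n. of_nat (Suc n choose i) * bern i * X (Suc n - i)) / of_nat (Suc n))"
    using mzeta_fix_arg_last[OF q, of s n] s True by (simp only: minus_divide_left X_def)
  then show ?thesis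
    unfolding True ab bern_sum_zeta by (simp add: sum_negf del: of_nat_Suc)
qed

theorem theorem2p14:
  fixes r j n :: nat
  assumes "r \<ge> 2" and "j \<in> {1..r}"
  shows "mero_eq ({1..r} - {j})
    (\<lambda>s. mzeta (seg s 1 (j - 1) @ [- of_nat n] @ seg s (j + 1) r))
    (\<lambda>s.
      - (1 - kdelta j 1) * (1 / (of_nat n + 1)) *
          mzeta (seg s 1 (j - 2) @ [s (j - 1) - of_nat n - 1] @ seg s (j + 1) r)
      + (1 - kdelta j r) * (1 / (of_nat n + 1)) *
          mzeta (seg s 1 (j - 1) @ [- of_nat n + s (j + 1) - 1] @ seg s (j + 2) r)
      + (1 - kdelta j 1) * (\<Sum>k=0..n. of_nat (n choose k) *
          mzeta (seg s 1 (j - 2) @ [s (j - 1) - of_nat n + of_nat k] @ seg s (j + 1) r) *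
          zeta (- of_nat k))
      - (1 - kdelta j r) * (\<Sum>k=0..n. of_nat (n choose k) *
          mzeta (seg s 1 (j - 1) @ [- of_nat n + s (j + 1) + of_nat k] @ seg s (j + 2) r) *
          zeta (- of_nat k))
      + kdelta j 1 * (1 - kdelta j r) *
          mzeta (seg s 1 (j - 1) @ [- of_nat n]) * mzeta (seg s (j + 1) r)
      + (kdelta j r - 1) *
          mzeta (seg s 1 (j - 1) @ [- of_nat n + s (j + 1)] @ seg s (j + 2) r))"
    (is "mero_eq ?I ?lhs ?rhs")
proof -
  define q where "q = r - 1"
  have r: "r = Suc q" "q \<ge> 1" using assms by (auto simp: q_def)
  note j = assms(2)[unfolded r(1)]
  have I: "finite ?I" by simp
  \<comment> \<open>The right-hand side without Kronecker deltas: \<open>mzeta_above\<close> is 0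
    for j = r, and \<open>mzeta_below\<close> for j = 1 encodes the powers of 0.\<close>
  define R where "R s = (mzeta_above q j (Suc n) s - mzeta_below q j (Suc n) s) * (1 / of_nat (Suc n))
    - (\<Sum>k=0..n. of_nat (n choose k) * (mzeta_above q j (n - k) s - mzeta_below q j (n - k) s) * zeta (- of_nat k))
    - mzeta_above q j n s" for s
  have lhs: "?lhs = (\<lambda>s. mzeta_cont r (fix_arg r j (- of_nat n) s))"
    by (rule ext, rule mzeta_fix_arg[OF assms(2)])
  have above: "quot ?I (mzeta_above q j p)" for p
    unfolding mzeta_above_def[abs_def] r(1)
    using quot_shift_arg[OF j r(2)] quot_const by (cases "j \<le> q") auto
  have below: "quot ?I (mzeta_below q j p)" for p
    unfolding mzeta_below_def[abs_def] using quot_shift_arg[OF j r(2)] quot_const above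
    by (cases "j = 1"; cases "p = 0") (auto simp: r(1))
  have quot_R: "quot ?I R"
    unfolding R_def[abs_def]
    by (intro quot_diff[OF I] quot_mult[OF I] quot_sum[OF I] quot_const above below)
  have kd: "kdelta a b = 1 \<longleftrightarrow> a = b" "kdelta a b = 0 \<longleftrightarrow> a \<noteq> b" for a b by (auto simp: kdelta_def)
  have lower: "mzeta (seg s 1 (j - 2) @ [x] @ seg s (j + 1) r) = mzeta_below q j p s"
    if "j \<noteq> 1" "x = s (j - 1) - of_nat p" for s x p
  proof -
    have "mzeta (seg s 1 (j - 2) @ [x] @ seg s (j + 1) (Suc q)) = mzeta_cont q (shift_arg q j (j - 1) (- of_nat p) s)"
      by (rule mzeta_shift_arg_pred) (use that j in auto)
    then show ?thesis using that by (simp only: mzeta_below_def r(1) if_False)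
  qed
  have upper: "mzeta (seg s 1 (j - 1) @ [x] @ seg s (j + 2) r) = mzeta_above q j p s"
    if "j \<noteq> r" "x = s (j + 1) - of_nat p" for s x p
  proof -
    have jq: "j \<le> q" using that j r(1) by auto
    have "mzeta (seg s 1 (j - 1) @ [x] @ seg s (j + 2) (Suc q)) = mzeta_cont q (shift_arg q j j (- of_nat p) s)"
      by (rule mzeta_shift_arg_succ) (use that j jq in auto)
    then show ?thesis using jq by (simp only: mzeta_above_def r(1) if_True)
  qed
  have rhs: "?rhs = R"
  proof
    fix s
    define A where "A = (\<Sum>k=0..n. of_nat (n choose k) * mzeta_above q j (n - k) s * zeta (- of_nat k))"
    define B where "B = (\<Sum>k=0..n. of_nat (n choose k) * mzeta_below q j (n - k) s * zeta (- of_nat k))"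
    have R: "R s = (mzeta_above q j (Suc n) s - mzeta_below q j (Suc n) s) * (1 / (of_nat n + 1)) - (A - B) - mzeta_above q j n s"
      by (simp add: R_def A_def B_def right_diff_distrib left_diff_distrib sum_subtractf add.commute)
    have lower_s: "mzeta (seg s 1 (j - 2) @ [s (j - 1) - of_nat n - 1] @ seg s (j + 1) r) = mzeta_below q j (Suc n) s"
      "(\<Sum>k=0..n. of_nat (n choose k) *
          mzeta (seg s 1 (j - 2) @ [s (j - 1) - of_nat n + of_nat k] @ seg s (j + 1) r) *
          zeta (- of_nat k)) = B" if "j \<noteq> 1"
      unfolding B_def
      by (rule lower[OF that], simp)
        (rule sum.cong[OF refl], subst lower[OF that], auto simp: of_nat_diff)
    have upper_s: "mzeta (seg s 1 (j - 1) @ [- of_nat n + s (j + 1) - 1] @ seg s (j + 2) r) = mzeta_above q j (Suc n) s"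
      "mzeta (seg s 1 (j - 1) @ [- of_nat n + s (j + 1)] @ seg s (j + 2) r) = mzeta_above q j n s"
      "(\<Sum>k=0..n. of_nat (n choose k) *
          mzeta (seg s 1 (j - 1) @ [- of_nat n + s (j + 1) + of_nat k] @ seg s (j + 2) r) *
          zeta (- of_nat k)) = A" if "j \<noteq> r"
      unfolding A_def
      by (rule upper[OF that], simp, rule upper[OF that], simp)
        (rule sum.cong[OF refl], subst upper[OF that], auto simp: of_nat_diff)
    consider "j = 1" "j \<noteq> r" | "j \<noteq> 1" "j = r" | "j \<noteq> 1" "j \<noteq> r" using assms(1) by fastforce
    then show "?rhs s = R s"
    proof cases
      case 1
      have k: "kdelta j 1 = 1" "kdelta j r = 0" using 1 kd by auto
      have below: "mzeta_below q j p s = (if p = 0 then mzeta_above q j 0 s else 0)" for p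
        using 1 by (simp add: mzeta_below_def)
      \<comment> \<open>Only k = n gives the power 0 ^ 0, so B collapses to the product of zeta(-n)
        with the zeta function of the remaining variables.\<close>
      have "B = (\<Sum>k=0..n. if k = n then mzeta_above q j 0 s * zeta (- of_nat n) else 0)"
        unfolding B_def below by (rule sum.cong) auto
      then have B: "B = zeta (- of_nat n) * mzeta_above q j 0 s" by (simp add: mult.commute)
      have first: "mzeta (seg s 1 (j - 1) @ [- of_nat n]) = zeta (- of_nat n)" using 1 by simp
      have rest: "mzeta (seg s (j + 1) r) = mzeta_above q j 0 s"
        using mzeta_drop_first[of s q 1] 1 r by (simp add: mzeta_above_def numeral_2_eq_2 del: upt_Suc)
      show ?thesis
        unfolding R upper_s[OF 1(2)] k first rest B below[of "Suc n"] by simp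
    next
      case 2
      have k: "kdelta j 1 = 0" "kdelta j r = 1" using 2 kd by auto
      have above: "mzeta_above q j p s = 0" for p using 2 r by (simp add: mzeta_above_def)
      have "A = 0" by (simp add: A_def above)
      then show ?thesis
        unfolding R lower_s[OF 2(1)] k above by simp
    next
      case 3
      have k: "kdelta j 1 = 0" "kdelta j r = 0" using 3 kd by auto
      show ?thesis
        unfolding R lower_s[OF 3(1)] upper_s[OF 3(2)] k by (simp add: algebra_simps diff_divide_distrib)
    qed
  qed
  have "mero_eq ?I (\<lambda>s. mzeta_cont r (fix_arg r j (- of_nat n) s)) R"
  \<comment> \<open>Both sides are quotients of entire functions in the free variables, so the
    identity on \<open>arg_dom\<close> suffices.\<close>
  proof (rule quot_mero_eqI[OF I quot_fix_arg[OF assms(2,1)] quot_R openin_arg_dom arg_dom_nonempty])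
    fix s assume "s \<in> arg_dom r j n"
    then show "mzeta_cont r (fix_arg r j (- of_nat n) s) = R s"
      using mzeta_fix_arg_eq[OF j r(2), of s n] by (simp add: r(1) R_def)
  qed
  then show ?thesis unfolding lhs rhs .
qed

end
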